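(* Let $X$ be a Fréchet space with a Schauder basis and without continuous norm, and let $(p_j)_{j\ge 1}$ be an increasing sequence of seminorms inducing the topology of $X$. Then $X$ satisfies the Invariant Subspace Property if and only if there exists $j_0\ge 1$ such that, for every $j\ge j_0$, $\ker p_{j+1}$ is of finite codimension in $\ker p_j$.
   Context: Spaces are over $\mathbb{K}=\mathbb{R}$ or $\mathbb{C}$. $L(X)$ denotes the space of continuous linear operators from $X$ to $X$. A Fréchet space $X$ satisfies the Invariant Subspace Property if every $T\in L(X)$ possesses a non-trivial invariant subspace, i.e. a closed subspace $M$ of $X$ with $M\ne\{0\}$, $M\neq X$ and $TM\subset M$. A Fréchet space is without continuous norm if no continuous seminorm on it is a norm (equivalently, no $p_j$ is a norm). Increasing means $p_j(x)\le p_{j+1}(x)$ for all $x\in X$ and $j\ge 1$. *)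

theory Defs
  imports "HOL-Analysis.Analysis"
begin

text \<open>
  The carrier of a space is a whole type, whose (Hausdorff) topology is the one of its type
  class. Scalar multiplication is an explicit parameter, as in the library's
  \<^locale>\<open>vector_space\<close>, so that the same definitions serve for real and for complex spaces.
\<close>

definition seminorm :: "('k::real_normed_field \<Rightarrow> 'a::ab_group_add \<Rightarrow> 'a) \<Rightarrow> ('a \<Rightarrow> real) \<Rightarrow> bool" where
  "seminorm smul p \<longleftrightarrow>
     (\<forall>x. 0 \<le> p x) \<and>
     (\<forall>x y. p (x + y) \<le> p x + p y) \<and>
     (\<forall>c x. p (smul c x) = norm c * p x)"

definition seminorm_ker :: "('a::ab_group_add \<Rightarrow> real) \<Rightarrow> 'a set" where
  "seminorm_ker p = {x. p x = 0}"

text \<open>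
  The translates of finite intersections of open balls of seminorms in \<open>P\<close> form a base of the
  topology; \<open>P\<close> need not be directed.
\<close>

definition induces_topology :: "('a::{ab_group_add,topological_space} \<Rightarrow> real) set \<Rightarrow> bool" where
  "induces_topology P \<longleftrightarrow>
     (\<forall>U. open U \<longleftrightarrow>
        (\<forall>x\<in>U. \<exists>F \<epsilon>. finite F \<and> F \<subseteq> P \<and> 0 < \<epsilon> \<and> {y. \<forall>p\<in>F. p (y - x) < \<epsilon>} \<subseteq> U))"

definition tvs_Cauchy :: "(nat \<Rightarrow> 'a::{ab_group_add,topological_space}) \<Rightarrow> bool" where
  "tvs_Cauchy u \<longleftrightarrow>
     (\<forall>U. open U \<and> 0 \<in> U \<longrightarrow> (\<exists>N. \<forall>m\<ge>N. \<forall>n\<ge>N. u m - u n \<in> U))"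

text \<open>
  The topology is given by countably many seminorms, hence first countable, so completeness
  can be expressed with sequences. Hausdorffness comes from the class \<^class>\<open>t2_space\<close>.
\<close>

definition frechet_space :: "('k::real_normed_field \<Rightarrow> 'a::{ab_group_add,t2_space} \<Rightarrow> 'a) \<Rightarrow> bool" where
  "frechet_space smul \<longleftrightarrow>
     vector_space smul \<and>
     (\<exists>p :: nat \<Rightarrow> 'a \<Rightarrow> real. (\<forall>j. seminorm smul (p j)) \<and> induces_topology (range p)) \<and>
     (\<forall>u :: nat \<Rightarrow> 'a. tvs_Cauchy u \<longrightarrow> convergent u)"

text \<open>
  Continuity of the coefficient functionals is not required: in a Frechet space it is automatic.
\<close>

definition schauder_basis ::
  "('k::real_normed_field \<Rightarrow> 'a::{ab_group_add,t2_space} \<Rightarrow> 'a) \<Rightarrow> (nat \<Rightarrow> 'a) \<Rightarrow> bool" where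
  "schauder_basis smul e \<longleftrightarrow>
     (\<forall>x. \<exists>!a :: nat \<Rightarrow> 'k. (\<lambda>n. smul (a n) (e n)) sums x)"

definition without_continuous_norm ::
  "('k::real_normed_field \<Rightarrow> 'a::{ab_group_add,t2_space} \<Rightarrow> 'a) \<Rightarrow> bool" where
  "without_continuous_norm smul \<longleftrightarrow>
     \<not> (\<exists>q. seminorm smul q \<and> continuous_on UNIV q \<and> (\<forall>x. q x = 0 \<longrightarrow> x = 0))"

text \<open>
  The sequence is indexed from 1; the value \<open>p 0\<close> is irrelevant.
\<close>

definition increasing_inducing_seminorms ::
  "('k::real_normed_field \<Rightarrow> 'a::{ab_group_add,t2_space} \<Rightarrow> 'a) \<Rightarrow> (nat \<Rightarrow> 'a \<Rightarrow> real) \<Rightarrow> bool" where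
  "increasing_inducing_seminorms smul p \<longleftrightarrow>
     (\<forall>j\<ge>1. seminorm smul (p j)) \<and>
     (\<forall>j\<ge>1. \<forall>x. p j x \<le> p (j + 1) x) \<and>
     induces_topology (p ` {1..})"

definition invariant_subspace_property ::
  "('k::real_normed_field \<Rightarrow> 'a::{ab_group_add,t2_space} \<Rightarrow> 'a) \<Rightarrow> bool" where
  "invariant_subspace_property smul \<longleftrightarrow>
     (\<forall>T. Vector_Spaces.linear smul smul T \<and> continuous_on UNIV T \<longrightarrow>
        (\<exists>M. module.subspace smul M \<and> closed M \<and> M \<noteq> {0} \<and> M \<noteq> UNIV \<and> T ` M \<subseteq> M))"

text \<open>
  The quotient \<open>V / W\<close> is finite-dimensional, i.e. spanned by the classes of finitely many
  elements of \<open>V\<close>. Meant for subspaces \<open>V\<close> and \<open>W\<close>.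
\<close>

definition finite_codim_in ::
  "('k::field \<Rightarrow> 'a::ab_group_add \<Rightarrow> 'a) \<Rightarrow> 'a set \<Rightarrow> 'a set \<Rightarrow> bool" where
  "finite_codim_in smul W V \<longleftrightarrow>
     W \<subseteq> V \<and>
     (\<exists>B. finite B \<and> B \<subseteq> V \<and> (\<forall>v\<in>V. \<exists>b\<in>module.span smul B. v - b \<in> W))"

end

theory Submission
  imports Defs
begin

text \<open>
  Write \<open>Ker j\<close> for the kernel of the \<open>j\<close>-th seminorm. As no seminorm is a norm, these kernels form a
  decreasing sequence of nonzero closed subspaces with intersection \<open>0\<close>. An operator \<open>T\<close> is continuous
  iff every \<open>p j (T x)\<close> is bounded by a multiple of some \<open>p k x\<close>; in particular \<open>T\<close> maps \<open>Ker k\<close> to \<open>Ker j\<close>.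

  \<^bold>\<open>Finite codimension gives invariant subspaces.\<close> Let all codimensions be finite from \<open>j1\<close> on and put
  \<open>Z = Ker j1\<close>, a proper subspace for \<open>j1\<close> large. Then \<open>Z\<close> is a copy of the space of all scalar
  sequences, and like that space it is linearly compact (\<open>linear_compactness\<close>). Consequently, countably
  many continuous functionals that are linearly independent on \<open>Z\<close> take any prescribed values at some
  point of \<open>Z\<close>, and finitely many coordinate functionals \<open>f\<^sub>i\<close> suffice to cut out of \<open>Z\<close> a subspace
  that \<open>T\<close> maps into \<open>Z\<close>. If the functionals \<open>f\<^sub>i \<circ> T\<^sup>k\<close>, \<open>k \<ge> 0\<close>, are independent on \<open>Z\<close> for some \<open>i\<close>, choose
  \<open>y \<notin> Z\<close> and \<open>z \<in> Z\<close> on which they agree: their common kernel is invariant and contains \<open>y - z \<noteq> 0\<close>.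
  Otherwise they satisfy a linear recursion on \<open>Z\<close> for each \<open>i\<close>, and finitely many conditions
  \<open>f\<^sub>i (T\<^sup>k x) = 0\<close> define an invariant subspace of \<open>Z\<close>; it is nonzero since it contains some \<open>Ker m\<close>.

  \<^bold>\<open>Infinite codimension gives an operator without invariant subspaces.\<close> By the open mapping argument the
  suprema \<open>q j\<close> of \<open>p j\<close> over the partial sums of a basis expansion define the same topology. Their
  kernels are spanned by basis vectors, so after passing to a subsequence the basis splits into
  infinitely many infinite levels: a vector of level \<open>l\<close> is invisible to the seminorms
  before the \<open>l\<close>-th one and visible to that one and all later ones. The operator is determined by the orbit
  \<open>u\<^sub>k = T\<^sup>k u\<^sub>0\<close>, where \<open>u\<^sub>k = \<lambda>\<^sub>k e\<^sub>k\<close>, possibly plus an earlier \<open>u\<^sub>i\<close>, for a suitable enumeration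
  \<open>(e\<^sub>k)\<close> of the basis. Continuity only restricts how a vector may descend in level: going up is free, and
  a vector that descends slowly may be given sizes \<open>\<lambda>\<^sub>k\<close> that make its images as small as
  desired (\<open>shifted_bound\<close>). So one may jump to a very high level, come back with huge coefficients
  and let \<open>T\<^sup>m u\<^sub>0\<close> return to \<open>u\<^sub>0\<close>, up to vectors that a given seminorm does not see.

  For a nonzero \<open>x\<close> the truncation of \<open>x\<close> at a position \<open>n\<close> is \<open>Y(T) u\<^sub>0\<close> for a polynomial \<open>Y\<close>
  of degree at most \<open>n\<close>, normalised by scaling \<open>x\<close>. A polynomial \<open>P\<close> with coefficients bounded independently of \<open>Y\<close>
  makes \<open>P Y\<close> close to \<open>t\<^sup>n\<close> in all relevant degrees (\<open>approx_inverse\<close>), so a return at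
  time \<open>m\<close> makes \<open>T\<^bsup>m-n\<^esup> P(T) x\<close> close to \<open>u\<^sub>0\<close>, apart from the tail of \<open>x\<close> (\<open>poly_op_head\<close>). On the tail,
  \<open>P\<close> meets vectors of higher level or vectors whose size was chosen after the bound on \<open>P\<close>
  (\<open>poly_op_tail\<close>). Hence every nonzero vector is cyclic (\<open>no_invariant_subspace\<close>).
\<close>

section \<open>Spaces whose topology is given by an increasing sequence of seminorms\<close>

text \<open>
  The scalars range over a complete normed field, which covers the real and the complex case at once.
\<close>

locale graded_space = vector_space smul
  for smul :: "'k::{real_normed_field,banach} \<Rightarrow> 'a::{ab_group_add,t2_space} \<Rightarrow> 'a"  (infixr "\<odot>" 75) +
  fixes p :: "nat \<Rightarrow> 'a \<Rightarrow> real"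
  assumes seminorm_p: "seminorm smul (p j)"
    and p_Suc: "p j x \<le> p (Suc j) x"
    and open_iff: "open U \<longleftrightarrow> (\<forall>x\<in>U. \<exists>j \<epsilon>. 0 < \<epsilon> \<and> {y. p j (y - x) < \<epsilon>} \<subseteq> U)"
begin

lemma p_nonneg [simp]: "0 \<le> p j x"
  and p_triangle: "p j (x + y) \<le> p j x + p j y"
  and p_smul [simp]: "p j (c \<odot> x) = norm c * p j x"
  using seminorm_p[of j] by (auto simp: seminorm_def)

lemma p_0 [simp]: "p j 0 = 0"
  using p_smul[of j 0 0] by (simp del: p_smul)

lemma p_minus [simp]: "p j (- x) = p j x"
proof -
  have "- x = (- 1) \<odot> x" by (simp add: scale_minus_left)
  then show ?thesis by (metis p_smul norm_minus_cancel norm_one mult_1)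
qed

lemma p_minus_commute: "p j (x - y) = p j (y - x)"
  by (metis minus_diff_eq p_minus)

lemma p_diff: "p j (x - y) \<le> p j x + p j y"
  using p_triangle[of j x "- y"] by simp

lemma p_diff_triangle: "p j (x - z) \<le> p j (x - y) + p j (y - z)"
  using p_triangle[of j "x - y" "y - z"] by simp

lemma p_add_null: "p j y = 0 \<Longrightarrow> p j (x + y) = p j x"
  using p_triangle[of j x y] p_diff[of j "x + y" y] by simp

lemma p_diff_null: "p j y = 0 \<Longrightarrow> p j (x - y) = p j x"
  using p_add_null[of j "- y" x] by simp

lemma p_mono: "i \<le> j \<Longrightarrow> p i x \<le> p j x"
  by (rule lift_Suc_mono_le[of "\<lambda>j. p j x"]) (auto simp: p_Suc)

lemma p_eq_0_mono: "i \<le> j \<Longrightarrow> p j x = 0 \<Longrightarrow> p i x = 0"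
  using p_mono[of i j x] p_nonneg[of i x] by linarith

lemma p_tendsto_0_le:
  assumes "g \<longlonglongrightarrow> 0" "\<And>n. p j (f n) \<le> g n"
  shows "(\<lambda>n. p j (f n)) \<longlonglongrightarrow> 0"
  by (rule tendsto_sandwich[OF _ _ tendsto_const assms(1)]) (auto simp: assms(2))

lemma p_sum: "p j (sum f A) \<le> (\<Sum>x\<in>A. p j (f x))"
proof (induction A rule: infinite_finite_induct)
  case (insert x F)
  then show ?case using p_triangle[of j "f x" "sum f F"] by simp
qed auto

lemma open_ball: "open {y. p j (y - x) < \<epsilon>}"
  unfolding open_iff
proof
  fix z assume "z \<in> {y. p j (y - x) < \<epsilon>}"
  then have z: "p j (z - x) < \<epsilon>" by simp
  have "{y. p j (y - z) < \<epsilon> - p j (z - x)} \<subseteq> {y. p j (y - x) < \<epsilon>}"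
    using p_diff_triangle[of j _ x z] by (fastforce intro: le_less_trans)
  with z show "\<exists>j' \<epsilon>'. 0 < \<epsilon>' \<and> {y. p j' (y - z) < \<epsilon>'} \<subseteq> {y. p j (y - x) < \<epsilon>}"
    by (intro exI[of _ j] exI[of _ "\<epsilon> - p j (z - x)"]) auto
qed

lemma p_separates: assumes "\<And>j. p j x = 0" shows "x = 0"
proof (rule ccontr)
  assume "x \<noteq> 0"
  then obtain U where U: "open U" "0 \<in> U" "x \<notin> U"
    using hausdorff[of 0 x] by blast
  then obtain j \<epsilon> where "0 < \<epsilon>" "{y. p j (y - 0) < \<epsilon>} \<subseteq> U"
    using open_iff by blast
  then have "x \<in> U" using assms by auto
  with U show False by simp
qed

lemma LIMSEQ_iff_p: "(u \<longlonglongrightarrow> x) \<longleftrightarrow> (\<forall>j. (\<lambda>n. p j (u n - x)) \<longlonglongrightarrow> 0)"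
proof
  assume lim: "u \<longlonglongrightarrow> x"
  show "\<forall>j. (\<lambda>n. p j (u n - x)) \<longlonglongrightarrow> 0"
  proof (intro allI, rule order_tendstoI)
    fix j and a :: real assume "0 < a"
    then show "\<forall>\<^sub>F n in sequentially. p j (u n - x) < a"
      using topological_tendstoD[OF lim open_ball[of j x a]] by simp
  qed (auto intro!: always_eventually less_le_trans[OF _ p_nonneg])
next
  assume lim: "\<forall>j. (\<lambda>n. p j (u n - x)) \<longlonglongrightarrow> 0"
  show "u \<longlonglongrightarrow> x"
  proof (rule topological_tendstoI)
    fix U assume "open U" "x \<in> U"
    then obtain j \<epsilon> where U: "0 < \<epsilon>" "{y. p j (y - x) < \<epsilon>} \<subseteq> U"
      using open_iff by blast
    have "\<forall>\<^sub>F n in sequentially. p j (u n - x) < \<epsilon>"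
      using lim U(1) order_tendstoD(2) by blast
    then show "\<forall>\<^sub>F n in sequentially. u n \<in> U"
      by (rule eventually_mono) (use U(2) in auto)
  qed
qed

lemma closed_iff_p:
  "closed M \<longleftrightarrow> (\<forall>x. (\<forall>j \<epsilon>. 0 < \<epsilon> \<longrightarrow> (\<exists>z\<in>M. p j (z - x) < \<epsilon>)) \<longrightarrow> x \<in> M)"
proof -
  have "closed M \<longleftrightarrow> (\<forall>x. x \<notin> M \<longrightarrow> (\<exists>j \<epsilon>. 0 < \<epsilon> \<and> (\<forall>y. p j (y - x) < \<epsilon> \<longrightarrow> y \<notin> M)))"
    unfolding closed_def open_iff by (simp add: subset_eq Ball_def)
  then show ?thesis by blast
qed

lemma continuous_p: "continuous_on UNIV (p j)"
  unfolding continuous_on_def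
proof (intro ballI tendstoI)
  fix x and \<epsilon> :: real assume "0 < \<epsilon>"
  then have "x \<in> {y. p j (y - x) < \<epsilon>}" by simp
  then have "\<forall>\<^sub>F y in nhds x. p j (y - x) < \<epsilon>"
    using open_ball[of j x \<epsilon>] unfolding eventually_nhds by blast
  then have "\<forall>\<^sub>F y in at x within UNIV. p j (y - x) < \<epsilon>"
    unfolding eventually_at_filter by (rule eventually_mono) simp
  then show "\<forall>\<^sub>F y in at x within UNIV. dist (p j y) (p j x) < \<epsilon>"
  proof (rule eventually_mono)
    fix y assume "p j (y - x) < \<epsilon>"
    then show "dist (p j y) (p j x) < \<epsilon>"
      using p_triangle[of j "y - x" x] p_diff[of j y "y - x"] by (simp add: dist_real_def)
  qed
qed

text \<open>For linear maps, continuity is this system of estimates.\<close>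

definition bounded_op :: "('a \<Rightarrow> 'a) \<Rightarrow> bool" where
  "bounded_op T \<longleftrightarrow> (\<forall>j. \<exists>k C. 0 \<le> C \<and> (\<forall>x. p j (T x) \<le> C * p k x))"

definition bounded_fun :: "('a \<Rightarrow> 'k) \<Rightarrow> bool" where
  "bounded_fun f \<longleftrightarrow> (\<exists>k C. 0 \<le> C \<and> (\<forall>x. norm (f x) \<le> C * p k x))"

text \<open>
  Every vector can be scaled into the ball where \<open>q\<close> is bounded; if \<open>p k\<close> vanishes at it,
  then arbitrarily large multiples lie in that ball.
\<close>

lemma bounded_by_scaling:
  assumes hom: "\<And>t x. q (of_real t \<odot> x) = \<bar>t\<bar> * q x" and \<epsilon>: "0 < \<epsilon>"
    and small: "\<And>x. p k x < \<epsilon> \<Longrightarrow> q x \<le> B" and B: "0 \<le> B"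
  shows "q x \<le> (2 * B / \<epsilon>) * p k x"
proof (cases "p k x = 0")
  case True
  have "q x \<le> 0"
  proof (rule ccontr)
    assume "\<not> q x \<le> 0"
    then have pos: "0 < q x" by simp
    have "q (of_real ((B + 1) / q x) \<odot> x) \<le> B"
      using True \<epsilon> by (intro small) simp
    then show False using pos B hom[of "(B + 1) / q x" x] by simp
  qed
  then show ?thesis using True by simp
next
  case False
  then have pos: "0 < p k x" using p_nonneg[of k x] by linarith
  define t where "t = \<epsilon> / (2 * p k x)"
  have t: "0 < t" "t * p k x = \<epsilon> / 2" using pos \<epsilon> by (simp_all add: t_def)
  then have "q (of_real t \<odot> x) \<le> B"
    using \<epsilon> by (intro small) simp
  then have "q x \<le> B / t" using t hom[of t x] by (simp add: field_simps)
  also have "B / t = (2 * B / \<epsilon>) * p k x" using pos \<epsilon> by (simp add: t_def)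
  finally show ?thesis .
qed

lemma continuous_imp_bounded_op:
  assumes lin: "Vector_Spaces.linear smul smul T" and cont: "continuous_on UNIV T"
  shows "bounded_op T"
  unfolding bounded_op_def
proof
  fix j
  interpret T: Vector_Spaces.linear smul smul T by (rule lin)
  have "open (T -` {y. p j (y - 0) < 1})"
    using cont open_ball by (metis continuous_on_open_vimage open_UNIV Int_UNIV_right)
  moreover have "0 \<in> T -` {y. p j (y - 0) < 1}" by simp
  ultimately obtain k \<epsilon> where k: "0 < \<epsilon>" "{y. p k (y - 0) < \<epsilon>} \<subseteq> T -` {y. p j (y - 0) < 1}"
    unfolding open_iff by blast
  have "p j (T x) \<le> (2 * 1 / \<epsilon>) * p k x" for x
  proof (rule bounded_by_scaling[where q = "\<lambda>x. p j (T x)" and \<epsilon> = \<epsilon>])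
    show "p j (T x) \<le> 1" if "p k x < \<epsilon>" for x
      using k(2) that by (auto simp: subset_eq intro: less_imp_le)
  qed (use k in \<open>auto simp: T.scale\<close>)
  then show "\<exists>k C. 0 \<le> C \<and> (\<forall>x. p j (T x) \<le> C * p k x)"
    using k(1) by (intro exI[of _ k] exI[of _ "2 * 1 / \<epsilon>"]) auto
qed

lemma bounded_op_imp_continuous:
  assumes lin: "Vector_Spaces.linear smul smul T" and bd: "bounded_op T"
  shows "continuous_on UNIV T"
  unfolding continuous_on_open_vimage[OF open_UNIV]
proof (intro allI impI)
  interpret T: Vector_Spaces.linear smul smul T by (rule lin)
  fix U :: "'a set" assume U: "open U"
  show "open (T -` U \<inter> UNIV)"
    unfolding open_iff
  proof
    fix x assume "x \<in> T -` U \<inter> UNIV"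
    then obtain j \<epsilon> where j: "0 < \<epsilon>" "{y. p j (y - T x) < \<epsilon>} \<subseteq> U"
      using U open_iff by (auto simp: vimage_def)
    obtain k C where k: "0 \<le> C" "\<And>x. p j (T x) \<le> C * p k x"
      using bd unfolding bounded_op_def by blast
    have "p j (T y - T x) < \<epsilon>" if "p k (y - x) < \<epsilon> / (C + 1)" for y
    proof -
      have "p j (T y - T x) \<le> C * p k (y - x)"
        using k(2)[of "y - x"] by (simp add: T.diff)
      also have "\<dots> \<le> (C + 1) * p k (y - x)" by (simp add: mult_right_mono)
      also have "\<dots> < \<epsilon>" using that k(1) by (simp add: field_simps)
      finally show ?thesis .
    qed
    then show "\<exists>k \<epsilon>'. 0 < \<epsilon>' \<and> {y. p k (y - x) < \<epsilon>'} \<subseteq> T -` U \<inter> UNIV"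
      using j k(1) by (intro exI[of _ k] exI[of _ "\<epsilon> / (C + 1)"]) (auto simp: subset_eq)
  qed
qed

lemma bounded_op_compose: 
  assumes "bounded_op S" "bounded_op T" shows "bounded_op (\<lambda>x. S (T x))"
  unfolding bounded_op_def
proof
  fix j
  obtain k C where k: "0 \<le> C" "\<And>x. p j (S x) \<le> C * p k x"
    using assms(1) unfolding bounded_op_def by blast
  obtain l D where l: "0 \<le> D" "\<And>x. p k (T x) \<le> D * p l x"
    using assms(2) unfolding bounded_op_def by blast
  have "p j (S (T x)) \<le> (C * D) * p l x" for x
  proof -
    have "p j (S (T x)) \<le> C * p k (T x)" by (rule k)
    also have "\<dots> \<le> C * (D * p l x)" by (intro mult_left_mono l k)
    finally show ?thesis by (simp add: mult.assoc)
  qed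
  then show "\<exists>k C. 0 \<le> C \<and> (\<forall>x. p j (S (T x)) \<le> C * p k x)"
    using k(1) l(1) by (intro exI[of _ l] exI[of _ "C * D"]) auto
qed

lemma bounded_op_funpow: 
  assumes "bounded_op T" shows "bounded_op (T ^^ n)"
proof (induction n)
  case 0
  have "\<exists>k C. 0 \<le> C \<and> (\<forall>x. p j ((T ^^ 0) x) \<le> C * p k x)" for j
    by (intro exI[of _ j] exI[of _ 1]) auto
  then show ?case by (simp add: bounded_op_def)
next
  case (Suc n)
  then show ?case using bounded_op_compose[OF assms Suc] by (simp add: o_def)
qed

lemma bounded_fun_compose: 
  assumes "bounded_fun f" "bounded_op T" shows "bounded_fun (\<lambda>x. f (T x))"
proof -
  obtain k C where k: "0 \<le> C" "\<And>x. norm (f x) \<le> C * p k x"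
    using assms(1) unfolding bounded_fun_def by blast
  obtain l D where l: "0 \<le> D" "\<And>x. p k (T x) \<le> D * p l x"
    using assms(2) unfolding bounded_op_def by blast
  have "norm (f (T x)) \<le> (C * D) * p l x" for x
  proof -
    have "norm (f (T x)) \<le> C * p k (T x)" by (rule k)
    also have "\<dots> \<le> C * (D * p l x)" by (intro mult_left_mono l k)
    finally show ?thesis by (simp add: mult.assoc)
  qed
  then show ?thesis using k(1) l(1) unfolding bounded_fun_def
    by (intro exI[of _ l] exI[of _ "C * D"]) auto
qed

lemma closed_null_set:
  assumes "\<And>f x y. f \<in> F \<Longrightarrow> f (x - y) = f x - f y" and "\<And>f. f \<in> F \<Longrightarrow> bounded_fun f"
  shows "closed {x. \<forall>f\<in>F. f x = 0}"
  unfolding closed_iff_p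
proof (intro allI impI, clarsimp)
  fix x f assume x: "\<forall>j \<epsilon>. 0 < \<epsilon> \<longrightarrow> (\<exists>z. (\<forall>f\<in>F. f z = 0) \<and> p j (z - x) < \<epsilon>)" and f: "f \<in> F"
  obtain k C where k: "0 \<le> C" "\<And>x. norm (f x) \<le> C * p k x"
    using assms(2)[OF f] unfolding bounded_fun_def by blast
  have "norm (f x) \<le> 0 + \<epsilon>" if e: "0 < \<epsilon>" for \<epsilon>
  proof -
    obtain z where z: "f z = 0" "p k (z - x) < \<epsilon> / (C + 1)"
      using x[rule_format, of "\<epsilon> / (C + 1)" k] e k(1) f by (metis add_nonneg_pos divide_pos_pos zero_less_one)
    have "norm (f x) = norm (f (z - x))" using assms(1)[OF f, of z x] z by simp
    also have "\<dots> \<le> C * p k (z - x)" by (rule k)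
    also have "\<dots> \<le> (C + 1) * p k (z - x)" by (simp add: mult_right_mono)
    also have "\<dots> \<le> \<epsilon>" using z(2) k(1) by (simp add: field_simps)
    finally show ?thesis by simp
  qed
  then have "norm (f x) \<le> 0" by (rule field_le_epsilon)
  then show "f x = 0" by simp
qed

lemma closed_ker: "closed {x. p j x = 0}"
  unfolding closed_iff_p
proof (intro allI impI, clarsimp)
  fix x assume x: "\<forall>i \<epsilon>. 0 < \<epsilon> \<longrightarrow> (\<exists>z. p j z = 0 \<and> p i (z - x) < \<epsilon>)"
  have "p j x \<le> 0 + \<epsilon>" if e: "0 < \<epsilon>" for \<epsilon>
  proof -
    obtain z where z: "p j z = 0" "p j (z - x) < \<epsilon>" using x[rule_format, OF e, of j] by blast
    then show ?thesis using p_diff[of j z "z - x"] by simp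
  qed
  then have "p j x \<le> 0" by (rule field_le_epsilon)
  then show "p j x = 0" using p_nonneg[of j x] by linarith
qed

lemma subspace_ker: "subspace {x. p j x = 0}"
proof (rule subspaceI)
  fix x y assume "x \<in> {x. p j x = 0}" "y \<in> {x. p j x = 0}"
  then show "x + y \<in> {x. p j x = 0}" by (simp add: p_add_null)
qed auto

end

locale graded_frechet = graded_space smul p
  for smul :: "'k::{real_normed_field,banach} \<Rightarrow> 'a::{ab_group_add,t2_space} \<Rightarrow> 'a"  (infixr "\<odot>" 75)
    and p +
  assumes complete: "(\<And>j \<epsilon>. 0 < \<epsilon> \<Longrightarrow> \<exists>N. \<forall>m\<ge>N. \<forall>n\<ge>N. p j (u m - u n) < \<epsilon>)
                     \<Longrightarrow> \<exists>x. \<forall>j. (\<lambda>n. p j (u n - x)) \<longlonglongrightarrow> 0"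

section \<open>Coordinates with respect to a Schauder basis\<close>

locale schauder_frechet = graded_frechet smul p
  for smul :: "'k::{real_normed_field,banach} \<Rightarrow> 'a::{ab_group_add,t2_space} \<Rightarrow> 'a"  (infixr "\<odot>" 75) 
    and p +
  fixes b :: "nat \<Rightarrow> 'a"
  assumes basis: "schauder_basis smul b"
begin

definition coord :: "'a \<Rightarrow> nat \<Rightarrow> 'k" where
  "coord x = (THE a. (\<lambda>n. a n \<odot> b n) sums x)"

definition S :: "nat \<Rightarrow> 'a \<Rightarrow> 'a" where
  "S n x = (\<Sum>i<n. coord x i \<odot> b i)"

lemma coord_sums: "(\<lambda>n. coord x n \<odot> b n) sums x"
  and coord_unique: "(\<lambda>n. a n \<odot> b n) sums x \<Longrightarrow> coord x = a"
proof -
  have ex: "\<exists>!a. (\<lambda>n. a n \<odot> b n) sums x" for x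
    using basis by (simp add: schauder_basis_def)
  show "(\<lambda>n. coord x n \<odot> b n) sums x"
    unfolding coord_def by (rule theI'[OF ex])
  show "(\<lambda>n. a n \<odot> b n) sums x \<Longrightarrow> coord x = a"
    unfolding coord_def using ex by (intro the1_equality)
qed

lemma S_tendsto: "(\<lambda>n. p j (S n x - x)) \<longlonglongrightarrow> 0"
  using coord_sums[of x] by (simp add: sums_def S_def LIMSEQ_iff_p)

lemma coord_eqI: "(\<And>j. (\<lambda>n. p j ((\<Sum>i<n. a i \<odot> b i) - x)) \<longlonglongrightarrow> 0) \<Longrightarrow> coord x = a"
  by (rule coord_unique) (simp add: sums_def LIMSEQ_iff_p)

lemma coord_add: "coord (x + y) i = coord x i + coord y i"
proof -
  have "coord (x + y) = (\<lambda>i. coord x i + coord y i)"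
  proof (rule coord_eqI)
    fix j
    have "(\<lambda>n. p j (S n x - x) + p j (S n y - y)) \<longlonglongrightarrow> 0"
      using tendsto_add[OF S_tendsto S_tendsto] by simp
    moreover have "p j ((\<Sum>i<n. (coord x i + coord y i) \<odot> b i) - (x + y))
        \<le> p j (S n x - x) + p j (S n y - y)" for n
      using p_triangle[of j "S n x - x" "S n y - y"]
      by (simp add: S_def scale_left_distrib sum.distrib algebra_simps)
    ultimately show "(\<lambda>n. p j ((\<Sum>i<n. (coord x i + coord y i) \<odot> b i) - (x + y))) \<longlonglongrightarrow> 0"
      by (rule p_tendsto_0_le)
  qed
  then show ?thesis by simp
qed

lemma coord_scale: "coord (c \<odot> x) i = c * coord x i"
proof -
  have "coord (c \<odot> x) = (\<lambda>i. c * coord x i)"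
  proof (rule coord_eqI)
    fix j
    have "(\<lambda>n. norm c * p j (S n x - x)) \<longlonglongrightarrow> 0"
      using tendsto_mult[OF tendsto_const S_tendsto, of "norm c"] by simp
    moreover have "p j ((\<Sum>i<n. (c * coord x i) \<odot> b i) - c \<odot> x) = norm c * p j (S n x - x)" for n
      by (simp add: S_def flip: scale_scale scale_sum_right scale_right_diff_distrib)
    ultimately show "(\<lambda>n. p j ((\<Sum>i<n. (c * coord x i) \<odot> b i) - c \<odot> x)) \<longlonglongrightarrow> 0"
      by simp
  qed
  then show ?thesis by simp
qed

lemma coord_0 [simp]: "coord 0 i = 0"
  using coord_scale[of 0 0 i] by simp

lemma coord_diff: "coord (x - y) i = coord x i - coord y i"
  using coord_add[of "x - y" y i] by simp

lemma coord_sum: "coord (sum f A) i = (\<Sum>x\<in>A. coord (f x) i)"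
  by (induction A rule: infinite_finite_induct) (auto simp: coord_add)

lemma coord_b: "coord (b i) k = (if k = i then 1 else 0)"
proof -
  have "coord (b i) = (\<lambda>k. if k = i then 1 else 0)"
  proof (rule coord_eqI, rule tendsto_eventually)
    fix j
    show "\<forall>\<^sub>F n in sequentially. p j ((\<Sum>k<n. (if k = i then 1 else 0) \<odot> b k) - b i) = 0"
      using eventually_gt_at_top[of i]
    proof eventually_elim
      case (elim n)
      have "(\<Sum>k<n. (if k = i then 1 else 0) \<odot> b k) = (\<Sum>k<n. if k = i then b k else 0)"
        by (intro sum.cong) auto
      also have "\<dots> = b i" using elim by simp
      finally show ?case by simp
    qed
  qed
  then show ?thesis by simp
qed

lemma coord_separates: "(\<And>i. coord x i = 0) \<Longrightarrow> x = 0"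
  using S_tendsto[of _ x] by (auto simp: S_def LIMSEQ_const_iff intro!: p_separates)

lemma S_add: "S n (x + y) = S n x + S n y"
  by (simp add: S_def coord_add scale_left_distrib sum.distrib)

lemma S_diff: "S n (x - y) = S n x - S n y"
  by (simp add: S_def coord_diff scale_left_diff_distrib sum_subtractf)

lemma S_scale: "S n (c \<odot> x) = c \<odot> S n x"
  by (simp add: S_def coord_scale scale_sum_right)

lemma S_sum: "S n (sum f A) = (\<Sum>x\<in>A. S n (f x))"
proof (induction A rule: infinite_finite_induct)
  case (insert x F)
  then show ?case by (simp add: S_add)
qed (auto simp: S_def)

text \<open>
  The seminorms \<open>q j\<close> make all partial sum operators contractive, and their kernels are spanned by basis
  vectors (\<open>q_eq_0_iff\<close> below).
\<close>

definition q :: "nat \<Rightarrow> 'a \<Rightarrow> real" where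
  "q j x = (SUP n. p j (S n x))"

lemma bdd_S: "bdd_above (range (\<lambda>n. p j (S n x)))"
proof -
  have "Bseq (\<lambda>n. p j (S n x - x))"
    using S_tendsto by (blast intro: convergent_imp_Bseq convergentI)
  then obtain B where B: "\<And>n. norm (p j (S n x - x)) \<le> B"
    unfolding Bseq_def by blast
  have "p j (S n x) \<le> B + p j x" for n
    using B[of n] p_triangle[of j "S n x - x" x] by simp
  then show ?thesis by (intro bdd_aboveI2)
qed

lemma S_le_q: "p j (S n x) \<le> q j x"
  unfolding q_def by (rule cSUP_upper[OF UNIV_I bdd_S])

lemma q_least: "(\<And>n. p j (S n x) \<le> B) \<Longrightarrow> q j x \<le> B"
  unfolding q_def by (rule cSUP_least) auto

lemma p_le_q: "p j x \<le> q j x"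
proof -
  have "p j x \<le> q j x + p j (S n x - x)" for n
    using S_le_q[of j n x] p_diff[of j "S n x" "S n x - x"] by simp
  moreover have "(\<lambda>n. q j x + p j (S n x - x)) \<longlonglongrightarrow> q j x + 0"
    by (intro tendsto_intros S_tendsto)
  ultimately show ?thesis
    by (intro LIMSEQ_le_const[of _ "q j x"]) auto
qed

lemma q_nonneg [simp]: "0 \<le> q j x"
  using p_le_q[of j x] p_nonneg[of j x] by linarith

lemma q_triangle: "q j (x + y) \<le> q j x + q j y"
proof (rule q_least)
  fix n show "p j (S n (x + y)) \<le> q j x + q j y"
    using p_triangle[of j "S n x" "S n y"] S_le_q[of j n x] S_le_q[of j n y]
    by (simp add: S_add)
qed

lemma q_scale_le: "q j (c \<odot> x) \<le> norm c * q j x"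
  by (rule q_least) (simp add: S_scale mult_left_mono S_le_q)

lemma q_scale: "q j (c \<odot> x) = norm c * q j x"
proof (cases "c = 0")
  case True
  then show ?thesis
    using q_scale_le[of j c x] q_nonneg[of j "c \<odot> x"] by (simp del: q_nonneg)
next
  case False
  have "q j x \<le> norm (inverse c) * q j (c \<odot> x)"
    using q_scale_le[of j "inverse c" "c \<odot> x"] False by simp
  then show ?thesis using q_scale_le[of j c x] False
    by (intro antisym) (auto simp: norm_inverse norm_divide field_simps)
qed

lemma seminorm_q: "seminorm smul (q j)"
  by (simp add: seminorm_def q_triangle q_scale)

lemma q_minus: "q j (- x) = q j x"
  using q_scale[of j "-1" x] by (simp add: scale_minus_left)

lemma q_diff: "q j (x - y) \<le> q j x + q j y"
  using q_triangle[of j x "- y"] by (simp add: q_minus)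

lemma q_Suc: "q j x \<le> q (Suc j) x"
  by (rule q_least) (meson S_le_q p_Suc order_trans)

lemma q_mono: "i \<le> j \<Longrightarrow> q i x \<le> q j x"
  by (rule lift_Suc_mono_le[of "\<lambda>j. q j x"]) (auto simp: q_Suc)

lemma coord_bound: "norm (coord x i) * p j (b i) \<le> 2 * q j x"
proof -
  have "coord x i \<odot> b i = S (Suc i) x - S i x" by (simp add: S_def)
  then have "norm (coord x i) * p j (b i) = p j (S (Suc i) x - S i x)"
    by (metis p_smul)
  then show ?thesis
    using p_diff[of j "S (Suc i) x" "S i x"] S_le_q[of j "Suc i" x] S_le_q[of j i x] by linarith
qed

lemma q_b: "q j (b i) = p j (b i)"
proof (rule antisym[OF q_least p_le_q])
  fix n
  have "S n (b i) = (\<Sum>k<n. if k = i then b k else 0)"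
    unfolding S_def coord_b by (intro sum.cong) auto
  then show "p j (S n (b i)) \<le> p j (b i)" by simp
qed

lemma b_nonzero: "b i \<noteq> 0"
  using coord_b[of i i] by auto

lemma b_visible: "\<exists>j. p j (b i) \<noteq> 0"
  using b_nonzero[of i] p_separates by blast

lemma q_eq_0_iff: "q j x = 0 \<longleftrightarrow> (\<forall>i. p j (b i) \<noteq> 0 \<longrightarrow> coord x i = 0)"
proof
  assume "q j x = 0"
  then show "\<forall>i. p j (b i) \<noteq> 0 \<longrightarrow> coord x i = 0"
    using coord_bound[of x _ j] by (metis mult_zero_right mult_le_0_iff norm_le_zero_iff p_nonneg
        order_antisym_conv not_le)
next
  assume coord: "\<forall>i. p j (b i) \<noteq> 0 \<longrightarrow> coord x i = 0"
  have "p j (S n x) \<le> 0" for n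
  proof -
    have "p j (S n x) \<le> (\<Sum>i<n. p j (coord x i \<odot> b i))" unfolding S_def by (rule p_sum)
    also have "\<dots> = (\<Sum>i<n. 0)" using coord by (intro sum.cong) (simp_all, blast)
    finally show ?thesis by simp
  qed
  then have "q j x \<le> 0" by (rule q_least)
  then show "q j x = 0" using q_nonneg[of j x] by linarith
qed

end

section \<open>Continuity of the partial sums\<close>

context graded_frechet begin

text \<open>
  The Baire category theorem in the form needed here: if the closure of no \<open>A n\<close> contained a ball, one
  could choose nested balls that avoid \<open>A 0\<close>, \<open>A 1\<close>, \<dots> in turn, and their common point would lie outside
  the union.
\<close>

lemma baire_ball:
  fixes A :: "nat \<Rightarrow> 'a set"
  assumes cover: "\<And>x. \<exists>n. x \<in> A n"
  shows "\<exists>n x s \<epsilon>. 0 < \<epsilon> \<and>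
           (\<forall>y. p s (y - x) < \<epsilon> \<longrightarrow> (\<forall>l \<eta>. 0 < \<eta> \<longrightarrow> (\<exists>a\<in>A n. p l (a - y) < \<eta>)))"
proof (rule ccontr)
  assume "\<not> ?thesis"
  then have avoid: "\<exists>y l \<eta>. p s (y - x) < \<epsilon> \<and> 0 < \<eta> \<and> (\<forall>a\<in>A n. \<eta> \<le> p l (a - y))"
    if "0 < \<epsilon>" for n x s \<epsilon>
    using that by (meson not_le)
  define ball where "ball = (\<lambda>(x, s, \<epsilon>). {z. p s (z - x) \<le> (\<epsilon>::real)})"
  define good where "good n B = (let (x, s, \<epsilon>) = B in 0 < \<epsilon> \<and> n \<le> s \<and> \<epsilon> \<le> (1/2) ^ n)"
    for n and B :: "'a \<times> nat \<times> real"
  have "\<exists>B. good 0 B"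
    by (intro exI[of _ "(0, 0, 1)"]) (auto simp: good_def)
  moreover have "\<exists>B'. good (Suc n) B' \<and> (ball B' \<subseteq> ball B \<and> ball B' \<inter> A n = {})"
    if "good n B" for n B
  proof -
    obtain x s \<epsilon> where B: "B = (x, s, \<epsilon>)" by (cases B)
    with that have \<epsilon>: "0 < \<epsilon>" by (simp add: good_def)
    obtain y l \<eta> where y: "p s (y - x) < \<epsilon> / 2" "0 < \<eta>" "\<And>a. a \<in> A n \<Longrightarrow> \<eta> \<le> p l (a - y)"
      using avoid[of "\<epsilon> / 2" s x n] \<epsilon> by auto
    define s' where "s' = max s (max l (Suc n))"
    define \<epsilon>' where "\<epsilon>' = min (\<epsilon> / 2) (min (\<eta> / 2) ((1/2) ^ Suc n))"
    have s': "s \<le> s'" "l \<le> s'" "Suc n \<le> s'" by (auto simp: s'_def)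
    have \<epsilon>': "0 < \<epsilon>'" "\<epsilon>' \<le> \<epsilon> / 2" "\<epsilon>' < \<eta>" "\<epsilon>' \<le> (1/2) ^ Suc n"
      using \<epsilon> y(2) by (auto simp: \<epsilon>'_def min_def)
    have "ball (y, s', \<epsilon>') \<subseteq> ball B"
    proof
      fix z assume "z \<in> ball (y, s', \<epsilon>')"
      then have "p s (z - y) \<le> \<epsilon> / 2"
        using p_mono[OF s'(1), of "z - y"] \<epsilon>'(2) by (simp add: ball_def)
      then show "z \<in> ball B"
        using p_diff_triangle[of s z x y] y(1) by (simp add: ball_def B)
    qed
    moreover have "ball (y, s', \<epsilon>') \<inter> A n = {}"
    proof -
      have "z \<notin> A n" if "p s' (z - y) \<le> \<epsilon>'" for z
        using p_mono[OF s'(2), of "z - y"] \<epsilon>'(3) that y(3)[of z] by fastforce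
      then show ?thesis by (auto simp: ball_def)
    qed
    ultimately show ?thesis
      using s' \<epsilon>' by (intro exI[of _ "(y, s', \<epsilon>')"]) (simp add: good_def)
  qed
  ultimately obtain B where good: "\<And>n. good n (B n)"
    and sub: "\<And>n. ball (B (Suc n)) \<subseteq> ball (B n)"
    and disj: "\<And>n. ball (B (Suc n)) \<inter> A n = {}"
    using dependent_nat_choice[where P = good
        and Q = "\<lambda>n B B'. ball B' \<subseteq> ball B \<and> ball B' \<inter> A n = {}"] by meson
  define x where "x n = fst (B n)" for n
  define s where "s n = fst (snd (B n))" for n
  define \<epsilon> where "\<epsilon> n = snd (snd (B n))" for n
  have B: "B n = (x n, s n, \<epsilon> n)" for n by (simp add: x_def s_def \<epsilon>_def)
  have gd: "0 < \<epsilon> n" "n \<le> s n" "\<epsilon> n \<le> (1/2) ^ n" for n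
    using good[of n] by (simp_all add: good_def B)
  have in_ball: "p (s n) (x m - x n) \<le> \<epsilon> n" if "n \<le> m" for m n
  proof -
    have "ball (B m) \<subseteq> ball (B n)"
      using that by (rule lift_Suc_antimono_le[of "\<lambda>n. ball (B n)", rotated]) (rule sub)
    moreover have "x m \<in> ball (B m)" using gd(1)[of m] by (simp add: ball_def B less_imp_le)
    ultimately have "x m \<in> ball (B n)" by blast
    then show ?thesis by (simp add: ball_def B)
  qed
  have "\<exists>N. \<forall>m\<ge>N. \<forall>n\<ge>N. p j (x m - x n) < \<delta>" if d: "0 < \<delta>" for j \<delta>
  proof -
    obtain N0 where N0: "(1/2::real) ^ N0 < \<delta> / 2"
      using real_arch_pow_inv[of "\<delta> / 2" "1/2"] d by auto
    define N where "N = max N0 j"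
    have "(1/2::real) ^ N \<le> (1/2) ^ N0" by (rule power_decreasing) (auto simp: N_def)
    with N0 have "(1/2::real) ^ N < \<delta> / 2" by linarith
    moreover have "j \<le> s N" using gd(2)[of N] by (simp add: N_def)
    ultimately have N: "(1/2::real) ^ N < \<delta> / 2" "j \<le> s N" .
    have "p j (x m - x n) < \<delta>" if "N \<le> m" "N \<le> n" for m n
    proof -
      have "p j (x m - x n) \<le> p (s N) (x m - x n)" by (rule p_mono[OF N(2)])
      also have "\<dots> \<le> p (s N) (x m - x N) + p (s N) (x N - x n)" by (rule p_diff_triangle)
      also have "\<dots> \<le> \<epsilon> N + \<epsilon> N"
        using in_ball[OF that(1)] in_ball[OF that(2)] by (simp add: p_minus_commute[of _ "x N" "x n"])
      also have "\<dots> < \<delta>" using gd(3)[of N] N(1) by linarith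
      finally show ?thesis .
    qed
    then show ?thesis by blast
  qed
  then obtain z where z: "\<And>j. (\<lambda>n. p j (x n - z)) \<longlonglongrightarrow> 0"
    using complete[of x] by blast
  have "p (s n) (z - x n) \<le> \<epsilon> n" for n
  proof (rule LIMSEQ_le_const)
    show "(\<lambda>m. \<epsilon> n + p (s n) (x m - z)) \<longlonglongrightarrow> \<epsilon> n"
      using tendsto_add[OF tendsto_const z, of "\<epsilon> n" "s n"] by simp
    have "p (s n) (z - x n) \<le> \<epsilon> n + p (s n) (x m - z)" if "n \<le> m" for m
      using in_ball[OF that] p_diff_triangle[of "s n" z "x n" "x m"]
        p_minus_commute[of "s n" z "x m"] by linarith
    then show "\<exists>N. \<forall>m\<ge>N. p (s n) (z - x n) \<le> \<epsilon> n + p (s n) (x m - z)"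
      by blast
  qed
  then have "z \<in> ball (B n)" for n by (simp add: ball_def B)
  then show False using disj cover[of z] by blast
qed

end

context schauder_frechet begin

text \<open>
  Countable subadditivity of \<open>q j\<close>, the completeness of the topology defined by the \<open>q l\<close> in disguise.
  The coordinates of \<open>x\<close> have to be the sums of the coordinates of the \<open>a i\<close>; this is an
  interchange of two limits, which is licensed by the uniform bound of \<open>p l \<circ> S n\<close> by \<open>q l\<close>.
\<close>

lemma q_le_suminf:
  assumes lim: "\<And>l. (\<lambda>N. p l ((\<Sum>i<N. a i) - x)) \<longlonglongrightarrow> 0"
    and summable_q: "\<And>l. summable (\<lambda>i. q l (a i))"
  shows "q j x \<le> (\<Sum>i. q j (a i))"
proof -
  define A where "A N = (\<Sum>i<N. a i)" for N
  define c where "c m = (\<Sum>i. coord (a i) m)" for m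
  define W where "W n = (\<Sum>m<n. c m \<odot> b m)" for n
  define tail where "tail l I = (\<Sum>i. q l (a (i + I)))" for l I
  have c: "(\<lambda>i. coord (a i) m) sums c m" for m
  proof -
    obtain l where l: "p l (b m) \<noteq> 0" using b_visible by blast
    then have pos: "0 < p l (b m)" using p_nonneg[of l "b m"] by linarith
    have "norm (coord (a i) m) \<le> (2 / p l (b m)) * q l (a i)" for i
      using coord_bound[of "a i" m l] pos by (simp add: field_simps)
    then have "summable (\<lambda>i. coord (a i) m)"
      by (intro summable_comparison_test'[OF summable_mult[OF summable_q]])
    then show ?thesis by (simp add: c_def summable_sums)
  qed
  have W: "(\<lambda>I. p l (W n - S n (A I))) \<longlonglongrightarrow> 0" for l n
  proof (rule p_tendsto_0_le)
    show "(\<lambda>I. \<Sum>m<n. norm ((\<Sum>i<I. coord (a i) m) - c m) * p l (b m)) \<longlonglongrightarrow> 0"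
    proof (rule tendsto_null_sum, rule tendsto_mult_left_zero, rule tendsto_norm_zero)
      fix m
      have "(\<lambda>I. \<Sum>i<I. coord (a i) m) \<longlonglongrightarrow> c m" using c[of m] by (simp add: sums_def)
      then show "(\<lambda>I. (\<Sum>i<I. coord (a i) m) - c m) \<longlonglongrightarrow> 0" by (rule LIM_zero)
    qed
    show "p l (W n - S n (A I)) \<le> (\<Sum>m<n. norm ((\<Sum>i<I. coord (a i) m) - c m) * p l (b m))" for I
    proof -
      have "W n - S n (A I) = (\<Sum>m<n. (c m - (\<Sum>i<I. coord (a i) m)) \<odot> b m)"
        by (simp add: W_def S_def A_def coord_sum scale_left_diff_distrib sum_subtractf)
      also have "p l \<dots> \<le> (\<Sum>m<n. p l ((c m - (\<Sum>i<I. coord (a i) m)) \<odot> b m))" by (rule p_sum)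
      finally show ?thesis by (simp add: norm_minus_commute)
    qed
  qed
  have tail: "p l (W n - S n (A I)) \<le> tail l I" for l n I
  proof (rule LIMSEQ_le_const)
    show "(\<lambda>I'. tail l I + p l (W n - S n (A I'))) \<longlonglongrightarrow> tail l I"
      using tendsto_add[OF tendsto_const W, of "tail l I" l n] by simp
    have "p l (W n - S n (A I)) \<le> tail l I + p l (W n - S n (A I'))" if "I \<le> I'" for I'
    proof -
      have "A (I + d) - A I = (\<Sum>i<d. a (i + I))" for d
        by (induction d) (auto simp: A_def algebra_simps)
      from this[of "I' - I"] that have "A I' - A I = (\<Sum>i<I' - I. a (i + I))" by simp
      then have "S n (A I') - S n (A I) = (\<Sum>i<I' - I. S n (a (i + I)))"
        by (simp add: S_sum flip: S_diff)
      then have "p l (S n (A I') - S n (A I)) \<le> (\<Sum>i<I' - I. p l (S n (a (i + I))))"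
        using p_sum by simp
      also have "\<dots> \<le> (\<Sum>i<I' - I. q l (a (i + I)))" by (intro sum_mono S_le_q)
      also have "\<dots> \<le> tail l I"
        unfolding tail_def
        by (rule sum_le_suminf) (simp_all add: summable_iff_shift[of "\<lambda>i. q l (a i)"] summable_q)
      finally show ?thesis
        using p_diff_triangle[of l "W n" "S n (A I)" "S n (A I')"] by linarith
    qed
    then show "\<exists>N. \<forall>I'\<ge>N. p l (W n - S n (A I)) \<le> tail l I + p l (W n - S n (A I'))"
      by blast
  qed
  have "coord x = c"
  proof (rule coord_eqI, rule LIMSEQ_I)
    fix l and \<epsilon> :: real assume \<epsilon>: "0 < \<epsilon>"
    have "(\<lambda>I. tail l I) \<longlonglongrightarrow> 0"
      unfolding tail_def by (rule suminf_exist_split2[OF summable_q])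
    then have "\<forall>\<^sub>F I in sequentially. tail l I < \<epsilon> / 3"
      using \<epsilon> by (intro order_tendstoD(2)) auto
    moreover have "\<forall>\<^sub>F I in sequentially. p l (A I - x) < \<epsilon> / 3"
      using lim[of l] \<epsilon> by (intro order_tendstoD(2)) (auto simp: A_def)
    ultimately have "\<forall>\<^sub>F I in sequentially. tail l I < \<epsilon> / 3 \<and> p l (A I - x) < \<epsilon> / 3"
      by eventually_elim simp
    then obtain I where I: "tail l I < \<epsilon> / 3" "p l (A I - x) < \<epsilon> / 3"
      by (auto dest: eventually_happens)
    have "\<forall>\<^sub>F n in sequentially. p l (S n (A I) - A I) < \<epsilon> / 3"
      using S_tendsto \<epsilon> by (intro order_tendstoD(2)) auto
    then have "\<forall>\<^sub>F n in sequentially. norm (p l ((\<Sum>m<n. c m \<odot> b m) - x) - 0) < \<epsilon>"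
    proof eventually_elim
      case (elim n)
      have "p l (W n - x) \<le> p l (W n - S n (A I)) + (p l (S n (A I) - A I) + p l (A I - x))"
        using p_diff_triangle[of l "W n" x "S n (A I)"] p_diff_triangle[of l "S n (A I)" x "A I"]
        by linarith
      then show ?case using elim I tail[of l n I] by (simp add: W_def)
    qed
    then show "\<exists>N. \<forall>n\<ge>N. norm (p l ((\<Sum>m<n. c m \<odot> b m) - x) - 0) < \<epsilon>"
      by (simp add: eventually_sequentially)
  qed
  then have "S n x = W n" for n by (simp add: S_def W_def)
  moreover have "S n (A 0) = 0" for n by (simp add: A_def S_def)
  ultimately have "p j (S n x) \<le> (\<Sum>i. q j (a i))" for n
    using tail[of j n 0] by (simp add: tail_def)
  then show ?thesis by (rule q_least)
qed

text \<open>
  The sets on which \<open>q j\<close> is at most \<open>n\<close> cover the space, so the closure of one of them contains a ball;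
  differences of its elements fill a ball around \<open>0\<close>.
\<close>

lemma q_approx:
  "\<exists>k \<epsilon>. 0 < \<epsilon> \<and> (\<forall>x t l \<eta>. 0 < t \<and> p k x < \<epsilon> * t \<and> 0 < \<eta> \<longrightarrow> (\<exists>a. q j a \<le> t \<and> p l (a - x) < \<eta>))"
proof -
  have "\<exists>n. x \<in> {x. q j x \<le> real n}" for x
    using real_arch_simple by simp
  then obtain n x0 s \<epsilon> where \<epsilon>: "0 < \<epsilon>" and
    near: "\<And>y l \<eta>. p s (y - x0) < \<epsilon> \<Longrightarrow> 0 < \<eta> \<Longrightarrow> \<exists>a. q j a \<le> real n \<and> p l (a - y) < \<eta>"
    using baire_ball[of "\<lambda>n. {x. q j x \<le> real n}"] by (auto simp: Bex_def) blast
  define N where "N = 2 * real n + 1"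
  have N: "0 < N" by (simp add: N_def)
  have "\<exists>a. q j a \<le> t \<and> p l (a - x) < \<eta>" if H: "0 < t" "p s x < (\<epsilon> / N) * t" "0 < \<eta>" for x t l \<eta>
  proof -
    define r where "r = N / t"
    have r: "0 < r" "r * t = N" using H N by (auto simp: r_def)
    have "r * p s x < \<epsilon>" using H N by (simp add: r_def field_simps)
    then have "p s (x0 + of_real r \<odot> x - x0) < \<epsilon>" using r by simp
    then obtain a1 where a1: "q j a1 \<le> real n" "p l (a1 - (x0 + of_real r \<odot> x)) < r * \<eta> / 2"
      using near[of "x0 + of_real r \<odot> x" "r * \<eta> / 2" l] r H by auto
    obtain a2 where a2: "q j a2 \<le> real n" "p l (a2 - x0) < r * \<eta> / 2"
      using near[of x0 "r * \<eta> / 2" l] r H \<epsilon> by auto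
    define a where "a = of_real (1 / r) \<odot> (a1 - a2)"
    have "q j a = q j (a1 - a2) / r" using r by (simp add: a_def q_scale del: of_real_divide)
    also have "\<dots> \<le> N / r"
      using q_diff[of j a1 a2] a1 a2 r by (intro divide_right_mono) (auto simp: N_def)
    also have "\<dots> = t" using r by (simp add: field_simps)
    finally have "q j a \<le> t" .
    moreover have "a - x = of_real (1 / r) \<odot> ((a1 - (x0 + of_real r \<odot> x)) - (a2 - x0))"
      using r by (simp add: a_def scale_right_diff_distrib scale_right_distrib)
    then have "p l (a - x) = p l ((a1 - (x0 + of_real r \<odot> x)) - (a2 - x0)) / r"
      using r by (simp del: of_real_divide)
    then have "p l (a - x) < \<eta>"
      using p_diff[of l "a1 - (x0 + of_real r \<odot> x)" "a2 - x0"] a1(2) a2(2) r(1)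
      by (simp add: pos_divide_less_eq mult.commute)
    ultimately show ?thesis by blast
  qed
  then show ?thesis using \<epsilon> N by (intro exI[of _ s] exI[of _ "\<epsilon> / N"]) auto
qed

text \<open>
  The closure in the previous lemma is removed as in the open mapping theorem: approximate
  \<open>x\<close>, then the error, and so on, controlling the \<open>n\<close>-th correction by \<open>q (j + n)\<close>, so that the
  corrections are summable for every \<open>q l\<close> at once.
\<close>

theorem q_bounded: "\<exists>k C. 0 \<le> C \<and> (\<forall>x. q j x \<le> C * p k x)"
proof -
  obtain K e where e: "\<And>j. 0 < e j" and approx: "\<And>j x t l \<eta>. 0 < t \<Longrightarrow> p (K j) x < e j * t \<Longrightarrow> 0 < \<eta>
      \<Longrightarrow> \<exists>a. q j a \<le> t \<and> p l (a - x) < \<eta>"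
    using q_approx by metis
  have "q j x \<le> 2" if x: "p (K j) x < e j" for x
  proof -
    define ok where "ok n r \<longleftrightarrow> p (K (j + n)) r < e (j + n) * (1/2) ^ n \<and> (n = 0 \<longrightarrow> r = x) \<and>
        (0 < n \<longrightarrow> p n r \<le> (1/2) ^ n)" for n r
    have "\<exists>r. ok 0 r" using x by (auto simp: ok_def)
    moreover have "\<exists>r'. ok (Suc n) r' \<and> q (j + n) (r - r') \<le> (1/2) ^ n" if okr: "ok n r" for n r
    proof -
      define l where "l = max (K (j + Suc n)) (Suc n)"
      define \<eta> where "\<eta> = min (e (j + Suc n) * (1/2) ^ Suc n) ((1/2::real) ^ Suc n)"
      have "0 < \<eta>" using e by (simp add: \<eta>_def)
      then obtain a where a: "q (j + n) a \<le> (1/2) ^ n" "p l (a - r) < \<eta>"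
        using approx[of "(1/2) ^ n" "j + n" r \<eta> l] okr unfolding ok_def
        by (metis zero_less_power half_gt_zero_iff zero_less_one)
      have "p i (r - a) < \<eta>" if "i \<le> l" for i
        using p_mono[OF that, of "r - a"] a(2) by (simp add: p_minus_commute)
      from this[of "K (j + Suc n)"] this[of "Suc n"]
      have "ok (Suc n) (r - a)" by (simp add: ok_def l_def \<eta>_def)
      then show ?thesis using a by (intro exI[of _ "r - a"]) simp
    qed
    ultimately obtain r where ok: "\<And>n. ok n (r n)"
      and qr: "\<And>n. q (j + n) (r n - r (Suc n)) \<le> (1/2) ^ n"
      using dependent_nat_choice[where P = ok and Q = "\<lambda>n r r'. q (j + n) (r - r') \<le> (1/2) ^ n"]
      by meson
    define a where "a n = r n - r (Suc n)" for n
    have r0: "r 0 = x" using ok[of 0] by (simp add: ok_def)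
    have sum_a: "(\<Sum>i<N. a i) - x = - r N" for N
      using sum_lessThan_telescope'[of r N] r0 by (simp add: a_def)
    have pow: "summable (\<lambda>n. (1/2::real) ^ n)" by (simp add: summable_geometric)
    have pow0: "(\<lambda>n. (1/2::real) ^ n) \<longlonglongrightarrow> 0" by (simp add: LIMSEQ_power_zero)
    have lim: "(\<lambda>N. p l ((\<Sum>i<N. a i) - x)) \<longlonglongrightarrow> 0" for l
      unfolding sum_a p_minus
    proof (rule tendsto_sandwich[OF _ _ tendsto_const pow0])
      show "\<forall>\<^sub>F n in sequentially. p l (r n) \<le> (1/2) ^ n"
        using eventually_ge_at_top[of "max l 1"]
      proof eventually_elim
        case (elim n)
        then show ?case using ok[of n] p_mono[of l n "r n"] by (simp add: ok_def)
      qed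
    qed auto
    have q_small: "q l (a n) \<le> (1/2) ^ n" if "l \<le> j + n" for l n
      using q_mono[OF that, of "a n"] qr[of n] by (simp add: a_def)
    have sq: "summable (\<lambda>i. q l (a i))" for l
      by (rule summable_comparison_test[OF _ pow]) (use q_small in \<open>auto intro!: exI[of _ l]\<close>)
    have "q j x \<le> (\<Sum>i. q j (a i))" by (rule q_le_suminf[OF lim sq])
    also have "\<dots> \<le> (\<Sum>i. (1/2) ^ i)" by (rule suminf_le[OF _ sq pow]) (simp add: q_small)
    also have "\<dots> = 2" by (simp add: suminf_geometric)
    finally show ?thesis .
  qed
  then have "q j x \<le> (2 * 2 / e j) * p (K j) x" for x
    using e by (intro bounded_by_scaling) (auto simp: q_scale)
  then show ?thesis using e[of j] by (intro exI[of _ "K j"] exI[of _ "2 * 2 / e j"]) auto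
qed

lemma bounded_fun_coord: "bounded_fun (\<lambda>x. coord x i)"
proof -
  obtain l where l: "p l (b i) \<noteq> 0" using b_visible by blast
  then have pos: "0 < p l (b i)" using p_nonneg[of l "b i"] by linarith
  obtain k C where k: "0 \<le> C" "\<And>x. q l x \<le> C * p k x" using q_bounded by blast
  have "norm (coord x i) \<le> (2 * C / p l (b i)) * p k x" for x
    using coord_bound[of x i l] k(2)[of x] pos by (simp add: field_simps)
  then show ?thesis using k(1) unfolding bounded_fun_def
    by (intro exI[of _ k] exI[of _ "2 * C / p l (b i)"]) auto
qed

end

section \<open>Finite codimension gives invariant subspaces\<close>

context vector_space begin

lemma finite_codim_in_refl: "finite_codim_in scale V V"
  unfolding finite_codim_in_def using span_zero
  by (metis diff_zero empty_subsetI finite.emptyI order_refl)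

lemma finite_codim_in_trans:
  assumes "finite_codim_in scale U W" "finite_codim_in scale W V"
  shows "finite_codim_in scale U V"
proof -
  obtain B1 where B1: "finite B1" "B1 \<subseteq> W" "\<And>v. v \<in> W \<Longrightarrow> \<exists>b\<in>span B1. v - b \<in> U"
    using assms(1) unfolding finite_codim_in_def by auto
  obtain B2 where B2: "finite B2" "B2 \<subseteq> V" "\<And>v. v \<in> V \<Longrightarrow> \<exists>b\<in>span B2. v - b \<in> W"
    using assms(2) unfolding finite_codim_in_def by auto
  have sub: "U \<subseteq> W" "W \<subseteq> V" using assms by (auto simp: finite_codim_in_def)
  have "\<exists>b\<in>span (B1 \<union> B2). v - b \<in> U" if v: "v \<in> V" for v
  proof -
    obtain b2 where b2: "b2 \<in> span B2" "v - b2 \<in> W" using B2(3)[OF v] by blast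
    obtain b1 where b1: "b1 \<in> span B1" "v - b2 - b1 \<in> U" using B1(3)[OF b2(2)] by blast
    have "b1 + b2 \<in> span (B1 \<union> B2)"
      using b1 b2 span_mono[of B1 "B1 \<union> B2"] span_mono[of B2 "B1 \<union> B2"] by (auto intro: span_add)
    moreover have "v - (b1 + b2) \<in> U" using b1(2) by (simp add: algebra_simps)
    ultimately show ?thesis by blast
  qed
  then show ?thesis using B1(1,2) B2(1,2) sub unfolding finite_codim_in_def
    by (intro conjI exI[of _ "B1 \<union> B2"]) auto
qed

text \<open>
  The chain condition in finite dimension. The span of \<open>B\<close> sits in a space of arbitrary dimension, so the
  cardinality of a maximal independent set serves as dimension.
\<close>

lemma subspaces_in_span_stabilise:
  assumes D: "\<And>n. subspace (D n)" "\<And>n. D (Suc n) \<subseteq> D n" "\<And>n. D n \<subseteq> span B" and B: "finite B"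
  shows "\<exists>N. \<forall>n\<ge>N. D n = D N"
proof -
  have "\<exists>b. b \<subseteq> D n \<and> independent b \<and> D n \<subseteq> span b" for n
    using maximal_independent_subset[of "D n"] by metis
  then obtain b where b: "\<And>n. b n \<subseteq> D n" "\<And>n. independent (b n)" "\<And>n. D n \<subseteq> span (b n)"
    by metis
  have fin: "finite (b n)" for n
    using independent_span_bound[OF B b(2)] b(1) D(3) by blast
  obtain N where N: "\<And>n. card (b N) \<le> card (b n)"
    using ex_has_least_nat[of "\<lambda>_. True" 0 "\<lambda>n. card (b n)"] by auto
  have "D n = D N" if n: "N \<le> n" for n
  proof
    show DnN: "D n \<subseteq> D N" using n by (rule lift_Suc_antimono_le[of D, rotated]) (rule D(2))
    show "D N \<subseteq> D n"
    proof (rule ccontr)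
      assume "\<not> D N \<subseteq> D n"
      then obtain x where x: "x \<in> D N" "x \<notin> D n" by blast
      have xs: "x \<notin> span (b n)" using x(2) b(1) D(1) span_minimal by blast
      then have "independent (insert x (b n))" using b(2) by (rule independent_insertI)
      moreover have "insert x (b n) \<subseteq> span (b N)" using x b DnN by blast
      ultimately have "card (insert x (b n)) \<le> card (b N)"
        using independent_span_bound[OF fin] by blast
      moreover have "x \<notin> b n" using xs span_base by blast
      ultimately show False using N[of n] fin by simp
    qed
  qed
  then show ?thesis by blast
qed

lemma subspaces_between_stabilise:
  assumes codim: "finite_codim_in scale W V"
    and S: "\<And>n. subspace (S n)" "\<And>n. S (Suc n) \<subseteq> S n" "\<And>n. W \<subseteq> S n" "\<And>n. S n \<subseteq> V"
  shows "\<exists>N. \<forall>n\<ge>N. S n = S N"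
proof -
  obtain B where B: "finite B" "\<And>v. v \<in> V \<Longrightarrow> \<exists>b\<in>span B. v - b \<in> W"
    using codim unfolding finite_codim_in_def by auto
  obtain N where N: "\<And>n. N \<le> n \<Longrightarrow> S n \<inter> span B = S N \<inter> span B"
    using subspaces_in_span_stabilise[of "\<lambda>n. S n \<inter> span B" B] S B
    by (auto intro: subspace_inter)
  have "S n = S N" if n: "N \<le> n" for n
  proof
    show "S n \<subseteq> S N" using n by (rule lift_Suc_antimono_le[of S, rotated]) (rule S(2))
    show "S N \<subseteq> S n"
    proof
      fix v assume v: "v \<in> S N"
      then obtain c where c: "c \<in> span B" "v - c \<in> W" using B(2) S(4) by blast
      have "v - c \<in> S N" using c(2) S(3) by blast
      then have "v - (v - c) \<in> S N" by (rule subspace_diff[OF S(1) v])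
      then have "c \<in> S n" using N[OF n] c(1) by auto
      moreover have "v - c \<in> S n" using c(2) S(3) by blast
      ultimately have "(v - c) + c \<in> S n" by (intro subspace_add[OF S(1)])
      then show "v \<in> S n" by simp
    qed
  qed
  then show ?thesis by blast
qed

end

context graded_frechet begin

definition linfun :: "('a \<Rightarrow> 'k) \<Rightarrow> bool" where
  "linfun f \<longleftrightarrow> (\<forall>x y. f (x + y) = f x + f y) \<and> (\<forall>c x. f (c \<odot> x) = c * f x)"

lemma linfun_add: "linfun f \<Longrightarrow> f (x + y) = f x + f y"
  by (auto simp: linfun_def)

lemma linfun_scale: "linfun f \<Longrightarrow> f (c \<odot> x) = c * f x"
  by (auto simp: linfun_def)

lemma linfun_0: "linfun f \<Longrightarrow> f 0 = 0"
  using linfun_scale[of f 0 0] by simp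

lemma linfun_diff: "linfun f \<Longrightarrow> f (x - y) = f x - f y"
  using linfun_add[of f "x - y" y] by simp

lemma linfun_kernel_inclusion:
  fixes n :: nat
  assumes "\<And>k. k < n \<Longrightarrow> linfun (g k)" "linfun f" "subspace Z"
    and "\<And>z. z \<in> Z \<Longrightarrow> (\<And>k. k < n \<Longrightarrow> g k z = 0) \<Longrightarrow> f z = 0"
  shows "\<exists>c. \<forall>z\<in>Z. f z = (\<Sum>k<n. c k * g k z)"
  using assms(1,3,4)
proof (induction n arbitrary: Z)
  case (Suc n)
  let ?Z = "{z \<in> Z. g n z = 0}"
  have gn: "linfun (g n)" using Suc.prems(1) by simp
  have "subspace ?Z"
    using Suc.prems(2) linfun_0[OF gn] by (auto simp: subspace_def linfun_add[OF gn] linfun_scale[OF gn])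
  moreover have "f z = 0" if "z \<in> ?Z" "\<And>k. k < n \<Longrightarrow> g k z = 0" for z
    using that by (intro Suc.prems(3)) (auto simp: less_Suc_eq)
  ultimately obtain c where c: "\<And>z. z \<in> ?Z \<Longrightarrow> f z = (\<Sum>k<n. c k * g k z)"
    using Suc.IH[of ?Z] Suc.prems(1) by auto
  show ?case
  proof (cases "\<exists>z\<in>Z. g n z \<noteq> 0")
    case False
    then have "\<forall>z\<in>Z. f z = (\<Sum>k<Suc n. c k * g k z)" using c by simp
    then show ?thesis by blast
  next
    case True
    then obtain z1 where z1: "z1 \<in> Z" "g n z1 \<noteq> 0" by blast
    define z0 where "z0 = inverse (g n z1) \<odot> z1"
    have z0: "z0 \<in> Z" "g n z0 = 1"
      using z1 Suc.prems(2) by (auto simp: z0_def linfun_scale[OF gn] subspace_scale)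
    define c' where "c' k = (if k = n then f z0 - (\<Sum>k<n. c k * g k z0) else c k)" for k
    have "f z = (\<Sum>k<Suc n. c' k * g k z)" if z: "z \<in> Z" for z
    proof -
      let ?w = "z - g n z \<odot> z0"
      have "?w \<in> ?Z"
        using z z0 Suc.prems(2)
        by (auto simp: linfun_diff[OF gn] linfun_scale[OF gn] intro: subspace_diff subspace_scale)
      from c[OF this] have "f ?w = (\<Sum>k<n. c k * g k ?w)" .
      moreover have "(\<Sum>k<n. c k * g k ?w) = (\<Sum>k<n. c k * (g k z - g n z * g k z0))"
        using Suc.prems(1) by (intro sum.cong) (auto simp: linfun_diff linfun_scale)
      ultimately have "f z - g n z * f z0 = (\<Sum>k<n. c k * (g k z - g n z * g k z0))"
        by (simp add: linfun_diff[OF assms(2)] linfun_scale[OF assms(2)])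
      then show ?thesis
        by (simp add: c'_def sum_distrib_left sum_subtractf algebra_simps)
    qed
    then show ?thesis by blast
  qed
qed auto

text \<open>
  This prescribes finitely many values at a time; together with \<open>linear_compactness\<close> below it yields
  infinitely many.
\<close>

lemma linfun_interpolate:
  fixes n :: nat
  assumes g: "\<And>k. linfun (g k)" and Z: "subspace Z"
    and indep: "\<And>d c. \<exists>z\<in>Z. g d z \<noteq> (\<Sum>k<d. c k * g k z)"
  shows "\<exists>z\<in>Z. \<forall>k<n. g k z = y k"
proof (induction n)
  case 0
  then show ?case using subspace_0[OF Z] by blast
next
  case (Suc n)
  then obtain z where z: "z \<in> Z" "\<And>k. k < n \<Longrightarrow> g k z = y k" by blast
  have "\<exists>w\<in>Z. (\<forall>k<n. g k w = 0) \<and> g n w \<noteq> 0"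
    using linfun_kernel_inclusion[of n g "g n" Z] g Z indep[of n] by blast
  then obtain w where w: "w \<in> Z" "\<And>k. k < n \<Longrightarrow> g k w = 0" "g n w \<noteq> 0" by blast
  let ?z = "z + ((y n - g n z) / g n w) \<odot> w"
  have "?z \<in> Z" using z w Z by (intro subspace_add subspace_scale)
  moreover have "\<forall>k<Suc n. g k ?z = y k"
    using z w by (auto simp: linfun_add[OF g] linfun_scale[OF g] less_Suc_eq)
  ultimately show ?case by blast
qed

abbreviation "Ker j \<equiv> {x. p j x = 0}"

lemma Ker_mono: "i \<le> j \<Longrightarrow> Ker j \<subseteq> Ker i"
  using p_eq_0_mono by blast

text \<open>
  The affine subspaces \<open>x n + L n\<close> decrease, and the claim is that they have a common point. Modulo
  each \<open>Ker (j1 + m)\<close> the situation is finite-dimensional, so the image of \<open>x n + L n\<close> no longer depends on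
  \<open>n\<close> once \<open>n\<close> is large. Points \<open>z m\<close> of these stable images can therefore be chosen coherently, each
  agreeing with the previous one modulo the previous kernel, and they converge.
\<close>

lemma linear_compactness:
  assumes codim: "\<And>j. j1 \<le> j \<Longrightarrow> finite_codim_in smul (Ker (Suc j)) (Ker j)"
    and L: "\<And>n. subspace (L n)" "\<And>n. L (Suc n) \<subseteq> L n" "\<And>n. L n \<subseteq> Ker j1" "\<And>n. \<exists>m. Ker m \<subseteq> L n"
    and x: "\<And>n. x (Suc n) - x n \<in> L n"
  shows "\<exists>z. \<forall>n. z - x n \<in> L n"
proof -
  have codim': "finite_codim_in smul (Ker (j1 + m)) (Ker j1)" for m
  proof (induction m)
    case (Suc m)
    then show ?case using finite_codim_in_trans[OF codim[of "j1 + m"] Suc] by simp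
  qed (simp add: finite_codim_in_refl)
  have L_mono: "L n \<subseteq> L m" if "m \<le> n" for m n
    using that by (rule lift_Suc_antimono_le[of L, rotated]) (rule L(2))
  have x_diff: "x n - x m \<in> L m" if "m \<le> n" for m n
    using that
  proof (induction n rule: dec_induct)
    case base
    then show ?case using subspace_0[OF L(1)] by simp
  next
    case (step n)
    then have "x (Suc n) - x n \<in> L m" using x[of n] L_mono[of m n] by auto
    from subspace_add[OF L(1) this step.IH] show ?case by simp
  qed
  define \<sigma> where "\<sigma> m n = {l + k |l k. l \<in> L n \<and> k \<in> Ker (j1 + m)}" for m n
  have "\<exists>N. \<forall>n\<ge>N. \<sigma> m n = \<sigma> m N" for m
  proof (rule subspaces_between_stabilise[OF codim'[of m]])
    show "subspace (\<sigma> m n)" for n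
      unfolding \<sigma>_def by (rule subspace_sums[OF L(1) subspace_ker])
    show "\<sigma> m (Suc n) \<subseteq> \<sigma> m n" for n using L(2) unfolding \<sigma>_def by blast
    show "Ker (j1 + m) \<subseteq> \<sigma> m n" for n
    proof
      fix v assume "v \<in> Ker (j1 + m)"
      then have "0 + v \<in> \<sigma> m n" unfolding \<sigma>_def using subspace_0[OF L(1)] by blast
      then show "v \<in> \<sigma> m n" by simp
    qed
    show "\<sigma> m n \<subseteq> Ker j1" for n
    proof
      fix v assume "v \<in> \<sigma> m n"
      then obtain l k where "l \<in> L n" "k \<in> Ker (j1 + m)" "v = l + k" unfolding \<sigma>_def by blast
      moreover have "l \<in> Ker j1" "k \<in> Ker j1"
        using calculation L(3)[of n] Ker_mono[of j1 "j1 + m"] by auto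
      ultimately show "v \<in> Ker j1" using subspace_add[OF subspace_ker] by blast
    qed
  qed
  then obtain N where N: "\<And>m n. N m \<le> n \<Longrightarrow> \<sigma> m n = \<sigma> m (N m)" by metis
  define \<nu> where "\<nu> m = m + (\<Sum>i\<le>m. N i)" for m
  have \<nu>: "m \<le> \<nu> m" "\<nu> m \<le> \<nu> (Suc m)" "N m \<le> \<nu> m" for m
    by (auto simp: \<nu>_def intro: trans_le_add2 member_le_sum)
  have step: "\<exists>z'. z' - x (\<nu> (Suc m)) \<in> L (\<nu> (Suc m)) \<and> z' - z \<in> Ker (j1 + m)"
    if z: "z - x (\<nu> m) \<in> L (\<nu> m)" for m z
  proof -
    have "(z - x (\<nu> m)) - (x (\<nu> (Suc m)) - x (\<nu> m)) \<in> L (\<nu> m)"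
      using z x_diff[OF \<nu>(2)] by (rule subspace_diff[OF L(1)])
    then have "z - x (\<nu> (Suc m)) + 0 \<in> \<sigma> m (\<nu> m)"
      unfolding \<sigma>_def by (intro CollectI exI[of _ "z - x (\<nu> (Suc m))"] exI[of _ 0]) simp
    also have "\<sigma> m (\<nu> m) = \<sigma> m (\<nu> (Suc m))"
      using N[of m "\<nu> m"] N[of m "\<nu> (Suc m)"] \<nu>(2)[of m] \<nu>(3)[of m] by simp
    finally obtain l k where lk: "l \<in> L (\<nu> (Suc m))" "k \<in> Ker (j1 + m)" "z - x (\<nu> (Suc m)) = l + k"
      unfolding \<sigma>_def by auto
    have "x (\<nu> (Suc m)) + l - z = - k" using lk(3) by (simp add: algebra_simps)
    then show ?thesis using lk by (intro exI[of _ "x (\<nu> (Suc m)) + l"]) auto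
  qed
  obtain z where z: "\<And>m. z m - x (\<nu> m) \<in> L (\<nu> m)" and zz: "\<And>m. z (Suc m) - z m \<in> Ker (j1 + m)"
  proof -
    have "\<exists>z. z - x (\<nu> 0) \<in> L (\<nu> 0)" using subspace_0[OF L(1)] by (intro exI[of _ "x (\<nu> 0)"]) simp
    from dependent_nat_choice[where P = "\<lambda>m z. z - x (\<nu> m) \<in> L (\<nu> m)"
        and Q = "\<lambda>m z z'. z' - z \<in> Ker (j1 + m)", OF this step]
    show ?thesis using that by blast
  qed
  have z_diff: "p m (z n' - z n) = 0" if "m \<le> j1 + n" "n \<le> n'" for m n n'
    using that(2)
  proof (induction n' rule: dec_induct)
    case (step k)
    have "p m (z (Suc k) - z k) = 0"
      using zz[of k] that(1) step.hyps by (intro p_eq_0_mono[of m "j1 + k"]) auto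
    with step.IH show ?case
      using p_diff_triangle[of m "z (Suc k)" "z n" "z k"] p_nonneg[of m "z (Suc k) - z n"] by linarith
  qed simp
  have "\<exists>N. \<forall>m\<ge>N. \<forall>n\<ge>N. p j (z m - z n) < \<epsilon>" if "0 < \<epsilon>" for j \<epsilon>
  proof (intro exI allI impI)
    fix m n assume mn: "j \<le> m" "j \<le> n"
    have "p j (z m - z j) = 0" "p j (z n - z j) = 0" using mn by (auto intro!: z_diff)
    then have "p j (z m - z n) = 0"
      using p_diff[of j "z m - z j" "z n - z j"] p_nonneg[of j "z m - z n"] by simp
    then show "p j (z m - z n) < \<epsilon>" using that by simp
  qed
  then obtain w where w: "\<And>j. (\<lambda>n. p j (z n - w)) \<longlonglongrightarrow> 0"
    using complete[of z] by blast
  have w_diff: "p m (w - z n) = 0" if "m \<le> j1 + n" for m n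
  proof -
    have "p m (w - z n) \<le> 0"
    proof (rule LIMSEQ_le_const[OF w[of m]], intro exI allI impI)
      fix n' assume "n \<le> n'"
      then show "p m (w - z n) \<le> p m (z n' - w)"
        using p_diff_triangle[of m w "z n" "z n'"] z_diff[OF that, of n'] p_minus_commute[of m w]
        by simp
    qed
    then show ?thesis using p_nonneg[of m "w - z n"] by linarith
  qed
  have "w - x n \<in> L n" for n
  proof -
    obtain m0 where m0: "Ker m0 \<subseteq> L n" using L(4) by blast
    define m where "m = max m0 n"
    have "w - z m \<in> Ker m0" using w_diff[of m0 m] by (simp add: m_def)
    then have "w - z m \<in> L n" using m0 by blast
    moreover have n: "n \<le> \<nu> m" using \<nu>(1)[of m] by (simp add: m_def)
    then have "z m - x (\<nu> m) \<in> L n" using z[of m] L_mono by blast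
    moreover have "x (\<nu> m) - x n \<in> L n" by (rule x_diff[OF n])
    ultimately have "(w - z m) + ((z m - x (\<nu> m)) + (x (\<nu> m) - x n)) \<in> L n"
      by (intro subspace_add L(1))
    then show ?thesis by simp
  qed
  then show ?thesis by blast
qed

lemma Ker_subset_null:
  assumes "finite F" "\<And>f. f \<in> F \<Longrightarrow> bounded_fun f"
  shows "\<exists>m. \<forall>x\<in>Ker m. \<forall>f\<in>F. f x = 0"
  using assms
proof (induction F)
  case (insert f F)
  then obtain m where m: "\<forall>x\<in>Ker m. \<forall>f\<in>F. f x = 0" by auto
  obtain k C where k: "0 \<le> C" "\<And>x. norm (f x) \<le> C * p k x"
    using insert.prems unfolding bounded_fun_def by blast
  have "f' x = 0" if "x \<in> Ker (max m k)" "f' \<in> insert f F" for x f'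
  proof -
    have "x \<in> Ker m" "x \<in> Ker k" using that(1) Ker_mono[of m "max m k"] Ker_mono[of k "max m k"] by auto
    then show ?thesis using that(2) m k(2)[of x] by auto
  qed
  then show ?case by blast
qed auto

end

context schauder_frechet begin

lemma linfun_coord: "linfun (\<lambda>x. coord x i)"
  by (simp add: linfun_def coord_add coord_scale)

text \<open>
  Consider the orbits of the coordinate functionals under the transpose of \<open>T\<close>, restricted to \<open>Z\<close>. If one of
  them is linearly independent, its common kernel meets every coset of \<open>Z\<close>. If the relevant ones are
  dependent, their spans are finite-dimensional, and so is the quotient of \<open>Z\<close> by their common kernel.
\<close>

theorem codim_imp_invariant_subspace:
  assumes codim: "\<And>j. j0 \<le> j \<Longrightarrow> finite_codim_in smul (Ker (Suc j)) (Ker j)"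
    and no_norm: "\<And>j. Ker j \<noteq> {0}"
    and lin: "Vector_Spaces.linear smul smul T" and bd: "bounded_op T"
  shows "\<exists>M. subspace M \<and> closed M \<and> M \<noteq> {0} \<and> M \<noteq> UNIV \<and> T ` M \<subseteq> M"
proof -
  interpret T: Vector_Spaces.linear smul smul T by (rule lin)
  have Ker_nz: "\<exists>x\<in>Ker m. x \<noteq> 0" for m using no_norm[of m] subspace_0[OF subspace_ker] by blast
  obtain y j' where y: "p j' y \<noteq> 0" using Ker_nz p_separates by blast
  define j1 where "j1 = max j0 j'"
  define Z where "Z = Ker j1"
  have Z: "subspace Z" unfolding Z_def by (rule subspace_ker)
  have yZ: "y \<notin> Z" using y Ker_mono[of j' j1] by (auto simp: Z_def j1_def)
  have codim1: "finite_codim_in smul (Ker (Suc j)) (Ker j)" if "j1 \<le> j" for j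
    using codim that by (simp add: j1_def)
  have codimZ: "finite_codim_in smul (Ker (j1 + m)) Z" for m
  proof (induction m)
    case (Suc m)
    then show ?case using finite_codim_in_trans[OF codim1[of "j1 + m"] Suc] by simp
  qed (simp add: finite_codim_in_refl Z_def)
  define g where "g i k x = coord ((T ^^ k) x) i" for i k x
  have Tpow: "(T ^^ k) (x + y) = (T ^^ k) x + (T ^^ k) y" "(T ^^ k) (c \<odot> x) = c \<odot> (T ^^ k) x" for k x y c
    by (induction k) (auto simp: T.add T.scale)
  have g: "linfun (g i k)" for i k by (simp add: linfun_def g_def Tpow coord_add coord_scale)
  have g_bd: "bounded_fun (g i k)" for i k
    unfolding g_def by (rule bounded_fun_compose[OF bounded_fun_coord bounded_op_funpow[OF bd]])
  obtain k0 C where k0: "\<And>x. p j1 (T x) \<le> C * p k0 x" using bd unfolding bounded_op_def by blast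
  have TK0: "T x \<in> Z" if "x \<in> Ker k0" for x
    using that p_nonneg[of j1 "T x"] k0[of x] by (simp add: Z_def del: p_nonneg)
  define k1 where "k1 = max k0 j1"
  have TK: "T x \<in> Z" if "x \<in> Ker k1" for x
    using that Ker_mono[of k0 k1] by (intro TK0) (auto simp: k1_def)
  have K1Z: "Ker k1 \<subseteq> Z" unfolding Z_def by (rule Ker_mono) (simp add: k1_def)
  \<comment> \<open>The coordinate functionals separate points, so by compactness finitely many of them suffice.\<close>
  have "\<exists>N. \<forall>x\<in>Z. (\<forall>i<N. coord x i = 0) \<longrightarrow> x \<in> Ker k1"
  proof (rule ccontr)
    assume no: "\<not> ?thesis"
    define L where "L n = {x\<in>Z. \<forall>i<n. coord x i = 0}" for n
    have L: "subspace (L n)" for n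
      using Z by (auto simp: L_def subspace_def coord_add coord_scale)
    define \<sigma> where "\<sigma> n = {l + k |l k. l \<in> L n \<and> k \<in> Ker k1}" for n
    have "\<exists>N. \<forall>n\<ge>N. \<sigma> n = \<sigma> N"
    proof (rule subspaces_between_stabilise)
      show "finite_codim_in smul (Ker k1) Z" using codimZ[of "k1 - j1"] by (simp add: k1_def)
      show "subspace (\<sigma> n)" for n
        unfolding \<sigma>_def by (rule subspace_sums[OF L subspace_ker])
      have "L (Suc n) \<subseteq> L n" for n by (auto simp: L_def)
      then show "\<sigma> (Suc n) \<subseteq> \<sigma> n" for n unfolding \<sigma>_def by blast
      show "Ker k1 \<subseteq> \<sigma> n" for n
      proof
        fix v assume "v \<in> Ker k1"
        then have "0 + v \<in> \<sigma> n" unfolding \<sigma>_def using subspace_0[OF L] by blast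
        then show "v \<in> \<sigma> n" by simp
      qed
      show "\<sigma> n \<subseteq> Z" for n
      proof
        fix v assume "v \<in> \<sigma> n"
        then obtain l k where lk: "l \<in> L n" "k \<in> Ker k1" "v = l + k" unfolding \<sigma>_def by blast
        then have "l \<in> Z" "k \<in> Z" using K1Z by (auto simp: L_def)
        then show "v \<in> Z" unfolding lk(3) by (rule subspace_add[OF Z])
      qed
    qed
    then obtain N where N: "\<And>n. N \<le> n \<Longrightarrow> \<sigma> n = \<sigma> N" by blast
    obtain v where v: "v \<in> L N" "v \<notin> Ker k1" using no by (auto simp: L_def)
    have "\<exists>l\<in>L (N + n). l - v \<in> Ker k1" for n
    proof -
      have "v + 0 \<in> \<sigma> N" unfolding \<sigma>_def using v(1) subspace_0[OF subspace_ker] by blast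
      then have "v \<in> \<sigma> (N + n)" using N[of "N + n"] by simp
      then obtain l k where "l \<in> L (N + n)" "k \<in> Ker k1" "v = l + k" unfolding \<sigma>_def by blast
      then show ?thesis by (intro bexI[of _ l]) auto
    qed
    then obtain l where l: "\<And>n. l n \<in> L (N + n)" "\<And>n. l n - v \<in> Ker k1" by metis
    have "\<exists>z. \<forall>n. z - l n \<in> L (N + n) \<inter> Ker k1"
    proof (rule linear_compactness[of j1])
      show "subspace (L (N + n) \<inter> Ker k1)" for n by (intro subspace_inter L subspace_ker)
      show "L (N + Suc n) \<inter> Ker k1 \<subseteq> L (N + n) \<inter> Ker k1" for n by (auto simp: L_def)
      show "L (N + n) \<inter> Ker k1 \<subseteq> Ker j1" for n using K1Z by (auto simp: Z_def)
      show "\<exists>m. Ker m \<subseteq> L (N + n) \<inter> Ker k1" for n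
      proof -
        obtain m where m: "\<forall>x\<in>Ker m. \<forall>f\<in>(\<lambda>i x. coord x i) ` {..<N + n}. f x = 0"
          using Ker_subset_null[of "(\<lambda>i x. coord x i) ` {..<N + n}"] bounded_fun_coord by auto
        have "Ker (max m k1) \<subseteq> L (N + n) \<inter> Ker k1"
          using m Ker_mono[of m "max m k1"] Ker_mono[of k1 "max m k1"] K1Z by (auto simp: L_def subset_eq)
        then show ?thesis by blast
      qed
      show "l (Suc n) - l n \<in> L (N + n) \<inter> Ker k1" for n
      proof
        have "l (Suc n) \<in> L (N + n)" using l(1)[of "Suc n"] by (auto simp: L_def)
        then show "l (Suc n) - l n \<in> L (N + n)" using l(1) by (intro subspace_diff L)
        show "l (Suc n) - l n \<in> Ker k1"
          using subspace_diff[OF subspace_ker l(2)[of "Suc n"] l(2)[of n]] by simp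
      qed
    qed (fact codim1)
    then obtain z where z: "\<And>n. z - l n \<in> L (N + n)" "\<And>n. z - l n \<in> Ker k1" by blast
    have zL: "z \<in> L (N + n)" for n
      using subspace_add[OF L z(1)[of n] l(1)[of n]] by simp
    have "coord z i = 0" for i
    proof -
      have "\<forall>j<N + Suc i. coord z j = 0" using zL[of "Suc i"] by (simp add: L_def)
      then show ?thesis by simp
    qed
    then have "z = 0" by (rule coord_separates)
    then have "- v \<in> Ker k1" using subspace_add[OF subspace_ker z(2)[of 0] l(2)[of 0]] by simp
    with v(2) show False by simp
  qed
  then obtain N where N: "\<And>x. x \<in> Z \<Longrightarrow> (\<And>i. i < N \<Longrightarrow> coord x i = 0) \<Longrightarrow> x \<in> Ker k1" by blast
  show ?thesis
  proof (cases "\<exists>i<N. \<forall>d c. \<exists>z\<in>Z. g i d z \<noteq> (\<Sum>k<d. c k * g i k z)")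
    case True
    then obtain i where indep: "\<And>d c. \<exists>z\<in>Z. g i d z \<noteq> (\<Sum>k<d. c k * g i k z)" by blast
    define L where "L n = {z\<in>Z. \<forall>k<n. g i k z = 0}" for n
    have L: "subspace (L n)" for n
      using Z linfun_0[OF g] by (auto simp: L_def subspace_def linfun_add[OF g] linfun_scale[OF g])
    obtain x where x: "\<And>n. x n \<in> Z" "\<And>n k. k < n \<Longrightarrow> g i k (x n) = g i k y"
      using linfun_interpolate[of "g i" Z _ "\<lambda>k. g i k y", OF g Z indep] by metis
    have "\<exists>z. \<forall>n. z - x n \<in> L n"
    proof (rule linear_compactness[of j1])
      show "L (Suc n) \<subseteq> L n" "L n \<subseteq> Ker j1" for n by (auto simp: L_def Z_def)
      show "\<exists>m. Ker m \<subseteq> L n" for n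
      proof -
        obtain m where m: "\<forall>x\<in>Ker m. \<forall>f\<in>g i ` {..<n}. f x = 0"
          using Ker_subset_null[of "g i ` {..<n}"] g_bd by auto
        have "Ker (max m j1) \<subseteq> L n"
          using m Ker_mono[of m "max m j1"] Ker_mono[of j1 "max m j1"] by (auto simp: L_def Z_def subset_eq)
        then show ?thesis by blast
      qed
      show "x (Suc n) - x n \<in> L n" for n
        using x Z by (auto simp: L_def linfun_diff[OF g] intro: subspace_diff)
    qed (fact codim1 L)+
    then obtain z where z: "\<And>n. z - x n \<in> L n" by blast
    have "z \<in> Z" using subspace_add[OF Z _ x(1)[of 0], of "z - x 0"] z[of 0] by (simp add: L_def)
    \<comment> \<open>\<open>z\<close> lies in \<open>Z\<close> and \<open>y\<close> does not, so \<open>y - z\<close> is a nonzero common zero.\<close>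
    have gz: "g i k (y - z) = 0" for k
      using z[of "Suc k"] x(2)[of k "Suc k"] by (simp add: L_def linfun_diff[OF g])
    define M where "M = {x. \<forall>f\<in>range (g i). f x = 0}"
    have "subspace M"
      using linfun_0[OF g] by (auto simp: M_def subspace_def linfun_add[OF g] linfun_scale[OF g])
    moreover have "closed M"
      unfolding M_def by (rule closed_null_set) (auto simp: linfun_diff[OF g] g_bd)
    moreover have "y - z \<in> M" "y - z \<noteq> 0" using gz yZ \<open>z \<in> Z\<close> by (auto simp: M_def)
    moreover obtain w where "g i 0 w \<noteq> 0" using indep[of 0 "\<lambda>_. 0"] by auto
    then have "w \<notin> M" by (auto simp: M_def)
    moreover have "T ` M \<subseteq> M"
    proof clarify
      fix x assume "x \<in> M"
      then have "g i (Suc k) x = 0" for k by (auto simp: M_def)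
      then show "T x \<in> M" by (auto simp: M_def g_def funpow_swap1)
    qed
    ultimately show ?thesis by (intro exI[of _ M]) auto
  next
    case False
    then obtain d c where dc: "\<And>i z. i < N \<Longrightarrow> z \<in> Z \<Longrightarrow> g i (d i) z = (\<Sum>k<d i. c i k * g i k z)"
      by metis
    define F where "F = (\<Union>i<N. g i ` {..<d i})"
    \<comment> \<open>The recursion expresses \<open>g i (d i)\<close> by the functionals in \<open>F\<close>, which makes \<open>M\<close> invariant.\<close>
    define M where "M = Z \<inter> {x. \<forall>f\<in>F. f x = 0}"
    have F: "linfun f" "bounded_fun f" if "f \<in> F" for f using that g g_bd by (auto simp: F_def)
    have "subspace M"
      using Z F(1) linfun_0 by (auto simp: M_def subspace_def linfun_add linfun_scale)
    moreover have "closed M"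
      unfolding M_def Z_def by (intro closed_Int closed_ker closed_null_set F linfun_diff)
    moreover have "M \<noteq> UNIV" using yZ by (auto simp: M_def)
    moreover have "M \<noteq> {0}"
    proof -
      have "finite F" by (auto simp: F_def)
      then obtain m where "\<forall>x\<in>Ker m. \<forall>f\<in>F. f x = 0"
        using Ker_subset_null[of F] F(2) by auto
      then have "Ker (max m j1) \<subseteq> M"
        using Ker_mono[of m "max m j1"] Ker_mono[of j1 "max m j1"] by (auto simp: M_def Z_def)
      then show ?thesis using Ker_nz[of "max m j1"] by blast
    qed
    moreover have "T ` M \<subseteq> M"
    proof clarify
      fix x assume x: "x \<in> M"
      then have xZ: "x \<in> Z" by (simp add: M_def)
      have g0: "g i k x = 0" if "i < N" "k \<le> d i" for i k
      proof (cases "k = d i")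
        case True
        have "g i (d i) x = (\<Sum>k<d i. c i k * g i k x)" by (rule dc[OF that(1) xZ])
        also have "\<dots> = 0" using x that(1) by (intro sum.neutral) (auto simp: M_def F_def)
        finally show ?thesis using True by simp
      next
        case False
        then show ?thesis using x that by (auto simp: M_def F_def)
      qed
      have "coord x i = 0" if "i < N" for i using g0[OF that, of 0] by (simp add: g_def)
      then have "T x \<in> Z" by (intro TK N xZ)
      moreover have "g i k (T x) = 0" if "i < N" "k < d i" for i k
        using g0[OF that(1), of "Suc k"] that(2) by (simp add: g_def funpow_swap1)
      ultimately show "T x \<in> M" by (auto simp: M_def F_def)
    qed
    ultimately show ?thesis by blast
  qed
qed

end

section \<open>Approximate inversion of polynomials\<close>

text \<open>
  The coefficients of the inverse of the power series \<open>c\<close>, up to degree \<open>e\<close>. The recursion for them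
  divides by \<open>c 0\<close> only, whence the uniform bound.
\<close>

lemma truncated_inverse_bound:
  fixes \<tau> :: real
  assumes "0 < \<tau>"
  shows "\<exists>G\<ge>0. \<forall>c :: nat \<Rightarrow> 'k::real_normed_field. \<tau> \<le> norm (c 0) \<and> (\<forall>i. norm (c i) \<le> 1) \<longrightarrow>
           (\<exists>g. (\<forall>j. norm (g j) \<le> G) \<and> (\<forall>j\<ge>e. g j = 0) \<and>
                (\<forall>i<e. (\<Sum>j\<le>i. g j * c (i - j)) = (if i = 0 then 1 else 0)))"
proof (induction e)
  case 0
  show ?case by (intro exI[of _ 0]) (auto intro!: exI[of _ "\<lambda>_. 0"])
next
  case (Suc e)
  then obtain G where G: "0 \<le> G" and ex: "\<And>c :: nat \<Rightarrow> 'k. \<tau> \<le> norm (c 0) \<Longrightarrow> (\<And>i. norm (c i) \<le> 1) \<Longrightarrow>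
       \<exists>g. (\<forall>j. norm (g j) \<le> G) \<and> (\<forall>j\<ge>e. g j = 0) \<and>
           (\<forall>i<e. (\<Sum>j\<le>i. g j * c (i - j)) = (if i = 0 then 1 else 0))"
    by blast
  define G' where "G' = max G ((1 + real e * G) / \<tau>)"
  have "\<exists>g. (\<forall>j. norm (g j) \<le> G') \<and> (\<forall>j\<ge>Suc e. g j = 0) \<and>
           (\<forall>i<Suc e. (\<Sum>j\<le>i. g j * c (i - j)) = (if i = 0 then 1 else 0))"
    if c: "\<tau> \<le> norm (c 0)" "\<And>i. norm (c i) \<le> 1" for c :: "nat \<Rightarrow> 'k"
  proof -
    obtain g where g: "\<And>j. norm (g j) \<le> G" "\<And>j. e \<le> j \<Longrightarrow> g j = 0"
      "\<And>i. i < e \<Longrightarrow> (\<Sum>j\<le>i. g j * c (i - j)) = (if i = 0 then 1 else 0)"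
      using ex[of c] c by blast
    have c0: "c 0 \<noteq> 0" using c(1) assms by auto
    define r where "r = (if e = 0 then 1 else 0) - (\<Sum>j<e. g j * c (e - j))"
    define g' where "g' = g(e := r / c 0)"
    have "norm (\<Sum>j<e. g j * c (e - j)) \<le> (\<Sum>j<e. G * 1)"
      using mult_mono[OF g(1) c(2) G norm_ge_zero] by (intro sum_norm_le) (simp add: norm_mult)
    then have "norm r \<le> 1 + real e * G"
      unfolding r_def by (intro order_trans[OF norm_triangle_ineq4] add_mono) auto
    then have "norm (r / c 0) \<le> (1 + real e * G) / \<tau>"
      using c(1) assms G unfolding norm_divide by (intro frac_le) auto
    then have "norm (g' j) \<le> G'" for j
      using g(1)[of j] by (auto simp: g'_def G'_def)
    moreover have "\<forall>j\<ge>Suc e. g' j = 0" using g(2) by (simp add: g'_def)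
    moreover have "(\<Sum>j\<le>i. g' j * c (i - j)) = (if i = 0 then 1 else 0)" if i: "i < Suc e" for i
    proof (cases "i = e")
      case True
      have "(\<Sum>j\<le>e. g' j * c (e - j)) = (\<Sum>j<e. g' j * c (e - j)) + r"
        using c0 by (simp add: lessThan_Suc_atMost[symmetric] g'_def)
      also have "(\<Sum>j<e. g' j * c (e - j)) = (\<Sum>j<e. g j * c (e - j))"
        by (intro sum.cong) (auto simp: g'_def)
      finally show ?thesis using True by (simp add: r_def)
    next
      case False
      then have "(\<Sum>j\<le>i. g' j * c (i - j)) = (\<Sum>j\<le>i. g j * c (i - j))"
        using i by (intro sum.cong) (auto simp: g'_def)
      then show ?thesis using False i g(3)[of i] by simp
    qed
    ultimately show ?thesis by blast
  qed
  moreover have "0 \<le> G'" using G by (simp add: G'_def)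
  ultimately show ?case by blast
qed

text \<open>
  Sequences stand for the coefficients of polynomials. The product \<open>P c\<close> is required to be near \<open>t\<^sup>n\<close> only in
  degrees below \<open>n + l\<close>.
\<close>

definition approx_invertible :: "nat \<Rightarrow> nat \<Rightarrow> real \<Rightarrow> real \<Rightarrow> (nat \<Rightarrow> 'k::real_normed_field) \<Rightarrow> bool" where
  "approx_invertible n l \<delta> \<Lambda> c \<longleftrightarrow>
     (\<exists>P. (\<forall>j. norm (P j) \<le> \<Lambda>) \<and> (\<forall>j\<ge>n + l. P j = 0) \<and>
          (\<forall>i<n + l. norm ((\<Sum>j\<le>i. P j * c (i - j)) - (if i = n then 1 else 0)) \<le> \<delta>))"

text \<open>
  If the coefficients before \<open>c v\<close> were zero, the truncated inverse of \<open>c\<^sub>v + c\<^sub>v\<^sub>+\<^sub>1 t + \<dots>\<close> multiplied by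
  \<open>t\<^bsup>n-v\<^esup>\<close> would do; if they are merely tiny, they contribute an error that is tiny relative to
  the bound \<open>G\<close> of that inverse.
\<close>

lemma approx_inverse_at:
  fixes \<tau> \<delta> :: real
  assumes \<tau>: "0 < \<tau>" and \<delta>: "0 < \<delta>" and v: "v \<le> n"
  shows "\<exists>\<Lambda>\<ge>0. \<exists>\<eta>>0. \<forall>c :: nat \<Rightarrow> 'k::real_normed_field.
           (\<forall>i. norm (c i) \<le> 1) \<and> \<tau> \<le> norm (c v) \<and> (\<forall>i<v. norm (c i) \<le> \<eta>) \<longrightarrow>
           approx_invertible n e \<delta> \<Lambda> c"
proof -
  obtain G where G: "0 \<le> G" and ex: "\<And>c :: nat \<Rightarrow> 'k. \<tau> \<le> norm (c 0) \<Longrightarrow> (\<And>i. norm (c i) \<le> 1) \<Longrightarrow>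
       \<exists>g. (\<forall>j. norm (g j) \<le> G) \<and> (\<forall>j\<ge>e. g j = 0) \<and>
           (\<forall>i<e. (\<Sum>j\<le>i. g j * c (i - j)) = (if i = 0 then 1 else 0))"
    using truncated_inverse_bound[OF \<tau>, where 'k = 'k and e = e] by blast
  define \<eta> where "\<eta> = \<delta> / (real e * G + 1)"
  have \<eta>: "0 < \<eta>" "real e * (G * \<eta>) \<le> \<delta>"
    using \<delta> G by (auto simp: \<eta>_def field_simps add_pos_nonneg intro!: mult_nonneg_nonneg)
  have "approx_invertible n e \<delta> G c"
    if c: "\<And>i. norm (c i) \<le> 1" "\<tau> \<le> norm (c v)" "\<And>i. i < v \<Longrightarrow> norm (c i) \<le> \<eta>" for c :: "nat \<Rightarrow> 'k"
  proof -
    obtain g where g: "\<And>j. norm (g j) \<le> G" "\<And>j. e \<le> j \<Longrightarrow> g j = 0"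
      "\<And>i. i < e \<Longrightarrow> (\<Sum>j\<le>i. g j * c (v + (i - j))) = (if i = 0 then 1 else 0)"
      using ex[of "\<lambda>i. c (v + i)"] c by auto
    have small: "norm (\<Sum>t\<in>A. g t * c (h - t)) \<le> \<delta>"
      if "finite A" "\<And>t. t \<in> A \<Longrightarrow> h - t < v" for A h
    proof -
      have "(\<Sum>t\<in>A. g t * c (h - t)) = (\<Sum>t\<in>A \<inter> {..<e}. g t * c (h - t))"
        using that(1) g(2) by (intro sum.mono_neutral_right) (auto simp: not_less[symmetric])
      also have "norm \<dots> \<le> real (card (A \<inter> {..<e})) * (G * \<eta>)"
        using that(2) by (intro sum_norm_bound) (auto simp: norm_mult intro!: mult_mono g c G)
      also have "\<dots> \<le> real e * (G * \<eta>)"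
        using card_mono[of "{..<e}" "A \<inter> {..<e}"] G \<eta>(1) by (intro mult_right_mono) auto
      finally show ?thesis using \<eta>(2) by linarith
    qed
    define P where "P j = (if n - v \<le> j then g (j - (n - v)) else 0)" for j
    have conv: "(\<Sum>j\<le>i. P j * c (i - j)) = (\<Sum>t\<le>i - (n - v). g t * c (i - (n - v) - t))"
      if "n - v \<le> i" for i
    proof -
      have "(\<Sum>j\<le>i. P j * c (i - j)) = (\<Sum>j\<in>{n - v..i}. P j * c (i - j))"
        by (intro sum.mono_neutral_right) (auto simp: P_def)
      also have "\<dots> = (\<Sum>t\<le>i - (n - v). g t * c (i - (n - v) - t))"
        using that
        by (intro sum.reindex_bij_witness[of _ "\<lambda>t. t + (n - v)" "\<lambda>j. j - (n - v)"])
           (auto simp: P_def)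
      finally show ?thesis .
    qed
    have "norm ((\<Sum>j\<le>i. P j * c (i - j)) - (if i = n then 1 else 0)) \<le> \<delta>" if i: "i < n + e" for i
    proof (cases "n - v \<le> i")
      case False
      then have "(\<Sum>j\<le>i. P j * c (i - j)) = 0" by (intro sum.neutral) (auto simp: P_def)
      then show ?thesis using False \<delta> by auto
    next
      case True
      define h where "h = i - (n - v)"
      show ?thesis
      proof (cases "h < v")
        case True
        then have "i \<noteq> n" using v by (auto simp: h_def)
        then show ?thesis
          using small[of "{..h}" h] True by (simp add: conv[OF \<open>n - v \<le> i\<close>] flip: h_def)
      next
        case False
        define l where "l = h - v"
        have l: "h = v + l" "l < e" "i = n \<longleftrightarrow> l = 0"
          using False True i v by (auto simp: l_def h_def)
        have "{..h} = {..l} \<union> {l<..h}" using l by auto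
        then have "(\<Sum>t\<le>h. g t * c (h - t)) = (\<Sum>t\<le>l. g t * c (h - t)) + (\<Sum>t\<in>{l<..h}. g t * c (h - t))"
          by (metis finite_atMost finite_greaterThanAtMost ivl_disj_int_one(3) sum.union_disjoint)
        also have "(\<Sum>t\<le>l. g t * c (h - t)) = (\<Sum>t\<le>l. g t * c (v + (l - t)))"
          by (intro sum.cong) (auto simp: l)
        also have "\<dots> = (if i = n then 1 else 0)" using g(3)[OF l(2)] l(3) by simp
        finally have "(\<Sum>t\<le>h. g t * c (h - t)) - (if i = n then 1 else 0)
            = (\<Sum>t\<in>{l<..h}. g t * c (h - t))" by simp
        moreover have "norm (\<Sum>t\<in>{l<..h}. g t * c (h - t)) \<le> \<delta>"
          using l by (intro small) auto
        ultimately show ?thesis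
          unfolding conv[OF \<open>n - v \<le> i\<close>] h_def[symmetric] by simp
      qed
    qed
    moreover have "norm (P j) \<le> G" for j using g(1) G by (simp add: P_def)
    moreover have "\<forall>j\<ge>n + e. P j = 0" using v by (auto simp: P_def intro!: g(2))
    ultimately show ?thesis unfolding approx_invertible_def by blast
  qed
  then show ?thesis using G \<eta>(1) by blast
qed

text \<open>
  The bound has to be uniform over all normalised \<open>c\<close>, although no fixed coefficient is bounded
  below. Going down from \<open>v = n\<close>: either \<open>c v\<close> is at least the threshold that was reached for \<open>v + 1\<close>,
  and the preceding lemma applies at \<open>v\<close>, or it is below that threshold, and the case \<open>v + 1\<close> applies.
\<close>

theorem approx_inverse:
  fixes \<delta> :: real
  assumes \<delta>: "0 < \<delta>"
  shows "\<exists>\<Lambda>\<ge>0. \<forall>c :: nat \<Rightarrow> 'k::real_normed_field.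
           (\<forall>i. norm (c i) \<le> 1) \<and> (\<exists>i\<le>n. norm (c i) = 1) \<longrightarrow>
           approx_invertible n e \<delta> \<Lambda> c"
proof -
  have good_mono: "approx_invertible n e \<delta> \<Lambda>' c" if "approx_invertible n e \<delta> \<Lambda> c" "\<Lambda> \<le> \<Lambda>'" for \<Lambda> \<Lambda>' and c :: "nat \<Rightarrow> 'k"
    using that unfolding approx_invertible_def by (meson order_trans)
  have "\<exists>\<Lambda>\<ge>0. \<exists>\<eta>>0. \<forall>c :: nat \<Rightarrow> 'k. (\<forall>i. norm (c i) \<le> 1) \<and> (\<exists>i\<le>n. norm (c i) = 1) \<and>
      (\<forall>i<n - d. norm (c i) \<le> \<eta>) \<longrightarrow> approx_invertible n e \<delta> \<Lambda> c" for d
  proof (induction d)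
    case 0
    obtain \<Lambda> \<eta> where \<Lambda>: "0 \<le> \<Lambda>" "0 < \<eta>" and at: "\<And>c :: nat \<Rightarrow> 'k. (\<And>i. norm (c i) \<le> 1) \<Longrightarrow>
        1 \<le> norm (c n) \<Longrightarrow> (\<And>i. i < n \<Longrightarrow> norm (c i) \<le> \<eta>) \<Longrightarrow> approx_invertible n e \<delta> \<Lambda> c"
      using approx_inverse_at[OF zero_less_one \<delta> order_refl, of n e, where 'k = 'k] by blast
    have "approx_invertible n e \<delta> \<Lambda> c" if c: "\<And>i. norm (c i) \<le> 1" "\<exists>i\<le>n. norm (c i) = 1"
        "\<And>i. i < n \<Longrightarrow> norm (c i) \<le> min \<eta> (1/2)" for c :: "nat \<Rightarrow> 'k"
    proof -
      obtain i where "i \<le> n" "norm (c i) = 1" using c(2) by blast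
      then have "norm (c n) = 1" using c(3)[of i] by (cases "i = n") auto
      then show ?thesis using c by (intro at) auto
    qed
    then show ?case using \<Lambda> by (intro exI[of _ \<Lambda>] conjI exI[of _ "min \<eta> (1/2)"]) auto
  next
    case (Suc d)
    then obtain \<Lambda>1 \<eta>1 where 1: "0 \<le> \<Lambda>1" "0 < \<eta>1" and IH: "\<And>c :: nat \<Rightarrow> 'k. (\<And>i. norm (c i) \<le> 1) \<Longrightarrow>
        \<exists>i\<le>n. norm (c i) = 1 \<Longrightarrow> (\<And>i. i < n - d \<Longrightarrow> norm (c i) \<le> \<eta>1) \<Longrightarrow> approx_invertible n e \<delta> \<Lambda>1 c"
      by blast
    obtain \<Lambda>2 \<eta>2 where 2: "0 \<le> \<Lambda>2" "0 < \<eta>2" and at: "\<And>c :: nat \<Rightarrow> 'k. (\<And>i. norm (c i) \<le> 1) \<Longrightarrow>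
        \<eta>1 \<le> norm (c (n - Suc d)) \<Longrightarrow> (\<And>i. i < n - Suc d \<Longrightarrow> norm (c i) \<le> \<eta>2) \<Longrightarrow> approx_invertible n e \<delta> \<Lambda>2 c"
      using approx_inverse_at[OF 1(2) \<delta> diff_le_self[of n "Suc d"], of e, where 'k = 'k] by blast
    have "approx_invertible n e \<delta> (max \<Lambda>1 \<Lambda>2) c" if c: "\<And>i. norm (c i) \<le> 1" "\<exists>i\<le>n. norm (c i) = 1"
        "\<And>i. i < n - Suc d \<Longrightarrow> norm (c i) \<le> min \<eta>1 \<eta>2" for c :: "nat \<Rightarrow> 'k"
    proof (cases "\<eta>1 \<le> norm (c (n - Suc d))")
      case True
      then have "approx_invertible n e \<delta> \<Lambda>2 c" using c by (intro at) auto
      then show ?thesis by (rule good_mono) simp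
    next
      case False
      have "norm (c i) \<le> \<eta>1" if "i < n - d" for i
        using that c(3)[of i] False by (cases "i = n - Suc d") auto
      then have "approx_invertible n e \<delta> \<Lambda>1 c" using c by (intro IH) auto
      then show ?thesis by (rule good_mono) simp
    qed
    then show ?case using 1 2
      by (intro exI[of _ "max \<Lambda>1 \<Lambda>2"] conjI exI[of _ "min \<eta>1 \<eta>2"]) auto
  qed
  from this[of n] obtain \<Lambda> \<eta> where "0 \<le> \<Lambda>" and \<Lambda>: "\<And>c :: nat \<Rightarrow> 'k. (\<forall>i. norm (c i) \<le> 1) \<and>
      (\<exists>i\<le>n. norm (c i) = 1) \<and> (\<forall>i<n - n. norm (c i) \<le> \<eta>) \<longrightarrow> approx_invertible n e \<delta> \<Lambda> c"
    by blast
  moreover have "\<forall>i<n - n. norm (c i) \<le> \<eta>" for c :: "nat \<Rightarrow> 'k" by simp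
  ultimately show ?thesis by blast
qed

section \<open>The combinatorial plan of the operator\<close>

text \<open>
  The orbit is planned in stages. Write \<open>e = start r\<close>. Stage \<open>r\<close> occupies the positions from \<open>e\<close> to
  \<open>start (r + 1) - 1 = (4 r + 12) e - 1\<close>, divided into blocks of length \<open>e\<close>; position \<open>0\<close> is
  in no stage.

  \<^item> In the blocks \<open>1, \<dots>, r + 2\<close> the level descends from \<open>r + 1\<close> to \<open>0\<close>.
  \<^item> Block \<open>r + 3\<close> is a first return, of level \<open>r + 1\<close>: \<open>u\<close> at \<open>(r + 3) e + l\<close> repeats \<open>u\<close> at \<open>l\<close>.
  \<^item> Then the level descends again, two blocks at a time, and from block \<open>3 r + 7\<close> on it is the
    target level of the stage.
  \<^item> From block \<open>3 r + 9\<close> on, the blocks \<open>1, \<dots>, r + 3\<close> of the stage are repeated.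

  The next stage starts at level \<open>r + 2\<close>. Two properties of this plan matter. The level drops by at
  most one within \<open>e\<close> steps, so that all powers of \<open>T\<close> up to \<open>T\<^sup>e\<close>, and with them the polynomials
  used in earlier stages, lose only one seminorm. And both returns are broken off at positions whose
  repeated vectors have level \<open>r + 1\<close>, which makes the interruption invisible to the first \<open>r + 1\<close> seminorms.

  Why two returns: in front of a return, \<open>u\<close> must be visible, and its size there enters the choice of the
  polynomials of the stage, while the sizes in the last blocks have to be chosen after these
  polynomials. The second return repeats the first one together with the vectors in front of
  it, adding only vectors of the target level, which may be huge since the seminorm for which the
  stage is made does not see them.
\<close>

fun start :: "nat \<Rightarrow> nat" where
  "start 0 = 1"
| "start (Suc r) = (4 * r + 12) * start r"

text \<open>
  Every positive number is the target of infinitely many stages. Stage \<open>r\<close> serves to approximate \<open>u\<^sub>0\<close> in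
  the seminorm \<open>target r - 1\<close>, which is blind to the target level.
\<close>

definition target :: "nat \<Rightarrow> nat" where
  "target r = Suc (fst (prod_decode r))"

definition stage :: "nat \<Rightarrow> nat" where
  "stage k = (LEAST r. k < start (Suc r))"

definition block :: "nat \<Rightarrow> nat" where
  "block k = k div start (stage k)"

definition level :: "nat \<Rightarrow> nat" where
  "level k = (let r = stage k; q = block k in
     if k = 0 then 0
     else if q \<le> r + 2 then r + 2 - q
     else max (target r) (r + 1 - (q - (r + 3)) div 2))"

text \<open>
  The parent of a position is the position whose vector is repeated there.
\<close>

definition parent :: "nat \<Rightarrow> nat option" where
  "parent k = (let r = stage k; q = block k in
     if q = r + 3 then Some (k - (r + 3) * start r)
     else if 3 * r + 9 \<le> q then Some (k - (3 * r + 8) * start r)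
     else None)"

lemma start_pos [simp]: "0 < start r"
  by (induction r) auto

lemma start_Suc_gt: "start r < start (Suc r)"
  by simp

declare start.simps(2) [simp del]

lemma start_le_block: "q * start r \<le> k \<Longrightarrow> 0 < q \<Longrightarrow> start r \<le> k"
  using mult_le_mono1[of 1 q "start r"] by linarith

lemma start_le_pos: "start r \<le> k \<Longrightarrow> 0 < k"
  using start_pos[of r] by linarith

lemma start_less: "r < s \<Longrightarrow> start r < start s"
  by (rule lift_Suc_mono_less[of start]) (rule start_Suc_gt)

lemma start_mono: "r \<le> s \<Longrightarrow> start r \<le> start s"
  using start_less[of r s] by (cases "r = s") auto

lemma start_gt: "r < start r"
proof (induction r)
  case (Suc r)
  have "Suc (start r) \<le> start (Suc r)" using start_Suc_gt[of r] by (rule Suc_leI)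
  with Suc show ?case by linarith
qed simp

lemma stage_upper: "k < start (Suc (stage k))"
proof -
  have "k < start (Suc k)" using start_gt[of "Suc k"] by linarith
  then show ?thesis unfolding stage_def by (rule LeastI)
qed

lemma stage_lower: assumes "0 < k" shows "start (stage k) \<le> k"
proof (cases "stage k")
  case (Suc r)
  then show ?thesis using not_less_Least[of r "\<lambda>r. k < start (Suc r)"] by (fold stage_def) simp
qed (use assms in simp)

lemma stage_eqI: assumes "start r \<le> k" "k < start (Suc r)" shows "stage k = r"
proof (rule antisym)
  show "stage k \<le> r" unfolding stage_def by (rule Least_le) fact
  show "r \<le> stage k"
  proof (rule ccontr)
    assume "\<not> r \<le> stage k"
    then have "start (Suc (stage k)) \<le> start r" by (intro start_mono) simp
    then show False using stage_upper[of k] assms by linarith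
  qed
qed

lemma stage_mono: assumes "j \<le> k" shows "stage j \<le> stage k"
  unfolding stage_def[of j] using stage_upper[of k] assms by (intro Least_le) linarith

lemma stage_ge: "start r \<le> k \<Longrightarrow> r \<le> stage k"
  using stage_mono[of "start r" k] stage_eqI[of r "start r"] start_Suc_gt[of r] by simp

lemma target_le: "target r \<le> Suc r"
  using le_prod_encode_1[of "fst (prod_decode r)" "snd (prod_decode r)"] by (simp add: target_def)

lemma target_pos: "0 < target r"
  by (simp add: target_def)

lemma target_unbounded: "\<exists>r\<ge>N. target r = Suc s"
  by (rule exI[of _ "prod_encode (s, N)"]) (simp add: target_def le_prod_encode_2)

lemma start_Suc_eq: "start (Suc r) = 4 * (r * start r) + 12 * start r"
  by (simp add: start.simps algebra_simps)

text \<open>Positions are located by their block: \<open>k = q \<cdot> start r + l\<close>.\<close>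

lemma blockI:
  assumes "q * start r \<le> k" "k < Suc q * start r" "0 < q" "q < 4 * r + 12"
  shows "stage k = r" "block k = q"
proof -
  have "Suc q * start r \<le> start (Suc r)"
    using assms(4) unfolding start.simps by (intro mult_le_mono1) simp
  then show st: "stage k = r"
    using assms(2) start_le_block[OF assms(1,3)] by (intro stage_eqI) auto
  show "block k = q" unfolding block_def st by (rule div_nat_eqI) (use assms in \<open>auto simp: mult.commute\<close>)
qed

lemma blockE:
  assumes "start r \<le> k" "k < start (Suc r)"
  shows "stage k = r" "block k * start r \<le> k" "k < Suc (block k) * start r" "0 < block k"
    "block k < 4 * r + 12" "k \<noteq> 0"
proof -
  show st: "stage k = r" by (rule stage_eqI) fact+
  show "block k * start r \<le> k" by (simp add: block_def st)
  show "k < Suc (block k) * start r"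
    using dividend_less_times_div[of "start r" k] by (simp add: block_def st mult.commute)
  show "0 < block k" using assms by (simp add: block_def st div_greater_zero_iff)
  show "block k < 4 * r + 12" using assms(2) unfolding block_def st
    by (intro less_mult_imp_div_less) (simp add: start.simps)
  show "k \<noteq> 0" using assms start_pos[of r] by linarith
qed

lemma block_le_iff:
  assumes "start r \<le> k" "k < start (Suc r)"
  shows "q \<le> block k \<longleftrightarrow> q * start r \<le> k"
  using blockE(1)[OF assms] by (simp add: block_def less_eq_div_iff_mult_less_eq)

lemma level_first:
  assumes "start r \<le> k" "k < 2 * start r"
  shows "stage k = r" "level k = r + 1" "parent k = None"
proof -
  have b: "stage k = r" "block k = 1" using blockI[of 1 r k] assms by auto
  then show "stage k = r" "level k = r + 1" "parent k = None"
    using assms start_pos[of r] by (auto simp: level_def parent_def)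
qed

lemma level_final:
  assumes "(3 * r + 7) * start r \<le> k" "k < start (Suc r)"
  shows "level k = target r"
proof -
  have k: "start r \<le> k" using assms(1) by (rule start_le_block) simp
  have "3 * r + 7 \<le> block k" using block_le_iff[OF k assms(2)] assms(1) by blast
  then show ?thesis using blockE[OF k assms(2)] target_pos[of r] by (auto simp: level_def)
qed

lemma level_ge_target:
  assumes "(r + 3) * start r \<le> k" "k < start (Suc r)"
  shows "target r \<le> level k"
proof -
  have k: "start r \<le> k" using assms(1) by (rule start_le_block) simp
  have "r + 3 \<le> block k" using block_le_iff[OF k assms(2)] assms(1) by blast
  then show ?thesis using blockE[OF k assms(2)] by (auto simp: level_def)
qed

lemma level_return:
  assumes "(r + 3) * start r \<le> k" "k < (r + 5) * start r"
  shows "level k = r + 1"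
proof -
  have k: "start r \<le> k" "k < start (Suc r)"
    using assms start_pos[of r] unfolding start_Suc_eq by (auto simp: algebra_simps)
  have "r + 3 \<le> block k" "\<not> r + 5 \<le> block k"
    unfolding block_le_iff[OF k] using assms by auto
  then show ?thesis using blockE[OF k] target_le[of r] by (auto simp: level_def)
qed

lemma parent_early:
  assumes "start r \<le> k" "k < (r + 3) * start r"
  shows "parent k = None"
proof -
  have k: "start r \<le> k" "k < start (Suc r)"
    using assms start_pos[of r] unfolding start_Suc_eq by (auto simp: algebra_simps)
  have "\<not> r + 3 \<le> block k" unfolding block_le_iff[OF k] using assms by auto
  then show ?thesis using blockE[OF k] by (auto simp: parent_def)
qed

lemma parent_return:
  assumes "(r + 3) * start r \<le> k" "k < (r + 4) * start r"
  shows "parent k = Some (k - (r + 3) * start r)"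
proof -
  have "stage k = r" "block k = r + 3"
    using blockI[of "r + 3" r k] assms by (auto simp: algebra_simps)
  then show ?thesis by (simp add: parent_def)
qed

lemma parent_middle:
  assumes "(r + 4) * start r \<le> k" "k < (3 * r + 9) * start r"
  shows "parent k = None"
proof -
  have k: "start r \<le> k" "k < start (Suc r)"
    using assms start_pos[of r] unfolding start_Suc_eq by (auto simp: algebra_simps)
  have "r + 4 \<le> block k" "\<not> 3 * r + 9 \<le> block k" unfolding block_le_iff[OF k] using assms by auto
  then show ?thesis using blockE[OF k] by (auto simp: parent_def)
qed

lemma parent_late:
  assumes "(3 * r + 9) * start r \<le> k" "k < start (Suc r)"
  shows "parent k = Some (k - (3 * r + 8) * start r)"
proof -
  have k: "start r \<le> k" using assms(1) by (rule start_le_block) simp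
  have "3 * r + 9 \<le> block k" unfolding block_le_iff[OF k assms(2)] using assms by auto
  then show ?thesis using blockE[OF k assms(2)] by (auto simp: parent_def)
qed

lemma parent_cases [consumes 2]:
  assumes "start r \<le> k" "k < start (Suc r)"
  obtains (early) "k < (r + 3) * start r" "parent k = None"
  | (return) i where "i < start r" "k = (r + 3) * start r + i" "parent k = Some i"
  | (middle) "(r + 4) * start r \<le> k" "k < (3 * r + 9) * start r" "parent k = None"
  | (late) i where "start r \<le> i" "i < (r + 4) * start r" "k = (3 * r + 8) * start r + i" "parent k = Some i"
proof -
  consider "k < (r + 3) * start r" | "(r + 3) * start r \<le> k" "k < (r + 4) * start r"
    | "(r + 4) * start r \<le> k" "k < (3 * r + 9) * start r" | "(3 * r + 9) * start r \<le> k"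
    by linarith
  then show ?thesis
  proof cases
    case 1
    then show ?thesis using parent_early[OF assms(1)] early by blast
  next
    case 2
    then show ?thesis using parent_return[OF 2] return[of "k - (r + 3) * start r"]
      by (simp add: algebra_simps)
  next
    case 3
    then show ?thesis using parent_middle[OF 3] middle by blast
  next
    case 4
    have "start r \<le> k - (3 * r + 8) * start r" "k - (3 * r + 8) * start r < (r + 4) * start r"
      "k = (3 * r + 8) * start r + (k - (3 * r + 8) * start r)"
      using 4 assms(2) unfolding start_Suc_eq by (auto simp: algebra_simps)
    then show ?thesis using parent_late[OF 4 assms(2)] late by blast
  qed
qed

lemma parent_less: assumes "parent k = Some i" shows "i < k"
proof (cases "k = 0")
  case True
  have "stage 0 = 0" unfolding stage_def by (rule Least_eq_0) simp
  then show ?thesis using assms True by (simp add: parent_def block_def)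
next
  case False
  then have "start (stage k) \<le> k" "k < start (Suc (stage k))"
    using stage_lower stage_upper by auto
  then show ?thesis using assms start_pos[of "stage k"]
    by (cases rule: parent_cases) (auto simp: algebra_simps)
qed

lemma level_drop:
  assumes k: "start r \<le> k" and k': "k' < start (Suc r)" and le: "k \<le> k'" "k' \<le> k + start r"
  shows "level k \<le> Suc (level k')"
proof -
  have kk: "k < start (Suc r)" "start r \<le> k'" using assms by auto
  note b = blockE[OF k kk(1)] blockE[OF kk(2) k']
  have "block k \<le> block k'" using le(1) by (simp add: block_def b div_le_mono)
  moreover have "block k' \<le> Suc (block k)"
    using div_le_mono[OF le(2), of "start r"] by (simp add: block_def b)
  ultimately consider "block k' = block k" | "block k' = Suc (block k)" by linarith
  then show ?thesis
  proof cases
    case 1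
    then show ?thesis using b by (simp add: level_def)
  next
    case 2
    then show ?thesis using b by (auto simp: level_def Let_def le_max_iff_disj)
  qed
qed

text \<open>
  Every level has room for infinitely many basis vectors.
\<close>

lemma level_infinite: "infinite {k. level k = v}"
  unfolding infinite_nat_iff_unbounded_le
proof
  fix m
  define r where "r = max m v"
  define k where "k = (r + 2 - v) * start r"
  have b: "stage k = r" "block k = r + 2 - v"
    using blockI[of "r + 2 - v" r k] by (auto simp: k_def r_def)
  have "m \<le> start r" using start_gt[of r] by (simp add: r_def)
  also have "start r \<le> k" by (simp add: k_def r_def)
  finally have "m \<le> k" .
  moreover have "0 < k" "v \<le> r" by (simp_all add: k_def r_def)
  then have "level k = v" by (simp add: level_def b)
  ultimately show "\<exists>k\<ge>m. k \<in> {k. level k = v}" by blast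
qed

section \<open>The choice of the sizes\<close>

text \<open>
  The sizes are chosen in half stages, since those after the first return depend, through the
  polynomials, on those before it. Stage \<open>r\<close> consists of the half stages \<open>2 r + 1\<close> and \<open>2 r + 2\<close>, and position
  \<open>0\<close> forms half stage \<open>0\<close>.
\<close>

definition half :: "nat \<Rightarrow> nat" where
  "half k = (if k = 0 then 0
     else 2 * stage k + (if k < (stage k + 3) * start (stage k) then 1 else 2))"

lemma half_less_start: assumes "k < start r" shows "half k \<le> 2 * r"
proof -
  have "stage k < r" if "0 < k"
  proof (rule ccontr)
    assume "\<not> stage k < r"
    then have "start r \<le> start (stage k)" by (intro start_mono) simp
    then show False using stage_lower[OF that] assms by simp
  qed
  then show ?thesis by (auto simp: half_def)
qed

lemma half_less_return: assumes "k < (r + 3) * start r" shows "half k \<le> 2 * r + 1"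
proof (cases "k < start r")
  case True
  then show ?thesis using half_less_start by fastforce
next
  case False
  then have "stage k = r"
    using assms start_pos[of r] by (intro stage_eqI) (auto simp: start_Suc_eq algebra_simps)
  then show ?thesis using assms False start_le_pos[of r k] by (simp add: half_def)
qed

lemma half_early: "start r \<le> k \<Longrightarrow> k < (r + 3) * start r \<Longrightarrow> half k = 2 * r + 1"
  using stage_eqI[of r k] start_pos[of r] start_le_pos[of r k] by (auto simp: half_def start_Suc_eq algebra_simps)

lemma half_late: "(r + 3) * start r \<le> k \<Longrightarrow> k < start (Suc r) \<Longrightarrow> half k = 2 * r + 2"
  using stage_eqI[of r k] start_le_block[of "r + 3" r k] start_le_pos[of r k] by (simp add: half_def)

lemma finite_half: "finite {k. half k = h}"
proof (rule finite_subset)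
  show "{k. half k = h} \<subseteq> {..<start (Suc h)}"
  proof
    fix k assume "k \<in> {k. half k = h}"
    then have "stage k \<le> h" by (auto simp: half_def stage_def split: if_splits)
    then have "start (Suc (stage k)) \<le> start (Suc h)" by (intro start_mono) simp
    then show "k \<in> {..<start (Suc h)}" using stage_upper[of k] by simp
  qed
qed simp

text \<open>
  Dependent choice along blocks: \<open>step\<close> redefines a function on one block only, and \<open>local\<close> says that
  \<open>\<Phi> h\<close> does not look beyond block \<open>h\<close>.
\<close>

lemma block_choice:
  fixes blk :: "nat \<Rightarrow> nat" and \<Phi> :: "nat \<Rightarrow> (nat \<Rightarrow> 'b) \<Rightarrow> bool"
  assumes step: "\<And>h f. \<exists>g. (\<forall>k. blk k \<noteq> h \<longrightarrow> g k = f k) \<and> \<Phi> h g"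
    and local: "\<And>h f g. (\<And>k. blk k \<le> h \<Longrightarrow> f k = g k) \<Longrightarrow> \<Phi> h f \<Longrightarrow> \<Phi> h g"
  shows "\<exists>f. \<forall>h. \<Phi> h f"
proof -
  have "\<exists>g. (\<forall>h<Suc n. \<Phi> h g) \<and> (\<forall>k. blk k < n \<longrightarrow> g k = f k)" if "\<forall>h<n. \<Phi> h f" for n f
  proof -
    obtain g where g: "\<And>k. blk k \<noteq> n \<Longrightarrow> g k = f k" "\<Phi> n g" using step by blast
    have "\<Phi> h g" if "h < n" for h
      using \<open>\<forall>h<n. \<Phi> h f\<close> that by (intro local[of h f g]) (auto simp: g(1))
    then show ?thesis using g by (intro exI[of _ g]) (auto simp: less_Suc_eq)
  qed
  from dependent_nat_choice[where P = "\<lambda>n f. \<forall>h<n. \<Phi> h f"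
      and Q = "\<lambda>n f g. \<forall>k. blk k < n \<longrightarrow> g k = f k", OF _ this]
  obtain F where F: "\<And>n h. h < n \<Longrightarrow> \<Phi> h (F n)" "\<And>n k. blk k < n \<Longrightarrow> F (Suc n) k = F n k"
    by auto
  define f where "f k = F (Suc (blk k)) k" for k
  have stable: "F n k = f k" if "blk k < n" for n k
    using that
  proof (induction n)
    case (Suc n)
    then show ?case by (cases "blk k = n") (auto simp: f_def F(2))
  qed simp
  have "\<Phi> h f" for h
    by (rule local[of h "F (Suc h)"]) (auto simp: F(1) stable)
  then show ?thesis by blast
qed

text \<open>
  A geometric progression, decreasing by a large factor \<open>G\<close> at each step and scaled by a large factor \<open>H\<close>.
\<close>

lemma decaying_sizes:
  fixes a :: "nat \<Rightarrow> nat \<Rightarrow> real" and b :: "nat \<Rightarrow> real"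
  assumes K: "finite K" and a: "\<And>k k'. 0 \<le> a k k'"
  shows "\<exists>x. \<forall>k\<in>K. 0 < x k \<and> b k \<le> x k \<and> (\<forall>k'\<in>K. k < k' \<longrightarrow> a k k' * x k' \<le> x k)"
proof -
  define G where "G = 1 + (\<Sum>k\<in>K. \<Sum>k'\<in>K. a k k')"
  define H where "H = 1 + (\<Sum>k\<in>K. \<bar>b k\<bar>)"
  define N where "N = Max K"
  have G: "1 \<le> G" "a k k' \<le> G" if "k \<in> K" "k' \<in> K" for k k'
  proof -
    show "1 \<le> G" using a by (simp add: G_def sum_nonneg)
    have "a k k' \<le> (\<Sum>k'\<in>K. a k k')" using that K a by (intro member_le_sum) auto
    also have "\<dots> \<le> (\<Sum>k\<in>K. \<Sum>k'\<in>K. a k k')"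
      using that K a by (intro member_le_sum[of k K "\<lambda>k. \<Sum>k'\<in>K. a k k'"]) (auto intro: sum_nonneg)
    finally show "a k k' \<le> G" by (simp add: G_def)
  qed
  have H: "1 \<le> H" by (simp add: H_def sum_nonneg)
  have bH: "b k \<le> H" if "k \<in> K" for k
    using member_le_sum[of k K "\<lambda>k. \<bar>b k\<bar>"] that K by (simp add: H_def)
  define x where "x k = H * G ^ (N - k)" for k
  have "0 < x k \<and> b k \<le> x k \<and> (\<forall>k'\<in>K. k < k' \<longrightarrow> a k k' * x k' \<le> x k)" if k: "k \<in> K" for k
  proof (intro conjI ballI impI)
    have pow: "1 \<le> G ^ (N - k)" using G(1)[OF k k] by (rule one_le_power)
    show "0 < x k" using H pow unfolding x_def by (intro mult_pos_pos) linarith+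
    have "H * 1 \<le> x k" unfolding x_def using H pow by (intro mult_left_mono) linarith+
    then show "b k \<le> x k" using bH[OF k] by simp
    fix k' assume k': "k' \<in> K" "k < k'"
    then have "k' \<le> N" using K by (simp add: N_def)
    then have "Suc (N - k') \<le> N - k" using k' by simp
    then have "G ^ Suc (N - k') \<le> G ^ (N - k)" using G(1)[OF k k] by (rule power_increasing)
    moreover have "a k k' * G ^ (N - k') \<le> G * G ^ (N - k')"
      using G[OF k k'(1)] by (intro mult_right_mono) auto
    ultimately have "H * (a k k' * G ^ (N - k')) \<le> H * G ^ (N - k)"
      using H by (intro mult_left_mono) auto
    then show "a k k' * x k' \<le> x k" by (simp add: x_def mult_ac)
  qed
  then show ?thesis by blast
qed

text \<open>
  A basis that is enumerated according to the plan. Its expansions are described independently of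
  the order of summation: the partial sums over suitable finite sets converge.
\<close>

locale leveled_basis = graded_frechet smul p
  for smul :: "'k::{real_normed_field,banach} \<Rightarrow> 'a::{ab_group_add,t2_space} \<Rightarrow> 'a"  (infixr "\<odot>" 75)
    and p +
  fixes e :: "nat \<Rightarrow> 'a" and \<phi> :: "nat \<Rightarrow> 'a \<Rightarrow> 'k"
  assumes linfun_\<phi>: "linfun (\<phi> k)"
    and \<phi>_e: "\<phi> k (e l) = (if k = l then 1 else 0)"
    and \<phi>_bound: "norm (\<phi> k x) * p s (e k) \<le> 2 * p s x"
    and approx: "0 < \<epsilon> \<Longrightarrow> finite F \<Longrightarrow> \<exists>G. finite G \<and> F \<subseteq> G \<and> p s (x - (\<Sum>k\<in>G. \<phi> k x \<odot> e k)) < \<epsilon>"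
    and level: "p s (e k) = 0 \<longleftrightarrow> s < level k"
begin

lemma visible: "level k \<le> s \<Longrightarrow> 0 < p s (e k)"
  using level[of s k] p_nonneg[of s "e k"] by linarith

text \<open>
  The intended orbit: \<open>orb lam k\<close> is \<open>T\<^sup>k\<close> applied to \<open>orb lam 0\<close>.
\<close>

function orb :: "(nat \<Rightarrow> real) \<Rightarrow> nat \<Rightarrow> 'a" where
  "orb lam k = of_real (lam k) \<odot> e k + (case parent k of None \<Rightarrow> 0 | Some i \<Rightarrow> orb lam i)"
  by auto
termination
  by (relation "Wellfounded.measure snd") (auto dest: parent_less)

declare orb.simps [simp del]

lemma orb_cong: "(\<And>j. j \<le> k \<Longrightarrow> f j = g j) \<Longrightarrow> orb f k = orb g k"
proof (induction k rule: less_induct)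
  case (less k)
  have "orb f i = orb g i" if "parent k = Some i" for i
    using parent_less[OF that] less.prems by (intro less.IH) auto
  then show ?case using less.prems[of k]
    by (subst (1 2) orb.simps) (auto split: option.splits)
qed

text \<open>
  A bound, in the seminorm for which stage \<open>r\<close> is made, of the orbit up to the first return, and in fact
  through the first block of the next stage (\<open>u_bound\<close>).
\<close>

definition visible_bound :: "(nat \<Rightarrow> real) \<Rightarrow> nat \<Rightarrow> real" where
  "visible_bound lam r = (\<Sum>i<(r + 3) * start r. p (target r - 1) (orb lam i))"

text \<open>
  The constants of the approximate inverse used in stage \<open>r\<close>. The tolerance makes the
  total error at most \<open>1 / (r + 1)\<close>; \<open>n = (3 r + 7) start r\<close> is the truncation point, and \<open>weight\<close> bounds
  the sum of the absolute values of the coefficients of \<open>P\<close>, which has \<open>n + start r\<close> of them.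
\<close>

definition tolerance :: "(nat \<Rightarrow> real) \<Rightarrow> nat \<Rightarrow> real" where
  "tolerance lam r = 1 / (real (r + 1) * real ((3 * r + 8) * start r) * (visible_bound lam r + 1))"

definition coef_bound :: "nat \<Rightarrow> nat \<Rightarrow> real \<Rightarrow> real" where
  "coef_bound n l \<delta> = (SOME \<Lambda>. 0 \<le> \<Lambda> \<and> (\<forall>c :: nat \<Rightarrow> 'k.
           (\<forall>i. norm (c i) \<le> 1) \<and> (\<exists>i\<le>n. norm (c i) = 1) \<longrightarrow>
           approx_invertible n l \<delta> \<Lambda> c))"

lemma coef_bound:
  assumes "0 < \<delta>"
  shows "0 \<le> coef_bound n l \<delta>"
    and "(\<And>i. norm (c i :: 'k) \<le> 1) \<Longrightarrow> i \<le> n \<Longrightarrow> norm (c i) = 1 \<Longrightarrow>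
      approx_invertible n l \<delta> (coef_bound n l \<delta>) c"
proof -
  have "\<exists>\<Lambda>. 0 \<le> \<Lambda> \<and> (\<forall>c :: nat \<Rightarrow> 'k.
           (\<forall>i. norm (c i) \<le> 1) \<and> (\<exists>i\<le>n. norm (c i) = 1) \<longrightarrow>
           approx_invertible n l \<delta> \<Lambda> c)"
    by (rule approx_inverse[OF assms])
  note * = someI_ex[OF this, folded coef_bound_def]
  show "0 \<le> coef_bound n l \<delta>" using * by blast
  show "approx_invertible n l \<delta> (coef_bound n l \<delta>) c"
    if "\<And>i. norm (c i) \<le> 1" "i \<le> n" "norm (c i) = 1"
    using * that by blast
qed

definition weight :: "(nat \<Rightarrow> real) \<Rightarrow> nat \<Rightarrow> real" where
  "weight lam r = real ((3 * r + 8) * start r) * coef_bound ((3 * r + 7) * start r) (start r) (tolerance lam r)"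

text \<open>
  A common bound for the weights of all earlier stages, whose polynomials must remain harmless in stage
  \<open>r\<close>; the summand \<open>1\<close> takes care of \<open>T\<close> itself.
\<close>

definition mass :: "(nat \<Rightarrow> real) \<Rightarrow> nat \<Rightarrow> real" where
  "mass lam r = 1 + (\<Sum>i<r. weight lam i)"

lemma visible_bound_nonneg: "0 \<le> visible_bound lam r"
  by (simp add: visible_bound_def sum_nonneg)

lemma tolerance_pos: "0 < tolerance lam r"
  using visible_bound_nonneg[of lam r] by (auto simp: tolerance_def intro!: mult_pos_pos)

lemma weight_nonneg: "0 \<le> weight lam r"
  unfolding weight_def using coef_bound(1)[OF tolerance_pos] by simp

lemma mass_ge_1: "1 \<le> mass lam r"
  by (simp add: mass_def sum_nonneg weight_nonneg)

lemma weight_le_mass: "i < r \<Longrightarrow> weight lam i \<le> mass lam r"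
  using member_le_sum[of i "{..<r}" "weight lam"] by (simp add: mass_def weight_nonneg)

lemma visible_bound_cong:
  assumes "\<And>k. k < (r + 3) * start r \<Longrightarrow> f k = g k" shows "visible_bound f r = visible_bound g r"
  unfolding visible_bound_def
proof (rule sum.cong[OF refl])
  fix i assume "i \<in> {..<(r + 3) * start r}"
  then have "orb f i = orb g i" by (intro orb_cong assms) simp
  then show "p (target r - 1) (orb f i) = p (target r - 1) (orb g i)" by simp
qed

lemma weight_cong:
  assumes "\<And>k. k < (r + 3) * start r \<Longrightarrow> f k = g k" shows "weight f r = weight g r"
  using visible_bound_cong[of r f g, OF assms] by (simp add: weight_def tolerance_def)

lemma mass_cong:
  assumes "\<And>k. k < start r \<Longrightarrow> f k = g k" shows "mass f r = mass g r"
  unfolding mass_def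
proof (rule arg_cong[of _ _ "(+) 1"], rule sum.cong[OF refl], rule weight_cong)
  fix i k assume "i \<in> {..<r}" "k < (i + 3) * start i"
  then have "k < start (Suc i)" "start (Suc i) \<le> start r"
    using start_mono[of "Suc i" r] by (auto simp: start_Suc_eq algebra_simps)
  then show "f k = g k" by (intro assms) simp
qed

text \<open>
  The two requirements on \<open>lam k\<close> in half stage \<open>h\<close>: it is at least \<open>ratio h lam k k'\<close> times
  any later \<open>lam k'\<close> of the same half stage, and at least \<open>floor_size h lam k\<close>, which depends on earlier half stages
  only. Where a divisor vanishes, because \<open>e k\<close> is invisible, the quotient is \<open>0\<close> and nothing is required.
\<close>

definition ratio :: "nat \<Rightarrow> (nat \<Rightarrow> real) \<Rightarrow> nat \<Rightarrow> nat \<Rightarrow> real" where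
  "ratio h lam k k' = (let r = (h - 1) div 2 in
     \<Sum>s\<le>r. mass lam r * 2 ^ Suc k * p s (e k') / p (Suc s) (e k))"

definition floor_size :: "nat \<Rightarrow> (nat \<Rightarrow> real) \<Rightarrow> nat \<Rightarrow> real" where
  "floor_size h lam k = (let r = (h - 1) div 2 in
     if h = 0 then 0
     else if odd h then mass lam r * 2 ^ Suc k * (\<Sum>l<start r. p r (orb lam l)) / p 0 (e k)
     else 2 ^ Suc k * weight lam r * visible_bound lam r / p (target r) (e k))"

lemma ratio_nonneg: "0 \<le> ratio h lam k k'"
  using mass_ge_1[of lam "(h - 1) div 2"] unfolding ratio_def Let_def
  by (intro sum_nonneg divide_nonneg_nonneg mult_nonneg_nonneg) auto

lemma requirements_local:
  assumes agree: "\<And>k. half k < h \<Longrightarrow> f k = g k"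
  shows "0 < h \<Longrightarrow> ratio h f k k' = ratio h g k k'" "floor_size h f k = floor_size h g k"
proof -
  define r where "r = (h - 1) div 2"
  have start: "f k = g k" if "0 < h" "k < start r" for k
    using half_less_start[OF that(2)] that(1) by (intro agree) (auto simp: r_def)
  then have mass: "mass f r = mass g r" if "0 < h" using that by (intro mass_cong)
  show "ratio h f k k' = ratio h g k k'" if "0 < h"
    using mass[OF that] unfolding ratio_def Let_def r_def by simp
  have odd: "(\<Sum>l<start r. p r (orb f l)) = (\<Sum>l<start r. p r (orb g l))" if "0 < h"
  proof (rule sum.cong[OF refl])
    fix l assume "l \<in> {..<start r}"
    then have "orb f l = orb g l" by (intro orb_cong start that) simp
    then show "p r (orb f l) = p r (orb g l)" by simp
  qed
  have even: "weight f r = weight g r" "visible_bound f r = visible_bound g r" if "0 < h" "even h"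
  proof -
    have "f k = g k" if "k < (r + 3) * start r" for k
      using half_less_return[OF that] \<open>0 < h\<close> \<open>even h\<close>
      by (intro agree) (auto simp: r_def elim!: evenE)
    then show "weight f r = weight g r" "visible_bound f r = visible_bound g r"
      by (auto intro: weight_cong visible_bound_cong)
  qed
  show "floor_size h f k = floor_size h g k"
    using odd even mass unfolding floor_size_def Let_def r_def[symmetric] by auto
qed

lemma sizes_exist:
  "\<exists>lam. \<forall>k. 0 < lam k \<and> floor_size (half k) lam k \<le> lam k \<and>
      (\<forall>k'. half k' = half k \<and> k < k' \<longrightarrow> ratio (half k) lam k k' * lam k' \<le> lam k)"
proof -
  define \<Phi> where "\<Phi> h lam \<longleftrightarrow> (\<forall>k. half k = h \<longrightarrow> 0 < lam k \<and> floor_size h lam k \<le> lam k \<and>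
      (\<forall>k'. half k' = h \<and> k < k' \<longrightarrow> ratio h lam k k' * lam k' \<le> lam k))" for h lam
  have zero: "k = 0" if "half k = 0" for k using that by (auto simp: half_def split: if_splits)
  have "\<exists>lam. \<forall>h. \<Phi> h lam"
  proof (rule block_choice[of half])
    fix h f
    from decaying_sizes[OF finite_half[of h] ratio_nonneg[of h f], of "floor_size h f"]
    obtain x where x0: "\<forall>k\<in>{k. half k = h}. 0 < x k \<and> floor_size h f k \<le> x k \<and>
      (\<forall>k'\<in>{k. half k = h}. k < k' \<longrightarrow> ratio h f k k' * x k' \<le> x k)"
      by (rule exE)
    have x: "0 < x k" "floor_size h f k \<le> x k" if "half k = h" for k
      using x0 that by auto
    have xx: "ratio h f k k' * x k' \<le> x k" if "half k = h" "half k' = h" "k < k'" for k k'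
      using x0 that by auto
    define g where "g k = (if half k = h then x k else f k)" for k
    have eq: "0 < h \<Longrightarrow> ratio h g k k' = ratio h f k k'" "floor_size h g k = floor_size h f k" for k k'
      by (auto intro!: requirements_local simp: g_def)
    have "\<Phi> h g"
      unfolding \<Phi>_def eq(2)
    proof (intro allI impI conjI)
      fix k k' assume "half k = h" "half k' = h \<and> k < k'"
      moreover from this have "0 < h" using zero[of k] zero[of k'] by (cases h) auto
      ultimately show "ratio h g k k' * g k' \<le> g k" using xx[of k k'] eq(1) by (simp add: g_def)
    qed (use x in \<open>auto simp: g_def\<close>)
    then show "\<exists>g. (\<forall>k. half k \<noteq> h \<longrightarrow> g k = f k) \<and> \<Phi> h g"
      by (intro exI[of _ g]) (simp add: g_def)
  next
    fix h f g assume agree: "\<And>k. half k \<le> h \<Longrightarrow> f k = g k" and f: "\<Phi> h f"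
    then have eq: "0 < h \<Longrightarrow> ratio h g k k' = ratio h f k k'" "floor_size h g k = floor_size h f k" for k k'
      by (auto intro!: requirements_local)
    show "\<Phi> h g"
      unfolding \<Phi>_def eq(2)
    proof (intro allI impI conjI)
      fix k k' assume k: "half k = h" "half k' = h \<and> k < k'"
      then have "0 < h" using zero[of k] zero[of k'] by (cases h) auto
      moreover have "ratio h f k k' * f k' \<le> f k" using f k unfolding \<Phi>_def by blast
      ultimately show "ratio h g k k' * g k' \<le> g k"
        using k agree[of k] agree[of k'] eq(1) by simp
    qed (use f agree in \<open>auto simp: \<Phi>_def\<close>)
  qed
  then show ?thesis unfolding \<Phi>_def by blast
qed

text \<open>
  The first property makes \<open>T\<close> and the polynomials of earlier stages small on descending vectors,
  the second one does so in front of the first return, where \<open>u l\<close> with \<open>l < start r\<close> comes into view,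
  and the third one does so for the polynomials of the same stage behind the truncation point.
\<close>

theorem sizes:
  obtains lam where "\<And>k. 0 < lam k"
    and "\<And>r k k' s. start r \<le> k \<Longrightarrow> k < k' \<Longrightarrow> k' \<le> k + start r \<Longrightarrow> k' < start (Suc r) \<Longrightarrow> s \<le> r \<Longrightarrow>
           mass lam r * 2 ^ Suc k * (lam k' * p s (e k')) \<le> lam k * p (Suc s) (e k)"
    and "\<And>r k. (r + 2) * start r \<le> k \<Longrightarrow> k < (r + 3) * start r \<Longrightarrow>
           mass lam r * 2 ^ Suc k * (\<Sum>l<start r. p r (orb lam l)) \<le> lam k * p 0 (e k)"
    and "\<And>r k. (3 * r + 7) * start r \<le> k \<Longrightarrow> k < start (Suc r) \<Longrightarrow>
           2 ^ Suc k * weight lam r * visible_bound lam r \<le> lam k * p (target r) (e k)"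
proof -
  obtain lam where lam: "\<And>k. 0 < lam k" "\<And>k. floor_size (half k) lam k \<le> lam k"
    "\<And>k k'. half k' = half k \<Longrightarrow> k < k' \<Longrightarrow> ratio (half k) lam k k' * lam k' \<le> lam k"
    using sizes_exist by blast
  show thesis
  proof (rule that[of lam])
    fix r k k' s
    assume k: "start r \<le> k" "k < k'" "k' \<le> k + start r" "k' < start (Suc r)" and s: "s \<le> r"
    show "mass lam r * 2 ^ Suc k * (lam k' * p s (e k')) \<le> lam k * p (Suc s) (e k)"
    proof (cases "Suc s < level k \<or> (k < (r + 3) * start r \<and> (r + 3) * start r \<le> k')")
      case True
      \<comment> \<open>Either \<open>e k\<close> is invisible and its level drops by at most one, or \<open>k'\<close> is in the first return.\<close>
      have "s < level k'"
      proof (cases "Suc s < level k")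
        case True
        then show ?thesis using level_drop[of r k k'] k by simp
      next
        case False
        with True have "(r + 3) * start r \<le> k'" "k < (r + 3) * start r" by auto
        moreover from this k have "k' < (r + 5) * start r"
          using start_pos[of r] by (simp add: algebra_simps)
        ultimately show ?thesis using level_return s by simp
      qed
      then have "p s (e k') = 0" using level by blast
      then show ?thesis using lam(1)[of k] by (simp add: less_imp_le)
    next
      case False
      then have pos: "0 < p (Suc s) (e k)" by (intro visible) simp
      have half: "half k' = half k" "(half k - 1) div 2 = r"
        using False k half_early[of r k] half_early[of r k'] half_late[of r k] half_late[of r k'] by auto
      let ?f = "\<lambda>s. mass lam r * 2 ^ Suc k * p s (e k') / p (Suc s) (e k)"
      have "?f s \<le> ratio (half k) lam k k'"
        unfolding ratio_def Let_def half(2) using s mass_ge_1[of lam r]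
        by (intro member_le_sum[of s "{..r}" ?f]) (auto intro!: divide_nonneg_nonneg mult_nonneg_nonneg)
      then have "?f s * lam k' \<le> ratio (half k) lam k k' * lam k'"
        using lam(1)[of k'] by (intro mult_right_mono) auto
      also have "\<dots> \<le> lam k" by (rule lam(3)[OF half(1) k(2)])
      finally show ?thesis using pos by (simp add: field_simps)
    qed
  next
    fix r k assume k: "(r + 2) * start r \<le> k" "k < (r + 3) * start r"
    have b: "stage k = r" "block k = r + 2" using blockI[of "r + 2" r k] k by (auto simp: algebra_simps)
    have k1: "start r \<le> k" by (rule start_le_block[OF k(1)]) simp
    then have "level k = 0" using b by (simp add: level_def)
    then have pos: "0 < p 0 (e k)" by (intro visible) simp
    have h: "half k = 2 * r + 1" by (rule half_early[OF k1 k(2)])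
    from lam(2)[of k] show "mass lam r * 2 ^ Suc k * (\<Sum>l<start r. p r (orb lam l)) \<le> lam k * p 0 (e k)"
      using pos by (simp add: h floor_size_def Let_def pos_divide_le_eq)
  next
    fix r k assume k: "(3 * r + 7) * start r \<le> k" "k < start (Suc r)"
    have "level k = target r" by (rule level_final[OF k])
    then have pos: "0 < p (target r) (e k)" by (intro visible) simp
    have h: "half k = 2 * r + 2" using k by (intro half_late) (auto simp: algebra_simps)
    from lam(2)[of k] show "2 ^ Suc k * weight lam r * visible_bound lam r \<le> lam k * p (target r) (e k)"
      using pos by (simp add: h floor_size_def Let_def pos_divide_le_eq)
  qed (rule lam(1))
qed

end

section \<open>The operator\<close>

lemma half_power_sum:
  assumes "finite K" "\<And>k. k \<in> K \<Longrightarrow> n < k"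
  shows "(\<Sum>k\<in>K. (1/2::real) ^ k) \<le> (1/2) ^ n"
proof -
  define m where "m = Suc (Max (insert n K))"
  have K: "K \<subseteq> {Suc n..<Suc n + m}"
  proof
    fix k assume k: "k \<in> K"
    then have "k \<le> Max (insert n K)" using assms(1) by simp
    then show "k \<in> {Suc n..<Suc n + m}" using assms(2)[OF k] by (simp add: m_def)
  qed
  have "(\<Sum>k\<in>{Suc n..<Suc n + m}. (1/2::real) ^ k) = (1/2) ^ n - (1/2) ^ (n + m)" for m
    by (induction m) auto
  then have "(\<Sum>k\<in>{Suc n..<Suc n + m}. (1/2::real) ^ k) \<le> (1/2) ^ n" by simp
  moreover have "(\<Sum>k\<in>K. (1/2::real) ^ k) \<le> (\<Sum>k\<in>{Suc n..<Suc n + m}. (1/2::real) ^ k)"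
    by (rule sum_mono2[OF _ K]) auto
  ultimately show ?thesis by linarith
qed

lemma convolution_sum:
  fixes F :: "nat \<Rightarrow> nat \<Rightarrow> 'b::comm_monoid_add"
  assumes "\<And>i j. A \<le> j \<Longrightarrow> F j i = 0" "\<And>i j. B \<le> i \<Longrightarrow> F j i = 0"
  shows "(\<Sum>j<A. \<Sum>i<B. F j i) = (\<Sum>k<A + B. \<Sum>j\<le>k. F j (k - j))"
proof -
  have "(\<Sum>j<A. \<Sum>i<B. F j i) = (\<Sum>(j, i)\<in>{..<A} \<times> {..<B}. F j i)"
    by (simp add: sum.cartesian_product)
  also have "\<dots> = (\<Sum>(j, i)\<in>{(j, i). j + i < A + B}. F j i)"
  proof (rule sum.mono_neutral_left)
    show "finite {(j, i). j + i < A + B}"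
      by (rule finite_subset[of _ "{..<A + B} \<times> {..<A + B}"]) auto
    have "F j i = 0" if "\<not> (j < A \<and> i < B)" for j i
      using that assms(1)[of j i] assms(2)[of i j] by (auto simp: not_less)
    then show "\<forall>x\<in>{(j, i). j + i < A + B} - {..<A} \<times> {..<B}. (case x of (j, i) \<Rightarrow> F j i) = 0"
      by auto
  qed auto
  also have "\<dots> = (\<Sum>k<A + B. \<Sum>j\<le>k. F j (k - j))"
    by (rule sum.triangle_reindex)
  finally show ?thesis .
qed

context graded_frechet begin

lemma bounded_op_add:
  assumes "bounded_op S" "bounded_op T" shows "bounded_op (\<lambda>x. S x + T x)"
  unfolding bounded_op_def
proof
  fix j
  obtain k C where k: "0 \<le> C" "\<And>x. p j (S x) \<le> C * p k x"
    using assms(1) unfolding bounded_op_def by blast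
  obtain l D where l: "0 \<le> D" "\<And>x. p j (T x) \<le> D * p l x"
    using assms(2) unfolding bounded_op_def by blast
  have "p j (S x + T x) \<le> (C + D) * p (max k l) x" for x
  proof -
    have "p j (S x + T x) \<le> C * p k x + D * p l x"
      using p_triangle[of j "S x" "T x"] k(2)[of x] l(2)[of x] by linarith
    also have "\<dots> \<le> C * p (max k l) x + D * p (max k l) x"
      by (intro add_mono mult_left_mono p_mono k l) auto
    finally show ?thesis by (simp add: algebra_simps)
  qed
  then show "\<exists>k C. 0 \<le> C \<and> (\<forall>x. p j (S x + T x) \<le> C * p k x)"
    using k(1) l(1) by (intro exI[of _ "max k l"] exI[of _ "C + D"]) auto
qed

lemma bounded_op_scale:
  assumes "bounded_op S" shows "bounded_op (\<lambda>x. c \<odot> S x)"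
  unfolding bounded_op_def
proof
  fix j
  obtain k C where k: "0 \<le> C" "\<And>x. p j (S x) \<le> C * p k x"
    using assms(1) unfolding bounded_op_def by blast
  have "p j (c \<odot> S x) \<le> (norm c * C) * p k x" for x
    using mult_left_mono[OF k(2)[of x], of "norm c"] by (simp add: mult.assoc)
  then show "\<exists>k C. 0 \<le> C \<and> (\<forall>x. p j (c \<odot> S x) \<le> C * p k x)"
    using k(1) by (intro exI[of _ k] exI[of _ "norm c * C"]) auto
qed

lemma bounded_op_sum:
  assumes "\<And>i. i \<in> A \<Longrightarrow> bounded_op (S i)" shows "bounded_op (\<lambda>x. \<Sum>i\<in>A. S i x)"
  using assms
proof (induction A rule: infinite_finite_induct)
  case (insert i A)
  then show ?case by (simp add: bounded_op_add)
qed (auto simp: bounded_op_def intro!: exI[of _ 0])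

lemma limit_unique:
  assumes "\<And>j. (\<lambda>n. p j (u n - x)) \<longlonglongrightarrow> 0" "\<And>j. (\<lambda>n. p j (u n - y)) \<longlonglongrightarrow> 0"
  shows "x = y"
  using LIMSEQ_unique[of u x y] assms by (simp add: LIMSEQ_iff_p)

end

context leveled_basis begin

text \<open>
  The factors \<open>(1/2)\<^sup>k\<close> make the series for \<open>T x\<close> absolutely convergent in every seminorm, although
  the expansion of \<open>x\<close> itself may converge conditionally.
\<close>

lemma diagonal_operator:
  assumes t: "\<And>s. \<exists>s' C. 0 \<le> C \<and> (\<forall>k. p s (t k) \<le> C * (1/2) ^ k * p s' (e k))"
  shows "\<exists>T. Vector_Spaces.linear smul smul T \<and> bounded_op T \<and> (\<forall>k. T (e k) = t k)"
proof -
  define U where "U N x = (\<Sum>k<N. \<phi> k x \<odot> t k)" for N x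
  have bound: "\<exists>s' D. 0 \<le> D \<and> (\<forall>m x K. finite K \<and> (\<forall>k\<in>K. m \<le> k) \<longrightarrow>
      p s (\<Sum>k\<in>K. \<phi> k x \<odot> t k) \<le> D * p s' x * (1/2) ^ m)" for s
  proof -
    obtain s' C where C: "0 \<le> C" "\<And>k. p s (t k) \<le> C * (1/2) ^ k * p s' (e k)"
      using t[of s] by blast
    have "p s (\<Sum>k\<in>K. \<phi> k x \<odot> t k) \<le> 4 * C * p s' x * (1/2) ^ m"
      if K: "finite K" "\<And>k. k \<in> K \<Longrightarrow> m \<le> k" for m x K
    proof -
      have single: "p s (\<phi> k x \<odot> t k) \<le> 4 * C * p s' x * (1/2) ^ Suc k" for k
      proof -
        have "p s (\<phi> k x \<odot> t k) \<le> norm (\<phi> k x) * (C * (1/2) ^ k * p s' (e k))"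
          by (simp add: mult_left_mono C(2))
        also have "\<dots> = C * (1/2) ^ k * (norm (\<phi> k x) * p s' (e k))" by (simp add: mult_ac)
        also have "\<dots> \<le> C * (1/2) ^ k * (2 * p s' x)"
          using C(1) by (intro mult_left_mono \<phi>_bound) auto
        finally show ?thesis by (simp add: algebra_simps)
      qed
      have "p s (\<Sum>k\<in>K. \<phi> k x \<odot> t k) \<le> (\<Sum>k\<in>K. p s (\<phi> k x \<odot> t k))" by (rule p_sum)
      also have "\<dots> \<le> (\<Sum>k\<in>K. 4 * C * p s' x * (1/2) ^ Suc k)" by (rule sum_mono[OF single])
      also have "\<dots> = 4 * C * p s' x * (\<Sum>k\<in>Suc ` K. (1/2) ^ k)"
        by (simp add: sum.reindex sum_distrib_left)
      also have "\<dots> \<le> 4 * C * p s' x * (1/2) ^ m"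
        using C(1) K by (intro mult_left_mono half_power_sum) (auto simp: less_Suc_eq_le)
      finally show ?thesis .
    qed
    then have "\<forall>m x K. finite K \<and> (\<forall>k\<in>K. m \<le> k) \<longrightarrow>
      p s (\<Sum>k\<in>K. \<phi> k x \<odot> t k) \<le> 4 * C * p s' x * (1/2) ^ m" by blast
    moreover have "0 \<le> 4 * C" using C(1) by simp
    ultimately show ?thesis by (intro exI[of _ s'] exI[of _ "4 * C"] conjI)
  qed
  have ex_lim: "\<exists>y. \<forall>s. (\<lambda>N. p s (U N x - y)) \<longlonglongrightarrow> 0" for x
  proof (rule complete)
    fix s and \<epsilon> :: real assume \<epsilon>: "0 < \<epsilon>"
    from bound[of s] obtain s' D where D1: "0 \<le> D" and D0: "\<forall>m x K. finite K \<and> (\<forall>k\<in>K. m \<le> k) \<longrightarrow>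
      p s (\<Sum>k\<in>K. \<phi> k x \<odot> t k) \<le> D * p s' x * (1/2) ^ m"
      by (elim exE conjE)
    have D2: "p s (\<Sum>k\<in>K. \<phi> k x \<odot> t k) \<le> D * p s' x * (1/2) ^ m"
      if "finite K" "\<forall>k\<in>K. m \<le> k" for m x K using D0 that by simp
    have "(\<lambda>m. D * p s' x * (1/2) ^ m) \<longlonglongrightarrow> D * p s' x * 0"
      by (intro tendsto_intros LIMSEQ_power_zero) simp
    then have "\<forall>\<^sub>F m in sequentially. D * p s' x * (1/2) ^ m < \<epsilon>"
      using \<epsilon> by (intro order_tendstoD(2)) auto
    then obtain N where N: "\<And>m. N \<le> m \<Longrightarrow> D * p s' x * (1/2) ^ m < \<epsilon>"
      unfolding eventually_sequentially by blast
    have le: "p s (U n x - U m x) < \<epsilon>" if "N \<le> m" "m \<le> n" for m n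
    proof -
      have "U n x - U m x = (\<Sum>k\<in>{m..<n}. \<phi> k x \<odot> t k)"
        using sum_diff_nat_ivl[of 0 m n "\<lambda>k. \<phi> k x \<odot> t k"] that(2)
        by (simp add: U_def atLeast0LessThan)
      then show ?thesis using D2[of "{m..<n}" m x] N[OF that(1)] by simp
    qed
    show "\<exists>N. \<forall>m\<ge>N. \<forall>n\<ge>N. p s (U m x - U n x) < \<epsilon>"
    proof (intro exI allI impI)
      fix m n assume "N \<le> m" "N \<le> n"
      then show "p s (U m x - U n x) < \<epsilon>"
        using le[of m n] le[of n m] p_minus_commute[of s "U m x" "U n x"]
        by (cases "m \<le> n") auto
    qed
  qed
  then obtain T where T: "\<And>x s. (\<lambda>N. p s (U N x - T x)) \<longlonglongrightarrow> 0" by metis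
  have U: "U N (x + y) = U N x + U N y" "U N (c \<odot> x) = c \<odot> U N x" for N x y c
    by (simp_all add: U_def linfun_add[OF linfun_\<phi>] linfun_scale[OF linfun_\<phi>]
        scale_left_distrib sum.distrib scale_sum_right)
  have "T (x + y) = T x + T y" for x y
  proof (rule limit_unique)
    show "(\<lambda>N. p s (U N (x + y) - T (x + y))) \<longlonglongrightarrow> 0" for s by (rule T)
    show "(\<lambda>N. p s (U N (x + y) - (T x + T y))) \<longlonglongrightarrow> 0" for s
    proof (rule p_tendsto_0_le)
      show "(\<lambda>N. p s (U N x - T x) + p s (U N y - T y)) \<longlonglongrightarrow> 0"
        using tendsto_add[OF T T] by simp
      show "p s (U N (x + y) - (T x + T y)) \<le> p s (U N x - T x) + p s (U N y - T y)" for N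
        using p_triangle[of s "U N x - T x" "U N y - T y"] by (simp add: U algebra_simps)
    qed
  qed
  moreover have "T (c \<odot> x) = c \<odot> T x" for c x
  proof (rule limit_unique)
    show "(\<lambda>N. p s (U N (c \<odot> x) - T (c \<odot> x))) \<longlonglongrightarrow> 0" for s by (rule T)
    have "(\<lambda>N. norm c * p s (U N x - T x)) \<longlonglongrightarrow> 0" for s
      using tendsto_mult[OF tendsto_const T, of "norm c"] by simp
    then show "(\<lambda>N. p s (U N (c \<odot> x) - c \<odot> T x)) \<longlonglongrightarrow> 0" for s
      by (simp add: U flip: scale_right_diff_distrib)
  qed
  ultimately have "Vector_Spaces.linear smul smul T"
    using vector_space_axioms by (simp add: Vector_Spaces.linear_iff)
  moreover have "bounded_op T"
    unfolding bounded_op_def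
  proof
    fix s
    from bound[of s] obtain s' D where D1: "0 \<le> D" and D0: "\<forall>m x K. finite K \<and> (\<forall>k\<in>K. m \<le> k) \<longrightarrow>
      p s (\<Sum>k\<in>K. \<phi> k x \<odot> t k) \<le> D * p s' x * (1/2) ^ m"
      by (elim exE conjE)
    have D2: "p s (\<Sum>k\<in>K. \<phi> k x \<odot> t k) \<le> D * p s' x * (1/2) ^ m"
      if "finite K" "\<forall>k\<in>K. m \<le> k" for m x K using D0 that by simp
    have "p s (T x) \<le> D * p s' x" for x
    proof (rule LIMSEQ_le_const)
      show "(\<lambda>N. D * p s' x + p s (U N x - T x)) \<longlonglongrightarrow> D * p s' x"
        using tendsto_add[OF tendsto_const T, of "D * p s' x" s x] by simp
      have "p s (T x) \<le> D * p s' x + p s (U N x - T x)" for N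
        using D2[of "{..<N}" 0 x] p_diff[of s "U N x" "U N x - T x"] by (simp add: U_def)
      then show "\<exists>N. \<forall>n\<ge>N. p s (T x) \<le> D * p s' x + p s (U n x - T x)" by blast
    qed
    then show "\<exists>k C. 0 \<le> C \<and> (\<forall>x. p s (T x) \<le> C * p k x)" using D1 by blast
  qed
  moreover have "T (e l) = t l" for l
  proof (rule limit_unique)
    show "(\<lambda>N. p s (U N (e l) - T (e l))) \<longlonglongrightarrow> 0" for s by (rule T)
    have "U N (e l) = t l" if "l < N" for N
    proof -
      have "U N (e l) = (\<Sum>k<N. if k = l then t k else 0)"
        unfolding U_def \<phi>_e by (intro sum.cong) auto
      then show ?thesis using that by simp
    qed
    then have "\<forall>\<^sub>F N in sequentially. p s (U N (e l) - t l) = 0" for s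
      by (intro eventually_mono[OF eventually_gt_at_top[of l]]) simp
    then show "(\<lambda>N. p s (U N (e l) - t l)) \<longlonglongrightarrow> 0" for s by (rule tendsto_eventually)
  qed
  ultimately show ?thesis by blast
qed

end

locale leveled_orbit = leveled_basis smul p e \<phi>
  for smul :: "'k::{real_normed_field,banach} \<Rightarrow> 'a::{ab_group_add,t2_space} \<Rightarrow> 'a"  (infixr "\<odot>" 75)
    and p and e and \<phi> +
  fixes lam :: "nat \<Rightarrow> real"
  assumes lam_pos: "0 < lam k"
    and decay: "start r \<le> k \<Longrightarrow> k < k' \<Longrightarrow> k' \<le> k + start r \<Longrightarrow> k' < start (Suc r) \<Longrightarrow> s \<le> r \<Longrightarrow>
           mass lam r * 2 ^ Suc k * (lam k' * p s (e k')) \<le> lam k * p (Suc s) (e k)"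
    and before_return: "(r + 2) * start r \<le> k \<Longrightarrow> k < (r + 3) * start r \<Longrightarrow>
           mass lam r * 2 ^ Suc k * (\<Sum>l<start r. p r (orb lam l)) \<le> lam k * p 0 (e k)"
    and final: "(3 * r + 7) * start r \<le> k \<Longrightarrow> k < start (Suc r) \<Longrightarrow>
           2 ^ Suc k * weight lam r * visible_bound lam r \<le> lam k * p (target r) (e k)"
begin

abbreviation u :: "nat \<Rightarrow> 'a" where "u \<equiv> orb lam"

lemma u_None: "parent k = None \<Longrightarrow> u k = of_real (lam k) \<odot> e k"
  and u_Some: "parent k = Some i \<Longrightarrow> u k = of_real (lam k) \<odot> e k + u i"
  by (subst orb.simps; simp)+

lemma p_lam_e: "p s (of_real (lam k) \<odot> e k) = lam k * p s (e k)"
  using lam_pos[of k] by simp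

lemma p_lam_e_null: "s < level k \<Longrightarrow> p s (of_real (lam k) \<odot> e k) = 0"
  using level[of s k] by simp

text \<open>\<open>shifted k j\<close> is what \<open>T\<^sup>j\<close> will make of \<open>lam k \<odot> e k\<close>.\<close>

definition shifted :: "nat \<Rightarrow> nat \<Rightarrow> 'a" where
  "shifted k j = u (k + j) - (case parent k of None \<Rightarrow> 0 | Some i \<Rightarrow> u (i + j))"

lemma shifted_0: "shifted k 0 = of_real (lam k) \<odot> e k"
  by (cases "parent k") (simp_all add: shifted_def u_None u_Some)

lemma u_first_null: "start r \<le> k \<Longrightarrow> k < 2 * start r \<Longrightarrow> s \<le> r \<Longrightarrow> p s (u k) = 0"
  using level_first[of r k] by (simp add: u_None p_lam_e_null del: p_smul)

lemma u_after_return_null: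
  assumes "(r + 4) * start r \<le> k" "k < (r + 5) * start r" "s \<le> r"
  shows "p s (u k) = 0"
proof -
  have "k < (3 * r + 9) * start r" using assms(2) by (rule less_le_trans) simp
  then have "parent k = None" using assms(1) by (intro parent_middle)
  moreover have "(r + 3) * start r \<le> k" using assms(1) by (rule order_trans[rotated]) simp
  then have "level k = r + 1" using assms by (intro level_return)
  ultimately show ?thesis using assms(3) by (simp add: u_None p_lam_e_null del: p_smul)
qed

text \<open>
  The estimate behind both the continuity of \<open>T\<close> and the harmlessness of the polynomials of earlier stages.
  Away from the ends of the returns, \<open>shifted k j\<close> is a multiple of \<open>e (k + j)\<close>, and \<open>decay\<close> applies. In front
  of the first return there is an additional \<open>u i\<close> with \<open>i < start r\<close>, for which \<open>before_return\<close> is made.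
  Across the beginning of the second return and the ends of both, all additional vectors have level greater than
  \<open>s\<close>.
\<close>

lemma shifted_bound:
  assumes k: "start r \<le> k" "k < start (Suc r)" and j: "1 \<le> j" "j \<le> start r" and s: "s \<le> r"
  shows "mass lam r * 2 ^ k * p s (shifted k j) \<le> lam k * p (Suc s) (e k)"
proof -
  define c where "c = mass lam r * 2 ^ k"
  define R where "R = lam k * p (Suc s) (e k)"
  have c: "0 \<le> c" using mass_ge_1[of lam r] by (simp add: c_def)
  have R: "0 \<le> R" using lam_pos[of k] by (simp add: R_def)
  have X: "2 * c * (lam (k + j) * p s (e (k + j))) \<le> R" if "k + j < start (Suc r)"
    using decay[OF k(1), of "k + j" s] that j s by (simp add: c_def R_def mult_ac)
  have X': "c * p s (shifted k j) \<le> R"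
    if "k + j < start (Suc r)" "p s (shifted k j) \<le> lam (k + j) * p s (e (k + j))"
  proof -
    have "c * p s (shifted k j) \<le> c * (lam (k + j) * p s (e (k + j)))"
      using that(2) c by (rule mult_left_mono)
    also have "\<dots> \<le> 2 * c * (lam (k + j) * p s (e (k + j)))"
      using c lam_pos[of "k + j"] by simp
    finally show ?thesis using X[OF that(1)] by linarith
  qed
  have null: "c * p s (shifted k j) \<le> R" if "p s (shifted k j) = 0" using that R by simp
  from k have "c * p s (shifted k j) \<le> R"
  proof (cases rule: parent_cases)
    case early
    have lt: "k + j < (r + 4) * start r" using early(1) j(2) by (simp add: algebra_simps)
    have in_stage: "k + j < start (Suc r)"
      using lt start_pos[of r] unfolding start_Suc_eq by (simp add: algebra_simps)
    show ?thesis
    proof (cases "k + j < (r + 3) * start r")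
      case True
      then have "parent (k + j) = None" using k(1) by (intro parent_early[of r]) auto
      then show ?thesis using early by (intro X'[OF in_stage]) (simp add: shifted_def u_None p_lam_e del: p_smul)
    next
      case False
      define i where "i = k + j - (r + 3) * start r"
      have i: "i < start r" using lt False by (simp add: i_def algebra_simps)
      have "parent (k + j) = Some i" using False lt unfolding i_def by (intro parent_return) auto
      then have "p s (shifted k j) \<le> lam (k + j) * p s (e (k + j)) + p s (u i)"
        using p_triangle[of s "of_real (lam (k + j)) \<odot> e (k + j)" "u i"] early
        by (simp add: shifted_def u_Some p_lam_e del: p_smul)
      moreover have "p s (u i) \<le> (\<Sum>l<start r. p r (u l))"
        using p_mono[OF s, of "u i"] member_le_sum[of i "{..<start r}" "\<lambda>l. p r (u l)"] i by simp
      moreover have "2 * c * (\<Sum>l<start r. p r (u l)) \<le> R"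
      proof -
        have "(r + 2) * start r \<le> k" using False j(2) by (simp add: algebra_simps)
        then have "2 * c * (\<Sum>l<start r. p r (u l)) \<le> lam k * p 0 (e k)"
          using before_return[of r k] early(1) by (simp add: c_def mult_ac)
        also have "\<dots> \<le> R" unfolding R_def using lam_pos[of k] by (intro mult_left_mono p_mono) auto
        finally show ?thesis .
      qed
      ultimately have "2 * c * p s (shifted k j) \<le> 2 * c * (lam (k + j) * p s (e (k + j)) + (\<Sum>l<start r. p r (u l)))"
        using c by (intro mult_left_mono) auto
      also have "\<dots> \<le> R + R"
        using X[OF in_stage] \<open>2 * c * (\<Sum>l<start r. p r (u l)) \<le> R\<close> by (simp add: distrib_left)
      finally show ?thesis by simp
    qed
  next
    case (return i)
    show ?thesis
    proof (cases "i + j < start r")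
      case True
      have "parent (k + j) = Some (k + j - (r + 3) * start r)"
        using return True by (intro parent_return) (auto simp: algebra_simps)
      then have "parent (k + j) = Some (i + j)" using return by simp
      moreover have "k + j < start (Suc r)"
        using return True unfolding start_Suc_eq by (simp add: algebra_simps)
      ultimately show ?thesis
        using return by (intro X') (simp_all add: shifted_def u_Some p_lam_e del: p_smul)
    next
      case False
      have "p s (u (i + j)) = 0" using False return j s by (intro u_first_null[of r]) auto
      moreover have "p s (u (k + j)) = 0"
        using False return j s by (intro u_after_return_null[of r]) (auto simp: algebra_simps)
      ultimately show ?thesis using return by (intro null) (simp add: shifted_def p_diff_null)
    qed
  next
    case middle
    have lt: "k + j < (3 * r + 10) * start r" using middle j(2) by (simp add: algebra_simps)
    have in_stage: "k + j < start (Suc r)"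
      using lt start_pos[of r] unfolding start_Suc_eq by (simp add: algebra_simps)
    have ge: "(r + 4) * start r \<le> k + j" using middle by simp
    show ?thesis
    proof (cases "k + j < (3 * r + 9) * start r")
      case True
      then have "parent (k + j) = None" using ge by (intro parent_middle[of r]) auto
      then show ?thesis using middle by (intro X'[OF in_stage]) (simp add: shifted_def u_None p_lam_e del: p_smul)
    next
      case False
      define i where "i = k + j - (3 * r + 8) * start r"
      have "parent (k + j) = Some i" using False in_stage unfolding i_def by (intro parent_late) auto
      moreover have "p s (u i) = 0"
        using False lt s by (intro u_first_null[of r]) (auto simp: i_def algebra_simps)
      ultimately show ?thesis
        using middle by (intro X'[OF in_stage]) (simp add: shifted_def u_Some p_add_null p_lam_e del: p_smul)
    qed
  next
    case (late i)
    show ?thesis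
    proof (cases "k + j < start (Suc r)")
      case True
      have "parent (k + j) = Some (k + j - (3 * r + 8) * start r)"
        using late True by (intro parent_late) (auto simp: algebra_simps)
      then have "parent (k + j) = Some (i + j)" using late by simp
      then show ?thesis
        using late True by (intro X') (simp_all add: shifted_def u_Some p_lam_e del: p_smul)
    next
      case False
      have "p s (u (k + j)) = 0"
        using False k j s start_Suc_gt[of r] by (intro u_first_null[of "Suc r"]) auto
      moreover have "p s (u (i + j)) = 0"
        using False late j s unfolding start_Suc_eq
        by (intro u_after_return_null[of r]) (auto simp: algebra_simps)
      ultimately show ?thesis using late by (intro null) (simp add: shifted_def p_diff_null)
    qed
  qed
  then show ?thesis by (simp add: c_def R_def)
qed

text \<open>
  For fixed \<open>s\<close>, the bound \<open>shifted_bound\<close> covers all positions from stage \<open>s\<close> on. The finitely many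
  others are absorbed by the constant, in a seminorm \<open>s'\<close> that sees all of them.
\<close>

lemma shift_operator:
  "\<exists>T. Vector_Spaces.linear smul smul T \<and> bounded_op T \<and>
       (\<forall>k. T (e k) = of_real (1 / lam k) \<odot> shifted k 1)"
proof (rule diagonal_operator)
  fix s
  define t where "t k = of_real (1 / lam k) \<odot> shifted k 1" for k
  define s' where "s' = Suc s + (\<Sum>k<start s. level k)"
  define C where "C = 1 + (\<Sum>k<start s. 2 ^ k * p s (t k) / p s' (e k))"
  have C: "1 \<le> C" by (auto simp: C_def intro!: sum_nonneg divide_nonneg_nonneg)
  have "p s (t k) \<le> C * (1/2) ^ k * p s' (e k)" for k
  proof (cases "k < start s")
    case True
    then have "level k \<le> (\<Sum>k<start s. level k)" by (intro member_le_sum) auto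
    then have pos: "0 < p s' (e k)" by (intro visible) (simp add: s'_def)
    have "2 ^ k * p s (t k) / p s' (e k) \<le> (\<Sum>k<start s. 2 ^ k * p s (t k) / p s' (e k))"
      using True by (intro member_le_sum) (auto intro!: divide_nonneg_nonneg)
    then have "2 ^ k * p s (t k) / p s' (e k) \<le> C" by (simp add: C_def)
    then show ?thesis using pos by (simp add: field_simps power_one_over)
  next
    case False
    define r where "r = stage k"
    have sr: "s \<le> r" using False stage_ge[of s k] by (simp add: r_def)
    have k: "start r \<le> k" "k < start (Suc r)"
      unfolding r_def using False start_le_pos[of s k] by (auto intro!: stage_lower stage_upper)
    have "1 * (2 ^ k * p s (shifted k 1)) \<le> mass lam r * (2 ^ k * p s (shifted k 1))"
      using mass_ge_1[of lam r] by (intro mult_right_mono) auto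
    also have "\<dots> \<le> lam k * p (Suc s) (e k)"
      using shifted_bound[OF k _ _ sr, of 1] start_pos[of r] by (simp add: mult_ac Suc_leI)
    finally have "p s (t k) \<le> 1 * (1/2) ^ k * p (Suc s) (e k)"
      using lam_pos[of k] by (simp add: t_def norm_divide field_simps power_one_over)
    also have "\<dots> \<le> C * (1/2) ^ k * p s' (e k)"
      using C by (intro mult_mono p_mono) (auto simp: s'_def)
    finally show ?thesis .
  qed
  then show "\<exists>s' C. 0 \<le> C \<and> (\<forall>k. p s (of_real (1 / lam k) \<odot> shifted k 1) \<le> C * (1/2) ^ k * p s' (e k))"
    using C unfolding t_def by (intro exI[of _ s'] exI[of _ C]) auto
qed

end

section \<open>Every nonzero vector is cyclic\<close>

context leveled_orbit begin

lemma visible_bound_ge: "i < (r + 3) * start r \<Longrightarrow> p (target r - 1) (u i) \<le> visible_bound lam r"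
  unfolding visible_bound_def
  by (intro member_le_sum[of i _ "\<lambda>i. p (target r - 1) (u i)"]) auto

text \<open>
  From the first return through the first block of the next stage, whatever the seminorm of the stage sees of the
  orbit is a repetition of what it saw before.
\<close>

lemma u_bound:
  assumes i: "i < 2 * start (Suc r)"
  shows "p (target r - 1) (u i) \<le> visible_bound lam r"
proof -
  define s where "s = target r - 1"
  have s: "s < target r" "s \<le> r" using target_pos[of r] target_le[of r] by (auto simp: s_def)
  have early: "p s (u i) \<le> visible_bound lam r" if "i < (r + 4) * start r" for i
  proof (cases "i < (r + 3) * start r")
    case False
    then have "parent i = Some (i - (r + 3) * start r)" using that by (intro parent_return) auto
    moreover have "level i = r + 1"
      using False that by (intro level_return) (auto simp: algebra_simps)
    ultimately have "p s (u i) = p s (u (i - (r + 3) * start r))"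
      using s by (simp add: u_Some p_lam_e_null add.commute[of _ "u _"] p_add_null del: p_smul)
    also have "\<dots> \<le> visible_bound lam r"
      unfolding s_def using False that by (intro visible_bound_ge) (auto simp: algebra_simps)
    finally show ?thesis .
  qed (use visible_bound_ge[of i r] in \<open>simp add: s_def\<close>)
  have lev: "s < level i" if "(r + 4) * start r \<le> i" "i < start (Suc r)" for i
    using level_ge_target[of r i] that s by (simp add: algebra_simps)
  consider "i < (r + 4) * start r" | "(r + 4) * start r \<le> i" "i < (3 * r + 9) * start r"
    | "(3 * r + 9) * start r \<le> i" "i < start (Suc r)" | "start (Suc r) \<le> i"
    by linarith
  then have "p s (u i) \<le> visible_bound lam r"
  proof cases
    case 1
    then show ?thesis by (rule early)
  next
    case 2
    then have "i < start (Suc r)" using start_pos[of r] unfolding start_Suc_eq by (simp add: algebra_simps)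
    then show ?thesis
      using lev[of i] 2 parent_middle[OF 2] visible_bound_nonneg by (simp add: u_None p_lam_e_null del: p_smul)
  next
    case 3
    then have "(r + 4) * start r \<le> i" by (simp add: algebra_simps)
    then have "p s (u i) = p s (u (i - (3 * r + 8) * start r))"
      using lev[of i] 3 parent_late[OF 3]
      by (simp add: u_Some p_lam_e_null add.commute[of _ "u _"] p_add_null del: p_smul)
    also have "\<dots> \<le> visible_bound lam r"
      using 3 start_pos[of r] unfolding start_Suc_eq by (intro early) (auto simp: algebra_simps)
    finally show ?thesis .
  next
    case 4
    then have "p s (u i) = 0" using i s by (intro u_first_null[of "Suc r"]) auto
    then show ?thesis using visible_bound_nonneg by simp
  qed
  then show ?thesis by (simp add: s_def)
qed

text \<open>
  At position \<open>(4 r + 11) start r\<close> the second return repeats the first return of \<open>u\<^sub>0\<close>; the two vectors that have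
  been added have levels \<open>target r\<close> and \<open>r + 1\<close>.
\<close>

lemma u_return:
  "p (target r - 1) (u ((4 * r + 11) * start r) - u 0) = 0"
proof -
  let ?m = "(4 * r + 11) * start r" and ?m' = "(r + 3) * start r"
  have m: "(3 * r + 9) * start r \<le> ?m" "?m < start (Suc r)" "(r + 3) * start r \<le> ?m"
    using start_pos[of r] unfolding start_Suc_eq by (auto simp: algebra_simps)
  have pm: "parent ?m = Some ?m'"
    using parent_late[OF m(1,2)] by (simp add: algebra_simps)
  have pm': "parent ?m' = Some 0" using parent_return[of r ?m'] start_pos[of r] by simp
  have eq: "u ?m - u 0 = of_real (lam ?m) \<odot> e ?m + of_real (lam ?m') \<odot> e ?m'"
    unfolding u_Some[OF pm] u_Some[OF pm'] by simp
  have "target r - 1 < level ?m" using level_ge_target[OF m(3,2)] target_pos[of r] by simp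
  moreover have "level ?m' = r + 1" using start_pos[of r] by (intro level_return) auto
  then have "target r - 1 < level ?m'" using target_le[of r] target_pos[of r] by simp
  ultimately show ?thesis unfolding eq by (simp add: p_add_null p_lam_e_null del: p_smul)
qed

lemma \<phi>_u_later: "i < k \<Longrightarrow> \<phi> k (u i) = 0"
proof (induction i rule: less_induct)
  case (less i)
  show ?case
  proof (cases "parent i")
    case None
    then show ?thesis using less.prems by (simp add: u_None linfun_scale[OF linfun_\<phi>] \<phi>_e)
  next
    case (Some j)
    then show ?thesis using less.prems less.IH[of j] parent_less[OF Some]
      by (simp add: u_Some linfun_scale[OF linfun_\<phi>] linfun_add[OF linfun_\<phi>] \<phi>_e)
  qed
qed

lemma norm_\<phi>_u: "norm (\<phi> k (u i)) \<le> lam k"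
proof (induction i rule: less_induct)
  case (less i)
  have lin: "\<phi> k (of_real (lam i) \<odot> e i) = (if k = i then of_real (lam i) else 0)"
    by (simp add: linfun_scale[OF linfun_\<phi>] \<phi>_e)
  show ?case
  proof (cases "parent i")
    case None
    then show ?thesis using lin lam_pos[of k] by (auto simp: u_None)
  next
    case (Some j)
    have j: "j < i" by (rule parent_less[OF Some])
    have "\<phi> k (u j) = 0" if "k = i" using \<phi>_u_later j that by simp
    then show ?thesis using less.IH[OF j] lin lam_pos[of k]
      by (auto simp: u_Some[OF Some] linfun_add[OF linfun_\<phi>])
  qed
qed

lemma e_as_u_combination:
  "\<exists>c. (\<forall>i\<ge>N. c i = 0) \<and> (\<Sum>k<N. x k \<odot> e k) = (\<Sum>i<N. c i \<odot> u i)"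
proof (induction N)
  case (Suc N)
  then obtain c where c: "\<And>i. N \<le> i \<Longrightarrow> c i = 0" "(\<Sum>k<N. x k \<odot> e k) = (\<Sum>i<N. c i \<odot> u i)"
    by blast
  define y where "y = x N / of_real (lam N)"
  have y: "x N \<odot> e N = y \<odot> (of_real (lam N) \<odot> e N)"
    using lam_pos[of N] by (simp add: y_def)
  show ?case
  proof (cases "parent N")
    case None
    define c' where "c' = c(N := y)"
    have "(\<Sum>i<N. c' i \<odot> u i) = (\<Sum>i<N. c i \<odot> u i)"
      by (intro sum.cong) (auto simp: c'_def)
    then have "(\<Sum>k<Suc N. x k \<odot> e k) = (\<Sum>i<Suc N. c' i \<odot> u i)"
      by (simp add: c(2) y u_None[OF None] c'_def)
    then show ?thesis using c(1) by (intro exI[of _ c']) (auto simp: c'_def)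
  next
    case (Some j)
    have j: "j < N" by (rule parent_less[OF Some])
    define c' where "c' = (\<lambda>i. (if i = N then y else c i) - (if i = j then y else 0))"
    have "(\<Sum>i<N. c' i \<odot> u i) = (\<Sum>i<N. c i \<odot> u i - (if i = j then y \<odot> u i else 0))"
      by (intro sum.cong) (auto simp: c'_def scale_left_diff_distrib)
    also have "\<dots> = (\<Sum>i<N. c i \<odot> u i) - y \<odot> u j" using j by (simp add: sum_subtractf)
    finally have "(\<Sum>k<Suc N. x k \<odot> e k) = (\<Sum>i<Suc N. c' i \<odot> u i)"
      using j by (simp add: c(2) y u_Some[OF Some] c'_def scale_right_distrib)
    then show ?thesis using c(1) j by (intro exI[of _ c']) (auto simp: c'_def)
  qed
qed auto

end

locale leveled_shift = leveled_orbit smul p e \<phi> lam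
  for smul :: "'k::{real_normed_field,banach} \<Rightarrow> 'a::{ab_group_add,t2_space} \<Rightarrow> 'a"  (infixr "\<odot>" 75)
    and p and e and \<phi> and lam +
  fixes T :: "'a \<Rightarrow> 'a"
  assumes lin_T: "Vector_Spaces.linear smul smul T"
    and bounded_T: "bounded_op T"
    and T_e: "T (e k) = of_real (1 / lam k) \<odot> shifted k 1"
begin

sublocale T: Vector_Spaces.linear smul smul T by (rule lin_T)

lemma T_u: "T (u k) = u (Suc k)"
proof (induction k rule: less_induct)
  case (less k)
  have *: "T (of_real (lam k) \<odot> e k) = shifted k 1"
    using lam_pos[of k] by (simp add: T.scale T_e)
  show ?case
  proof (cases "parent k")
    case None
    then show ?thesis by (simp add: u_None * shifted_def)
  next
    case (Some i)
    then show ?thesis using less.IH[OF parent_less[OF Some]]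
      by (simp add: u_Some T.add * shifted_def)
  qed
qed

lemma funpow_u: "(T ^^ j) (u k) = u (k + j)"
  by (induction j) (simp_all add: T_u)

lemma funpow_add: "(T ^^ j) (x + y) = (T ^^ j) x + (T ^^ j) y"
  by (induction j) (simp_all add: T.add)

lemma funpow_scale: "(T ^^ j) (c \<odot> x) = c \<odot> (T ^^ j) x"
  by (induction j) (simp_all add: T.scale)

lemma funpow_e: "(T ^^ j) (e k) = of_real (1 / lam k) \<odot> shifted k j"
proof -
  have "T (shifted k j) = shifted k (Suc j)" for j
    by (cases "parent k") (simp_all add: shifted_def T.diff T_u)
  then have "(T ^^ j) (shifted k 0) = shifted k j" by (induction j) simp_all
  then have "of_real (lam k) \<odot> (T ^^ j) (e k) = shifted k j"
    by (simp add: shifted_0 funpow_scale)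
  then show ?thesis using lam_pos[of k] by (metis divide_self_if less_irrefl mult.commute
        nonzero_divide_eq_eq of_real_1 of_real_mult scale_one scale_scale)
qed

text \<open>
  The operator \<open>T\<^sup>a P(T)\<close> with \<open>a = (r + 4) start r\<close>. It moves the truncation point \<open>(3 r + 7) start r\<close> to the
  return \<open>(4 r + 11) start r\<close>, and all its exponents are less than \<open>start (r + 1)\<close>.
\<close>

definition poly_op :: "nat \<Rightarrow> (nat \<Rightarrow> 'k) \<Rightarrow> 'a \<Rightarrow> 'a" where
  "poly_op r P x = (\<Sum>j<(3 * r + 8) * start r. P j \<odot> (T ^^ ((r + 4) * start r + j)) x)"

lemma poly_op_add: "poly_op r P (x + y) = poly_op r P x + poly_op r P y"
  by (simp add: poly_op_def funpow_add scale_right_distrib sum.distrib)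

lemma poly_op_scale: "poly_op r P (c \<odot> x) = c \<odot> poly_op r P x"
  by (simp add: poly_op_def funpow_scale scale_sum_right mult.commute)

lemma poly_op_diff: "poly_op r P (x - y) = poly_op r P x - poly_op r P y"
  using poly_op_add[of r P "x - y" y] by simp

lemma poly_op_0 [simp]: "poly_op r P 0 = 0"
  using poly_op_scale[of r P 0 0] by simp

lemma poly_op_sum: "poly_op r P (sum f A) = (\<Sum>x\<in>A. poly_op r P (f x))"
  by (induction A rule: infinite_finite_induct) (auto simp: poly_op_add)

lemma bounded_poly_op: "bounded_op (poly_op r P)"
  unfolding poly_op_def[abs_def]
  by (rule bounded_op_sum, rule bounded_op_scale, rule bounded_op_funpow, rule bounded_T)

lemma poly_op_e:
  assumes P: "\<And>j. norm (P j) \<le> coef_bound ((3 * r + 7) * start r) (start r) (tolerance lam r)"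
    and b: "\<And>j. j < (3 * r + 8) * start r \<Longrightarrow> p s (shifted k ((r + 4) * start r + j)) \<le> b"
  shows "p s (poly_op r P (e k)) \<le> weight lam r * (b / lam k)"
proof -
  let ?\<Lambda> = "coef_bound ((3 * r + 7) * start r) (start r) (tolerance lam r)"
  have "p s (poly_op r P (e k)) \<le> (\<Sum>j<(3 * r + 8) * start r. p s (P j \<odot> (T ^^ ((r + 4) * start r + j)) (e k)))"
    unfolding poly_op_def by (rule p_sum)
  also have "\<dots> \<le> (\<Sum>j<(3 * r + 8) * start r. ?\<Lambda> * (b / lam k))"
  proof (rule sum_mono)
    fix j assume "j \<in> {..<(3 * r + 8) * start r}"
    then have "p s (shifted k ((r + 4) * start r + j)) / lam k \<le> b / lam k"
      using b[of j] lam_pos[of k] by (intro divide_right_mono) auto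
    then have "norm (P j) * (p s (shifted k ((r + 4) * start r + j)) / lam k) \<le> ?\<Lambda> * (b / lam k)"
      using P[of j] lam_pos[of k] coef_bound(1)[OF tolerance_pos] by (intro mult_mono) auto
    then show "p s (P j \<odot> (T ^^ ((r + 4) * start r + j)) (e k)) \<le> ?\<Lambda> * (b / lam k)"
      using lam_pos[of k] by (simp add: funpow_e norm_divide)
  qed
  also have "\<dots> = weight lam r * (b / lam k)" by (simp add: weight_def)
  finally show ?thesis .
qed

text \<open>
  Within stage \<open>r\<close>, all vectors in sight are bounded by \<open>visible_bound\<close>, and \<open>lam k\<close> was chosen large
  compared with it. In later stages \<open>shifted_bound\<close> applies, as the exponents are at most \<open>start \<rho>\<close>
  and the weight is at most the mass.
\<close>

lemma poly_op_tail:
  assumes P: "\<And>j. norm (P j) \<le> coef_bound ((3 * r + 7) * start r) (start r) (tolerance lam r)"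
    and k: "(3 * r + 7) * start r < k"
  shows "p (target r - 1) (poly_op r P (e k)) \<le> (1/2) ^ k * p (target r) (e k)"
proof (cases "k < start (Suc r)")
  case True
  have shift: "(r + 4) * start r + j < start (Suc r)" if "j < (3 * r + 8) * start r" for j
    using that unfolding start_Suc_eq by (simp add: algebra_simps)
  have "p (target r - 1) (shifted k ((r + 4) * start r + j)) \<le> 2 * visible_bound lam r"
    if j: "j < (3 * r + 8) * start r" for j
  proof -
    let ?j = "(r + 4) * start r + j"
    have 1: "p (target r - 1) (u (k + ?j)) \<le> visible_bound lam r"
      using shift[OF j] True by (intro u_bound) simp
    show ?thesis
    proof (cases "parent k")
      case None
      then show ?thesis using 1 visible_bound_nonneg[of lam r] by (simp add: shifted_def)
    next
      case (Some i)
      have "p (target r - 1) (u (i + ?j)) \<le> visible_bound lam r"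
        using shift[OF j] True parent_less[OF Some] by (intro u_bound) simp
      then show ?thesis
        using 1 p_diff[of "target r - 1" "u (k + ?j)" "u (i + ?j)"] Some by (simp add: shifted_def)
    qed
  qed
  from poly_op_e[OF P this]
  have "p (target r - 1) (poly_op r P (e k)) \<le> weight lam r * (2 * visible_bound lam r / lam k)" .
  also have "\<dots> \<le> (1/2) ^ k * p (target r) (e k)"
    using final[of r k] k True lam_pos[of k] by (simp add: field_simps power_one_over)
  finally show ?thesis .
next
  case False
  define \<rho> where "\<rho> = stage k"
  have r\<rho>: "Suc r \<le> \<rho>" using False stage_ge[of "Suc r" k] by (simp add: \<rho>_def)
  have k\<rho>: "start \<rho> \<le> k" "k < start (Suc \<rho>)"
    unfolding \<rho>_def using k by (auto intro!: stage_lower stage_upper)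
  have s: "target r - 1 \<le> \<rho>" "Suc (target r - 1) = target r"
    using target_le[of r] target_pos[of r] r\<rho> by auto
  have m: "0 < mass lam \<rho>" using mass_ge_1[of lam \<rho>] by linarith
  have "p (target r - 1) (shifted k ((r + 4) * start r + j)) \<le> lam k * p (target r) (e k) / (mass lam \<rho> * 2 ^ k)"
    if j: "j < (3 * r + 8) * start r" for j
  proof -
    have "(r + 4) * start r + j \<le> start (Suc r)" using j unfolding start_Suc_eq by (simp add: algebra_simps)
    also have "\<dots> \<le> start \<rho>" by (rule start_mono[OF r\<rho>])
    finally have "mass lam \<rho> * 2 ^ k * p (target r - 1) (shifted k ((r + 4) * start r + j))
        \<le> lam k * p (Suc (target r - 1)) (e k)"
      using start_pos[of r] by (intro shifted_bound[OF k\<rho> _ _ s(1)]) (auto simp: Suc_leI)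
    then show ?thesis using m s(2) by (simp add: field_simps)
  qed
  from poly_op_e[OF P this]
  have "p (target r - 1) (poly_op r P (e k))
      \<le> weight lam r * (lam k * p (target r) (e k) / (mass lam \<rho> * 2 ^ k) / lam k)" .
  also have "\<dots> = (weight lam r / mass lam \<rho>) * ((1/2) ^ k * p (target r) (e k))"
    using lam_pos[of k] m by (simp add: field_simps power_one_over)
  also have "\<dots> \<le> 1 * ((1/2) ^ k * p (target r) (e k))"
    using m weight_le_mass[of r \<rho> lam] r\<rho> by (intro mult_right_mono) auto
  finally show ?thesis by simp
qed

text \<open>
  The coefficients \<open>d k\<close> of the product of \<open>P\<close> and \<open>c\<close> are within the tolerance of those of \<open>t\<^sup>n\<close> for
  \<open>k < n + start r\<close>. The terms of higher degree are arbitrary, but they fall into the beginning of the next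
  stage, which is invisible.
\<close>

lemma poly_op_head:
  assumes c: "\<And>i. (3 * r + 7) * start r < i \<Longrightarrow> c i = 0"
    and P0: "\<And>j. (3 * r + 8) * start r \<le> j \<Longrightarrow> P j = 0"
    and P: "\<And>i. i < (3 * r + 8) * start r \<Longrightarrow>
      norm ((\<Sum>j\<le>i. P j * c (i - j)) - (if i = (3 * r + 7) * start r then 1 else 0)) \<le> tolerance lam r"
  shows "p (target r - 1) (poly_op r P (\<Sum>i<Suc ((3 * r + 7) * start r). c i \<odot> u i) - u 0) \<le> 1 / real (Suc r)"
proof -
  define s where "s = target r - 1"
  define n where "n = (3 * r + 7) * start r"
  define A where "A = (3 * r + 8) * start r"
  define a where "a = (r + 4) * start r"
  define B where "B = visible_bound lam r"
  have A: "A = n + start r" "n < A" "a + A = start (Suc r)" "a + n = (4 * r + 11) * start r" "0 < A"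
    using start_pos[of r] unfolding start_Suc_eq by (auto simp: A_def n_def a_def algebra_simps)
  have aN: "a + (A + Suc n) \<le> 2 * start (Suc r)" using A(2,3) by linarith
  define d where "d i = (\<Sum>j\<le>i. P j * c (i - j))" for i
  have "poly_op r P (\<Sum>i<Suc n. c i \<odot> u i) = (\<Sum>i<Suc n. c i \<odot> (\<Sum>j<A. P j \<odot> u (i + (a + j))))"
    unfolding poly_op_sum poly_op_scale by (simp add: poly_op_def funpow_u A_def a_def)
  also have "\<dots> = (\<Sum>j<A. \<Sum>i<Suc n. (P j * c i) \<odot> u (a + (j + i)))"
    unfolding scale_sum_right by (subst sum.swap) (simp add: ac_simps)
  also have "\<dots> = (\<Sum>k<A + Suc n. \<Sum>j\<le>k. (P j * c (k - j)) \<odot> u (a + (j + (k - j))))"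
    using c P0 by (intro convolution_sum) (auto simp: A_def n_def)
  also have "\<dots> = (\<Sum>k<A + Suc n. d k \<odot> u (a + k))"
    by (simp add: d_def scale_sum_left)
  finally have Q: "poly_op r P (\<Sum>i<Suc n. c i \<odot> u i) = (\<Sum>k<A + Suc n. d k \<odot> u (a + k))" .
  define f where "f k = (d k - (if k = n then 1 else 0)) \<odot> u (a + k)" for k
  have "(\<Sum>k<A + Suc n. f k) = (\<Sum>k<A + Suc n. d k \<odot> u (a + k)) - (\<Sum>k<A + Suc n. if k = n then u (a + k) else 0)"
    unfolding f_def sum_subtractf[symmetric] by (intro sum.cong) (auto simp: scale_left_diff_distrib)
  then have diff: "(\<Sum>k<A + Suc n. d k \<odot> u (a + k)) - u (a + n) = (\<Sum>k<A + Suc n. f k)"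
    by (simp add: sum.delta)
  have small: "p s (f k) \<le> (if k < A then tolerance lam r * B else 0)" if "k < A + Suc n" for k
  proof (cases "k < A")
    case True
    have "p s (u (a + k)) \<le> B" unfolding s_def B_def using aN that by (intro u_bound) simp
    then show ?thesis
      using True P[of k] tolerance_pos[of lam r] unfolding f_def d_def n_def A_def
      by (auto simp: less_imp_le intro!: mult_mono)
  next
    case False
    have "s \<le> Suc r" using target_le[of r] by (simp add: s_def)
    then have "p s (u (a + k)) = 0" using False aN that A(3) by (intro u_first_null[of "Suc r"]) auto
    then show ?thesis using False by (simp add: f_def)
  qed
  have "p s (\<Sum>k<A + Suc n. f k) \<le> (\<Sum>k<A + Suc n. if k < A then tolerance lam r * B else 0)"
    by (rule order_trans[OF p_sum sum_mono]) (use small in auto)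
  also have "\<dots> = (\<Sum>k<A. tolerance lam r * B)"
    by (rule sum.mono_neutral_cong_right) auto
  also have "\<dots> = real A * B / (real (Suc r) * real A * (B + 1))"
    by (simp add: tolerance_def A_def B_def)
  also have "\<dots> = (B / (B + 1)) * (1 / real (Suc r))" using A(5) by simp
  also have "\<dots> \<le> 1 * (1 / real (Suc r))"
    using visible_bound_nonneg[of lam r] by (intro mult_right_mono) (auto simp: B_def)
  finally have "p s (\<Sum>k<A + Suc n. f k) \<le> 1 / real (Suc r)" by simp
  moreover have "p s (u (a + n) - u 0) = 0" unfolding A(4) s_def by (rule u_return)
  ultimately have "p s (poly_op r P (\<Sum>i<Suc n. c i \<odot> u i) - u 0) \<le> 1 / real (Suc r)"
    using p_diff_triangle[of s "poly_op r P (\<Sum>i<Suc n. c i \<odot> u i)" "u 0" "u (a + n)"]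
    unfolding Q diff by linarith
  then show ?thesis unfolding s_def n_def .
qed

text \<open>
  To approximate \<open>u\<^sub>0\<close> in the seminorm \<open>s\<close>, use a late stage with target \<open>s + 1\<close>. The truncation \<open>y\<close> of \<open>x\<close>
  is normalised by the largest coefficient \<open>\<mu>\<close> of its expansion in the \<open>u i\<close>. As the coordinates of
  all \<open>u i\<close> are bounded by \<open>norm_\<phi>_u\<close>, a nonzero coordinate of \<open>x\<close> keeps \<open>\<mu>\<close> from being smaller than a
  constant over \<open>n + 1\<close>, which the factor \<open>(1/2)\<^sup>n\<close> of the tail outweighs.
\<close>

theorem no_invariant_subspace:
  assumes M: "subspace M" "closed M" "T ` M \<subseteq> M" and x: "x \<in> M" "x \<noteq> 0"
  shows "M = UNIV"
proof -
  have TM: "(T ^^ j) y \<in> M" if "y \<in> M" for j y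
    using that M(3) by (induction j) auto
  have QM: "poly_op r P y \<in> M" if "y \<in> M" for r P y
    unfolding poly_op_def by (intro subspace_sum[OF M(1)] subspace_scale[OF M(1)] TM that)
  obtain k0 where k0: "\<phi> k0 x \<noteq> 0"
  proof (rule ccontr)
    assume no: "\<not> thesis"
    then have zero: "\<phi> k x = 0" for k using that by blast
    have "p s x \<le> 0 + \<epsilon>" if "0 < \<epsilon>" for s \<epsilon>
      using approx[OF that finite.emptyI, of s x] zero by (auto simp: less_imp_le)
    then have "p s x \<le> 0" for s by (rule field_le_epsilon)
    then have "x = 0" using p_separates p_nonneg order_antisym by blast
    with x(2) show False by simp
  qed
  define \<kappa> where "\<kappa> = norm (\<phi> k0 x) / lam k0"
  have \<kappa>: "0 < \<kappa>" using k0 lam_pos[of k0] by (simp add: \<kappa>_def)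
  have "\<exists>z\<in>M. p s (z - u 0) < \<epsilon>" if \<epsilon>: "0 < \<epsilon>" for s \<epsilon>
  proof -
    define X where "X = 2 * p (Suc s) x + 1"
    have X: "0 < X" by (simp add: X_def add_nonneg_pos)
    have "(\<lambda>n. real n * (1/2) ^ n) \<longlonglongrightarrow> 0"
      using powser_times_n_limit_0[of "1/2 :: real"] by simp
    then have "\<forall>\<^sub>F n in sequentially. real n * (1/2) ^ n < \<epsilon> * \<kappa> / (4 * X)"
      using \<epsilon> \<kappa> X by (intro order_tendstoD(2)) auto
    then obtain N where N: "\<And>n. N \<le> n \<Longrightarrow> real n * (1/2) ^ n < \<epsilon> * \<kappa> / (4 * X)"
      unfolding eventually_sequentially by blast
    obtain N' where N': "1 / real (Suc N') < \<epsilon> / 2" using nat_approx_posE[of "\<epsilon> / 2"] \<epsilon> by auto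
    obtain r where r: "max N (max N' k0) \<le> r" "target r = Suc s" using target_unbounded by blast
    define n where "n = (3 * r + 7) * start r"
    have nr: "r < n" using start_gt[of r] unfolding n_def
      by (metis le_add2 less_le_trans mult_le_mono1 nat_mult_1 numeral_One add.commute one_le_numeral order.trans trans_le_add2)
    obtain c where c0: "\<And>i. Suc n \<le> i \<Longrightarrow> c i = 0"
      and c: "(\<Sum>k<Suc n. \<phi> k x \<odot> e k) = (\<Sum>i<Suc n. c i \<odot> u i)"
      using e_as_u_combination[of "Suc n" "\<lambda>k. \<phi> k x"] by blast
    define y where "y = (\<Sum>k<Suc n. \<phi> k x \<odot> e k)"
    define \<mu> where "\<mu> = Max ((\<lambda>i. norm (c i)) ` {..n})"
    have c_le: "norm (c i) \<le> \<mu>" if "i \<le> n" for i unfolding \<mu>_def using that by (intro Max_ge) auto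
    have "\<mu> \<in> (\<lambda>i. norm (c i)) ` {..n}" unfolding \<mu>_def by (intro Max_in) auto
    then obtain i0 where i0: "i0 \<le> n" "norm (c i0) = \<mu>" by auto
    have sum_\<phi>: "\<phi> k (\<Sum>i\<in>A. g i) = (\<Sum>i\<in>A. \<phi> k (g i))" for k and A :: "nat set" and g
      by (induction A rule: infinite_finite_induct) (auto simp: linfun_add[OF linfun_\<phi>] linfun_0[OF linfun_\<phi>])
    have "\<phi> k0 y = (\<Sum>k<Suc n. if k0 = k then \<phi> k x else 0)"
      unfolding y_def sum_\<phi> by (intro sum.cong) (auto simp: linfun_scale[OF linfun_\<phi>] \<phi>_e)
    also have "\<dots> = \<phi> k0 x" using r(1) nr by simp
    finally have "norm (\<phi> k0 x) = norm (\<Sum>i<Suc n. c i * \<phi> k0 (u i))"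
      unfolding y_def c sum_\<phi> by (simp add: linfun_scale[OF linfun_\<phi>])
    also have "\<dots> \<le> (\<Sum>i<Suc n. \<mu> * lam k0)"
    proof (rule sum_norm_le)
      fix i assume "i \<in> {..<Suc n}"
      then show "norm (c i * \<phi> k0 (u i)) \<le> \<mu> * lam k0"
        using c_le[of i] norm_\<phi>_u[of k0 i] order_trans[OF norm_ge_zero c_le[of i]]
        by (auto simp: norm_mult intro!: mult_mono)
    qed
    finally have "\<kappa> \<le> real (Suc n) * \<mu>"
      using lam_pos[of k0] by (simp add: \<kappa>_def pos_divide_le_eq algebra_simps)
    then have \<mu>: "\<kappa> / real (Suc n) \<le> \<mu>" by (simp add: pos_divide_le_eq mult.commute)
    then have \<mu>0: "0 < \<mu>" using \<kappa> by (smt (verit) divide_pos_pos of_nat_0_less_iff zero_less_Suc)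
    define c' where "c' i = c i / of_real \<mu>" for i
    have c'1: "norm (c' i) \<le> 1" for i
    proof (cases "i \<le> n")
      case True
      then show ?thesis using c_le[OF True] \<mu>0 by (simp add: c'_def norm_divide)
    qed (simp add: c'_def c0)
    have c'2: "norm (c' i0) = 1" using i0 \<mu>0 by (simp add: c'_def norm_divide)
    obtain P where P: "\<And>j. norm (P j) \<le> coef_bound n (start r) (tolerance lam r)"
      "\<And>j. n + start r \<le> j \<Longrightarrow> P j = 0"
      "\<And>i. i < n + start r \<Longrightarrow> norm ((\<Sum>j\<le>i. P j * c' (i - j)) - (if i = n then 1 else 0)) \<le> tolerance lam r"
      using coef_bound(2)[OF tolerance_pos[of lam r], where c = c' and i = i0 and n = n and l = "start r",
          OF c'1 i0(1) c'2] unfolding approx_invertible_def by blast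
    have nA: "n + start r = (3 * r + 8) * start r" by (simp add: n_def algebra_simps)
    define z where "z = poly_op r P (of_real (1 / \<mu>) \<odot> x)"
    have "z \<in> M" unfolding z_def by (intro QM subspace_scale[OF M(1)] x(1))
    have s: "target r - 1 = s" using r(2) by simp
    have y': "of_real (1 / \<mu>) \<odot> y = (\<Sum>i<Suc n. c' i \<odot> u i)"
      unfolding y_def c by (simp add: scale_sum_right c'_def field_simps del: sum.lessThan_Suc)
    have "p s (poly_op r P (of_real (1 / \<mu>) \<odot> y) - u 0) \<le> 1 / real (Suc r)"
      unfolding y' s[symmetric] n_def
      by (rule poly_op_head) (use c0 P nA in \<open>auto simp: c'_def n_def\<close>)
    also have "\<dots> \<le> 1 / real (Suc N')" using r(1) by (intro divide_left_mono) auto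
    finally have head: "p s (poly_op r P (of_real (1 / \<mu>) \<odot> y) - u 0) < \<epsilon> / 2" using N' by linarith
    have tail: "p s (poly_op r P (x - y)) \<le> 2 * p (Suc s) x * (1/2) ^ n"
    proof (rule field_le_epsilon)
      fix \<eta> :: real assume \<eta>: "0 < \<eta>"
      obtain s' C where C: "0 \<le> C" "\<And>v. p s (poly_op r P v) \<le> C * p s' v"
        using bounded_poly_op[of r P] unfolding bounded_op_def by blast
      obtain G where G: "finite G" "{..<Suc n} \<subseteq> G" "p s' (x - (\<Sum>k\<in>G. \<phi> k x \<odot> e k)) < \<eta> / (C + 1)"
        using approx[of "\<eta> / (C + 1)" "{..<Suc n}" s' x] \<eta> C(1) by auto
      define w where "w = x - (\<Sum>k\<in>G. \<phi> k x \<odot> e k)"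
      have "C * p s' w \<le> (C + 1) * p s' w" by (intro mult_right_mono) auto
      also have "\<dots> \<le> \<eta>" using G(3) C(1) by (simp add: w_def field_simps)
      finally have w: "p s (poly_op r P w) \<le> \<eta>" using C(2)[of w] by linarith
      have "(\<Sum>k\<in>G. \<phi> k x \<odot> e k) = y + (\<Sum>k\<in>G - {..<Suc n}. \<phi> k x \<odot> e k)"
        unfolding y_def using sum.subset_diff[OF G(2,1)] by (simp add: add.commute del: sum.lessThan_Suc)
      then have xy: "x - y = w + (\<Sum>k\<in>G - {..<Suc n}. \<phi> k x \<odot> e k)" by (simp add: w_def)
      have "p s (poly_op r P (\<Sum>k\<in>G - {..<Suc n}. \<phi> k x \<odot> e k))
          \<le> (\<Sum>k\<in>G - {..<Suc n}. p s (poly_op r P (\<phi> k x \<odot> e k)))"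
        unfolding poly_op_sum by (rule p_sum)
      also have "\<dots> \<le> (\<Sum>k\<in>G - {..<Suc n}. 2 * p (Suc s) x * (1/2) ^ k)"
      proof (rule sum_mono)
        fix k assume k: "k \<in> G - {..<Suc n}"
        have "p s (poly_op r P (e k)) \<le> (1/2) ^ k * p (Suc s) (e k)"
          using poly_op_tail[of P r k] P(1) k by (simp add: s r(2) n_def)
        then have "norm (\<phi> k x) * p s (poly_op r P (e k)) \<le> norm (\<phi> k x) * ((1/2) ^ k * p (Suc s) (e k))"
          by (rule mult_left_mono) simp
        also have "\<dots> = (1/2) ^ k * (norm (\<phi> k x) * p (Suc s) (e k))" by simp
        also have "\<dots> \<le> (1/2) ^ k * (2 * p (Suc s) x)" by (intro mult_left_mono \<phi>_bound) simp
        finally show "p s (poly_op r P (\<phi> k x \<odot> e k)) \<le> 2 * p (Suc s) x * (1/2) ^ k"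
          by (simp add: poly_op_scale mult_ac)
      qed
      also have "\<dots> = 2 * p (Suc s) x * (\<Sum>k\<in>G - {..<Suc n}. (1/2) ^ k)"
        by (simp add: sum_distrib_left)
      also have "\<dots> \<le> 2 * p (Suc s) x * (1/2) ^ n"
        using G(1) by (intro mult_left_mono half_power_sum) auto
      finally show "p s (poly_op r P (x - y)) \<le> 2 * p (Suc s) x * (1/2) ^ n + \<eta>"
        using w p_triangle[of s "poly_op r P w" "poly_op r P (\<Sum>k\<in>G - {..<Suc n}. \<phi> k x \<odot> e k)"]
        unfolding xy poly_op_add by linarith
    qed
    have "p s (poly_op r P (of_real (1 / \<mu>) \<odot> (x - y))) = p s (poly_op r P (x - y)) / \<mu>"
      using \<mu>0 by (simp add: poly_op_scale norm_divide)
    also have "\<dots> \<le> (X * (1/2) ^ n) / (\<kappa> / real (Suc n))"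
      using tail \<mu> \<kappa> X by (intro frac_le) (auto simp: X_def algebra_simps intro: order_trans)
    also have "\<dots> = 2 * X / \<kappa> * (real (Suc n) * (1/2) ^ Suc n)"
      by (simp only: power_Suc divide_divide_eq_right) simp
    also have "\<dots> < 2 * X / \<kappa> * (\<epsilon> * \<kappa> / (4 * X))"
      using N[of "Suc n"] r(1) nr X \<kappa> by (intro mult_strict_left_mono) auto
    also have "\<dots> = \<epsilon> / 2" using X \<kappa> by simp
    finally have "p s (poly_op r P (of_real (1 / \<mu>) \<odot> (x - y))) < \<epsilon> / 2" .
    moreover have eq: "z - u 0 = (poly_op r P (of_real (1 / \<mu>) \<odot> y) - u 0) + poly_op r P (of_real (1 / \<mu>) \<odot> (x - y))"
      by (simp add: z_def poly_op_diff scale_right_diff_distrib)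
    have "p s (z - u 0) \<le> p s (poly_op r P (of_real (1 / \<mu>) \<odot> y) - u 0)
        + p s (poly_op r P (of_real (1 / \<mu>) \<odot> (x - y)))"
      unfolding eq by (rule p_triangle)
    ultimately have "p s (z - u 0) < \<epsilon>" using head by linarith
    then show ?thesis using \<open>z \<in> M\<close> by blast
  qed
  then have "u 0 \<in> M" using M(2) unfolding closed_iff_p by blast
  then have uM: "u k \<in> M" for k using TM[of "u 0" k] by (simp add: funpow_u)
  have lam_e: "of_real (lam k) \<odot> e k \<in> M" for k
  proof (cases "parent k")
    case None
    then show ?thesis using uM[of k] by (simp add: u_None)
  next
    case (Some i)
    then show ?thesis using subspace_diff[OF M(1) uM[of k] uM[of i]] by (simp add: u_Some)
  qed
  have eM: "e k \<in> M" for k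
    using subspace_scale[OF M(1) lam_e[of k], of "inverse (of_real (lam k))"] lam_pos[of k] by simp
  have "v \<in> M" for v
  proof -
    have "\<exists>z\<in>M. p s (z - v) < \<epsilon>" if \<epsilon>: "0 < \<epsilon>" for s \<epsilon>
    proof -
      obtain G where "p s (v - (\<Sum>k\<in>G. \<phi> k v \<odot> e k)) < \<epsilon>"
        using approx[OF \<epsilon> finite.emptyI, of s v] by blast
      moreover have "(\<Sum>k\<in>G. \<phi> k v \<odot> e k) \<in> M"
        by (intro subspace_sum[OF M(1)] subspace_scale[OF M(1)] eM)
      ultimately show ?thesis using p_minus_commute by metis
    qed
    then show ?thesis using M(2) unfolding closed_iff_p by blast
  qed
  then show ?thesis by blast
qed

end

context leveled_basis begin

theorem operator_without_invariant_subspace: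
  "\<exists>T. Vector_Spaces.linear smul smul T \<and> continuous_on UNIV T \<and>
       \<not> (\<exists>M. subspace M \<and> closed M \<and> M \<noteq> {0} \<and> M \<noteq> UNIV \<and> T ` M \<subseteq> M)"
proof -
  obtain lam where lam: "leveled_orbit_axioms smul p e lam"
    using sizes unfolding leveled_orbit_axioms_def by metis
  interpret leveled_orbit smul p e \<phi> lam
    using leveled_basis_axioms lam by (rule leveled_orbit.intro)
  obtain T where T: "Vector_Spaces.linear smul smul T" "bounded_op T"
    "\<And>k. T (e k) = of_real (1 / lam k) \<odot> shifted k 1"
    using shift_operator by blast
  interpret leveled_shift smul p e \<phi> lam T
    using leveled_orbit_axioms leveled_shift_axioms.intro[OF T] by (rule leveled_shift.intro)
  have "continuous_on UNIV T" by (rule bounded_op_imp_continuous[OF T(1,2)])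
  moreover have "\<not> (\<exists>M. subspace M \<and> closed M \<and> M \<noteq> {0} \<and> M \<noteq> UNIV \<and> T ` M \<subseteq> M)"
    using no_invariant_subspace subspace_0 by blast
  ultimately show ?thesis using T(1) by blast
qed

end

section \<open>The characterisation\<close>

text \<open>
  The spanning set \<open>B\<close> is allowed to lie outside of \<open>V\<close>.
\<close>

lemma (in vector_space) finite_codim_inI:
  assumes W: "W \<subseteq> V" "subspace V" and B: "finite B" "\<And>v. v \<in> V \<Longrightarrow> \<exists>c\<in>span B. v - c \<in> W"
  shows "finite_codim_in scale W V"
proof -
  obtain C where C: "C \<subseteq> V \<inter> span B" "independent C" "V \<inter> span B \<subseteq> span C"
    using maximal_independent_subset[of "V \<inter> span B"] by metis
  have "finite C" using independent_span_bound[OF B(1) C(2)] C(1) by blast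
  moreover have "\<exists>c\<in>span C. v - c \<in> W" if v: "v \<in> V" for v
  proof -
    obtain c where c: "c \<in> span B" "v - c \<in> W" using B(2)[OF v] by blast
    then have "v - c \<in> V" using W(1) by blast
    then have "v - (v - c) \<in> V" by (rule subspace_diff[OF W(2) v])
    then have "c \<in> V" by simp
    then show ?thesis using c C(3) by auto
  qed
  ultimately show ?thesis using W(1) C(1) unfolding finite_codim_in_def by blast
qed

context schauder_frechet begin

text \<open>
  If only finitely many basis vectors lay in \<open>Ker j\<close> and outside of \<open>Ker (Suc l)\<close>, they would span
  \<open>Ker l\<close> modulo \<open>Ker (Suc l)\<close>, because \<open>Ker l\<close> is contained in the kernel of \<open>q j\<close> for large \<open>l\<close>.
\<close>

lemma infinite_index_gap:
  assumes codim: "\<And>j0. \<exists>j\<ge>j0. \<not> finite_codim_in smul (Ker (Suc j)) (Ker j)"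
  shows "\<exists>k>j. infinite {i. p j (b i) = 0 \<and> p k (b i) \<noteq> 0}"
proof -
  obtain K C where K: "\<And>x. q j x \<le> C * p K x" using q_bounded by blast
  obtain l where l: "max K j \<le> l" "\<not> finite_codim_in smul (Ker (Suc l)) (Ker l)"
    using codim by blast
  define D where "D = {i. p j (b i) = 0 \<and> p (Suc l) (b i) \<noteq> 0}"
  have "infinite D"
  proof
    assume D: "finite D"
    have "finite_codim_in smul (Ker (Suc l)) (Ker l)"
    proof (rule finite_codim_inI)
      show "Ker (Suc l) \<subseteq> Ker l" by (rule Ker_mono) simp
      show "finite (b ` D)" using D by simp
      fix v assume v: "v \<in> Ker l"
      then have "p K v = 0" using p_eq_0_mono[of K l v] l(1) by simp
      then have "q j v = 0" using K[of v] q_nonneg[of j v] by simp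
      then have co0: "coord v i = 0" if "p j (b i) \<noteq> 0" for i using that q_eq_0_iff by blast
      define c where "c = (\<Sum>i\<in>D. coord v i \<odot> b i)"
      have "coord (v - c) i = coord v i - (\<Sum>k\<in>D. if k = i then coord v k else 0)" for i
        unfolding c_def coord_diff coord_sum coord_scale coord_b
        by (intro arg_cong2[of _ _ _ _ "(-)"] refl sum.cong) auto
      then have "coord (v - c) i = (if i \<in> D then 0 else coord v i)" for i using D by simp
      then have "q (Suc l) (v - c) = 0" unfolding q_eq_0_iff using co0 by (auto simp: D_def)
      then have "v - c \<in> Ker (Suc l)"
        using p_le_q[of "Suc l" "v - c"] p_nonneg[of "Suc l" "v - c"] by simp
      moreover have "c \<in> span (b ` D)"
        unfolding c_def by (intro span_sum span_scale span_base) auto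
      ultimately show "\<exists>c\<in>span (b ` D). v - c \<in> Ker (Suc l)" by blast
    qed (rule subspace_ker)
    with l(2) show False by simp
  qed
  then show ?thesis using l(1) unfolding D_def by (intro exI[of _ "Suc l"]) auto
qed

text \<open>
  A subsequence \<open>P\<close> of the seminorms \<open>q j\<close> has infinitely many basis vectors at each level, and matching
  them with the positions of that level is a permutation \<open>\<sigma>\<close> of the basis.
\<close>

theorem infinite_codim_imp_operator:
  assumes codim: "\<And>j0. \<exists>j\<ge>j0. \<not> finite_codim_in smul (Ker (Suc j)) (Ker j)"
  shows "\<exists>T. Vector_Spaces.linear smul smul T \<and> continuous_on UNIV T \<and>
       \<not> (\<exists>M. subspace M \<and> closed M \<and> M \<noteq> {0} \<and> M \<noteq> UNIV \<and> T ` M \<subseteq> M)"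
proof -
  obtain nxt where nxt: "\<And>j. j < nxt j" "\<And>j. infinite {i. p j (b i) = 0 \<and> p (nxt j) (b i) \<noteq> 0}"
    using infinite_index_gap[OF codim] by metis
  define js where "js m = (nxt ^^ m) 0" for m
  have js: "js m < js (Suc m)" "infinite {i. p (js m) (b i) = 0 \<and> p (js (Suc m)) (b i) \<noteq> 0}" for m
    using nxt by (simp_all add: js_def)
  have js_mono: "js m \<le> js n" if "m \<le> n" for m n
    using that by (rule lift_Suc_mono_le[of js, rotated]) (rule less_imp_le[OF js(1)])
  have js_ge: "m \<le> js m" for m
  proof (induction m)
    case (Suc m)
    then show ?case using js(1)[of m] by linarith
  qed simp
  define P where "P m = q (js (Suc m))" for m
  have p_le_P: "p m x \<le> P m x" for m x
    using p_le_q[of m x] q_mono[of m "js (Suc m)" x] js_ge[of "Suc m"] by (simp add: P_def)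
  have P_bound: "\<exists>k C. 0 \<le> C \<and> (\<forall>x. P m x \<le> C * p k x)" for m
    unfolding P_def by (rule q_bounded)
  have P_lim: "(\<lambda>n. P m (v n)) \<longlonglongrightarrow> 0" if "\<And>j. (\<lambda>n. p j (v n)) \<longlonglongrightarrow> 0" for m v
  proof -
    obtain k C where k: "0 \<le> C" "\<And>x. P m x \<le> C * p k x" using P_bound by blast
    have "(\<lambda>n. C * p k (v n)) \<longlonglongrightarrow> 0" using tendsto_mult[OF tendsto_const that, of C] by simp
    then show ?thesis
      by (rule tendsto_sandwich[OF always_eventually always_eventually tendsto_const, rotated -1])
         (use k(2) in \<open>auto simp: P_def\<close>)
  qed
  have graded_P: "graded_frechet smul P"
  proof (intro graded_frechet.intro graded_space.intro graded_space_axioms.intro graded_frechet_axioms.intro)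
    show "vector_space smul" by (rule vector_space_axioms)
    show "seminorm smul (P j)" for j unfolding P_def by (rule seminorm_q)
    show "P j x \<le> P (Suc j) x" for j x unfolding P_def by (intro q_mono js_mono) simp
    show "open U \<longleftrightarrow> (\<forall>x\<in>U. \<exists>j \<epsilon>. 0 < \<epsilon> \<and> {y. P j (y - x) < \<epsilon>} \<subseteq> U)" for U
    proof -
      have "\<exists>j \<epsilon>. 0 < \<epsilon> \<and> {y. P j (y - x) < \<epsilon>} \<subseteq> U" if "0 < \<epsilon>" "{y. p j (y - x) < \<epsilon>} \<subseteq> U" for x j \<epsilon>
        using that p_le_P by (intro exI[of _ j] exI[of _ \<epsilon>]) (auto intro: le_less_trans)
      moreover have "\<exists>j \<epsilon>. 0 < \<epsilon> \<and> {y. p j (y - x) < \<epsilon>} \<subseteq> U"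
        if \<epsilon>: "0 < \<epsilon>" and U: "{y. P j (y - x) < \<epsilon>} \<subseteq> U" for x j \<epsilon>
      proof -
        obtain k C where k: "0 \<le> C" "\<And>x. P j x \<le> C * p k x" using P_bound by blast
        have "P j (y - x) < \<epsilon>" if "p k (y - x) < \<epsilon> / (C + 1)" for y
        proof -
          have "P j (y - x) \<le> C * p k (y - x)" by (rule k)
          also have "\<dots> \<le> (C + 1) * p k (y - x)" by (simp add: mult_right_mono)
          also have "\<dots> < \<epsilon>" using that k(1) by (simp add: field_simps)
          finally show ?thesis .
        qed
        then show ?thesis using U \<epsilon> k(1) by (intro exI[of _ k] exI[of _ "\<epsilon> / (C + 1)"]) auto
      qed
      ultimately show ?thesis unfolding open_iff by meson
    qed
    show "\<exists>x. \<forall>j. (\<lambda>n. P j (v n - x)) \<longlonglongrightarrow> 0"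
      if v: "\<And>j \<epsilon>. 0 < \<epsilon> \<Longrightarrow> \<exists>N. \<forall>m\<ge>N. \<forall>n\<ge>N. P j (v m - v n) < \<epsilon>" for v
    proof -
      have "\<exists>N. \<forall>m\<ge>N. \<forall>n\<ge>N. p j (v m - v n) < \<epsilon>" if "0 < \<epsilon>" for j \<epsilon>
        using v[OF that, of j] p_le_P by (meson le_less_trans)
      then obtain x where "\<And>j. (\<lambda>n. p j (v n - x)) \<longlonglongrightarrow> 0" using complete[of v] by blast
      then have "(\<lambda>n. P j (v n - x)) \<longlonglongrightarrow> 0" for j by (rule P_lim)
      then show ?thesis by blast
    qed
  qed
  define lev where "lev i = (LEAST m. P m (b i) \<noteq> 0)" for i
  have Pb: "P m (b i) = p (js (Suc m)) (b i)" for m i by (simp add: P_def q_b)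
  have lev: "P s (b i) = 0 \<longleftrightarrow> s < lev i" for s i
  proof -
    obtain j where "p j (b i) \<noteq> 0" using b_visible by blast
    then have "P j (b i) \<noteq> 0" using p_le_P[of j "b i"] p_nonneg[of j "b i"] by linarith
    then have least: "P (lev i) (b i) \<noteq> 0" unfolding lev_def by (rule LeastI)
    show ?thesis
    proof
      assume "s < lev i"
      then show "P s (b i) = 0" unfolding lev_def by (metis not_less_Least)
    next
      assume s: "P s (b i) = 0"
      show "s < lev i"
      proof (rule ccontr)
        assume "\<not> s < lev i"
        then have "P (lev i) (b i) = 0"
          using s p_eq_0_mono[of "js (Suc (lev i))" "js (Suc s)" "b i"] js_mono unfolding Pb by simp
        with least show False by simp
      qed
    qed
  qed
  have inf_lev: "infinite {i. lev i = v}" for v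
  proof -
    have "{i. p (js v) (b i) = 0 \<and> p (js (Suc v)) (b i) \<noteq> 0} \<subseteq> {i. lev i = v}"
    proof
      fix i assume "i \<in> {i. p (js v) (b i) = 0 \<and> p (js (Suc v)) (b i) \<noteq> 0}"
      then have i: "p (js v) (b i) = 0" "\<not> v < lev i" using lev[of v i] by (auto simp: Pb)
      have "v \<le> lev i"
      proof (cases v)
        case (Suc w)
        then show ?thesis using i(1) lev[of w i] by (simp add: Pb)
      qed simp
      with i(2) show "i \<in> {i. lev i = v}" by simp
    qed
    then show ?thesis using js(2) finite_subset by blast
  qed
  define \<sigma> where "\<sigma> k = from_nat_into {i. lev i = level k} (to_nat_on {l. level l = level k} k)" for k
  have bij_level: "bij_betw (from_nat_into {i. lev i = v} \<circ> to_nat_on {l. level l = v}) {l. level l = v} {i. lev i = v}" for v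
    using to_nat_on_infinite[OF _ level_infinite] bij_betw_from_nat_into[OF _ inf_lev]
    by (intro bij_betw_trans) auto
  have lev_\<sigma>: "lev (\<sigma> k) = level k" for k
    using bij_betwE[OF bij_level[of "level k"]] by (simp add: \<sigma>_def)
  have "inj \<sigma>"
  proof (rule injI)
    fix k l assume eq: "\<sigma> k = \<sigma> l"
    then have "level k = level l" using lev_\<sigma> by metis
    then show "k = l"
      using eq bij_betw_imp_inj_on[OF bij_level[of "level k"]] by (simp add: \<sigma>_def inj_on_def)
  qed
  moreover have "surj \<sigma>"
    unfolding surj_def
  proof
    fix i
    have "i \<in> (from_nat_into {i'. lev i' = lev i} \<circ> to_nat_on {l. level l = lev i}) ` {l. level l = lev i}"
      using bij_betw_imp_surj_on[OF bij_level[of "lev i"]] by simp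
    then obtain k where "level k = lev i"
      "i = from_nat_into {i'. lev i' = lev i} (to_nat_on {l. level l = lev i} k)" by auto
    then have "i = \<sigma> k" by (simp add: \<sigma>_def)
    then show "\<exists>k. i = \<sigma> k" by blast
  qed
  ultimately have bij: "bij \<sigma>" by (simp add: bij_def)
  have "leveled_basis smul P (\<lambda>k. b (\<sigma> k)) (\<lambda>k x. coord x (\<sigma> k))"
  proof (intro leveled_basis.intro leveled_basis_axioms.intro)
    show "graded_frechet smul P" by (rule graded_P)
    show "linfun (\<lambda>x. coord x (\<sigma> k))" for k by (rule linfun_coord)
    show "coord (b (\<sigma> l)) (\<sigma> k) = (if k = l then 1 else 0)" for k l
      using \<open>inj \<sigma>\<close> by (simp add: coord_b inj_eq)
    show "norm (coord x (\<sigma> k)) * P s (b (\<sigma> k)) \<le> 2 * P s x" for k x s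
      unfolding P_def q_b by (rule coord_bound)
    show "P s (b (\<sigma> k)) = 0 \<longleftrightarrow> s < level k" for s k using lev lev_\<sigma> by simp
    show "\<exists>G. finite G \<and> F \<subseteq> G \<and> P s (x - (\<Sum>k\<in>G. coord x (\<sigma> k) \<odot> b (\<sigma> k))) < \<epsilon>"
      if \<epsilon>: "0 < \<epsilon>" and F: "finite F" for \<epsilon> F s x
    proof -
      have "(\<lambda>n. p j (x - S n x)) \<longlonglongrightarrow> 0" for j
        using S_tendsto[of j x] by (simp add: p_minus_commute)
      then have "\<forall>\<^sub>F n in sequentially. P s (x - S n x) < \<epsilon>"
        using \<epsilon> by (intro order_tendstoD(2)[OF P_lim]) auto
      then obtain N where N: "\<And>n. N \<le> n \<Longrightarrow> P s (x - S n x) < \<epsilon>"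
        unfolding eventually_sequentially by blast
      define n where "n = max N (Suc (Max (insert 0 (\<sigma> ` F))))"
      define G where "G = \<sigma> -` {..<n}"
      have "F \<subseteq> G"
      proof
        fix k assume "k \<in> F"
        then have "\<sigma> k \<le> Max (insert 0 (\<sigma> ` F))" using F by (intro Max_ge) auto
        then show "k \<in> G" by (simp add: G_def n_def)
      qed
      moreover have "finite G" unfolding G_def using \<open>inj \<sigma>\<close> by (intro finite_vimageI) auto
      moreover have "bij_betw \<sigma> G {..<n}"
        using bij unfolding G_def bij_betw_def
        by (auto simp: inj_on_def surj_image_vimage_eq bij_def)
      then have "S n x = (\<Sum>k\<in>G. coord x (\<sigma> k) \<odot> b (\<sigma> k))"
        unfolding S_def using sum.reindex_bij_betw[of \<sigma> G "{..<n}" "\<lambda>i. coord x i \<odot> b i"] by simp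
      ultimately show ?thesis using N[of n] by (intro exI[of _ G]) (simp add: n_def)
    qed
  qed
  from leveled_basis.operator_without_invariant_subspace[OF this] show ?thesis .
qed

end

text \<open>
  As the seminorms increase, a finite set of them may be replaced by its largest member; and they are
  renumbered from \<open>0\<close>.
\<close>

lemma graded_frechetI:
  fixes smul :: "'k::{real_normed_field,banach} \<Rightarrow> 'a::{ab_group_add,t2_space} \<Rightarrow> 'a"
  assumes frechet: "frechet_space smul" and p: "increasing_inducing_seminorms smul p"
  shows "graded_frechet smul (\<lambda>j. p (Suc j))"
proof -
  have mono: "p i x \<le> p j x" if "1 \<le> i" "i \<le> j" for i j x
    using that(2)
  proof (induction j rule: dec_induct)
    case (step n)
    then have "p n x \<le> p (n + 1) x" using p that(1) by (simp add: increasing_inducing_seminorms_def)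
    with step.IH show ?case by simp
  qed simp
  have open_iff: "open U \<longleftrightarrow> (\<forall>x\<in>U. \<exists>j \<epsilon>. 0 < \<epsilon> \<and> {y. p (Suc j) (y - x) < \<epsilon>} \<subseteq> U)" for U :: "'a set"
  proof -
    have "(\<exists>F \<epsilon>. finite F \<and> F \<subseteq> p ` {1..} \<and> 0 < \<epsilon> \<and> {y. \<forall>q\<in>F. q (y - x) < \<epsilon>} \<subseteq> U)
        \<longleftrightarrow> (\<exists>j \<epsilon>. 0 < \<epsilon> \<and> {y. p (Suc j) (y - x) < \<epsilon>} \<subseteq> U)" (is "?L \<longleftrightarrow> ?R") for x
    proof
      assume ?L
      then obtain F \<epsilon> where F: "finite F" "F \<subseteq> p ` {1..}" "0 < \<epsilon>" "{y. \<forall>q\<in>F. q (y - x) < \<epsilon>} \<subseteq> U"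
        by blast
      obtain I where I: "I \<subseteq> {1..}" "finite I" "F = p ` I" using finite_subset_image[OF F(1,2)] by blast
      define m where "m = Max (insert 0 I)"
      have "p i z \<le> p (Suc m) z" if "i \<in> I" for i z
      proof (rule mono)
        show "1 \<le> i" using I(1) that by auto
        have "i \<le> m" unfolding m_def using I(2) that by (intro Max_ge) auto
        then show "i \<le> Suc m" by simp
      qed
      then have "{y. p (Suc m) (y - x) < \<epsilon>} \<subseteq> {y. \<forall>q\<in>F. q (y - x) < \<epsilon>}"
        using I(3) by (auto intro: le_less_trans)
      then have "{y. p (Suc m) (y - x) < \<epsilon>} \<subseteq> U" using F(4) by (rule order_trans)
      then show ?R using F(3) by blast
    next
      assume ?R
      then obtain j \<epsilon> where "0 < \<epsilon>" "{y. p (Suc j) (y - x) < \<epsilon>} \<subseteq> U" by blast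
      then show ?L by (intro exI[of _ "{p (Suc j)}"] exI[of _ \<epsilon>]) auto
    qed
    then show ?thesis using p
      unfolding increasing_inducing_seminorms_def induces_topology_def by simp
  qed
  have space: "graded_space smul (\<lambda>j. p (Suc j))"
  proof (intro graded_space.intro graded_space_axioms.intro)
    show "vector_space smul" using frechet by (simp add: frechet_space_def)
    show "seminorm smul (p (Suc j))" for j using p by (simp add: increasing_inducing_seminorms_def)
  qed (auto simp: open_iff mono)
  interpret graded_space smul "\<lambda>j. p (Suc j)" by (rule space)
  show ?thesis
  proof (intro graded_frechet.intro graded_frechet_axioms.intro space)
    fix u :: "nat \<Rightarrow> 'a"
    assume u: "\<And>j \<epsilon>. 0 < \<epsilon> \<Longrightarrow> \<exists>N. \<forall>m\<ge>N. \<forall>n\<ge>N. p (Suc j) (u m - u n) < \<epsilon>"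
    have "tvs_Cauchy u"
      unfolding tvs_Cauchy_def
    proof (intro allI impI)
      fix U :: "'a set" assume "open U \<and> 0 \<in> U"
      then obtain j \<epsilon> where j: "0 < \<epsilon>" "{y. p (Suc j) (y - 0) < \<epsilon>} \<subseteq> U" using open_iff by blast
      obtain N where "\<forall>m\<ge>N. \<forall>n\<ge>N. p (Suc j) (u m - u n) < \<epsilon>" using u[OF j(1)] by blast
      then show "\<exists>N. \<forall>m\<ge>N. \<forall>n\<ge>N. u m - u n \<in> U" using j(2) by (intro exI[of _ N]) auto
    qed
    then have "convergent u" using frechet by (simp add: frechet_space_def)
    then show "\<exists>x. \<forall>j. (\<lambda>n. p (Suc j) (u n - x)) \<longlonglongrightarrow> 0"
      unfolding convergent_def LIMSEQ_iff_p .
  qed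
qed

theorem invariant_subspace_property_iff:
  fixes smul :: "'k::{real_normed_field,banach} \<Rightarrow> 'a::{ab_group_add,t2_space} \<Rightarrow> 'a"
  assumes frechet: "frechet_space smul" and basis: "schauder_basis smul b"
    and no_norm: "without_continuous_norm smul" and p: "increasing_inducing_seminorms smul p"
  shows "invariant_subspace_property smul \<longleftrightarrow>
    (\<exists>j0\<ge>1. \<forall>j\<ge>j0. finite_codim_in smul (seminorm_ker (p (j + 1))) (seminorm_ker (p j)))"
proof -
  interpret graded_frechet smul "\<lambda>j. p (Suc j)" by (rule graded_frechetI[OF frechet p])
  interpret schauder_frechet smul "\<lambda>j. p (Suc j)" b by unfold_locales (rule basis)
  show ?thesis
  proof
    assume isp: "invariant_subspace_property smul"
    show "\<exists>j0\<ge>1. \<forall>j\<ge>j0. finite_codim_in smul (seminorm_ker (p (j + 1))) (seminorm_ker (p j))"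
    proof (rule ccontr)
      assume no: "\<not> ?thesis"
      have "\<exists>j\<ge>j0. \<not> finite_codim_in smul (Ker (Suc j)) (Ker j)" for j0
      proof -
        obtain j where j: "Suc j0 \<le> j" "\<not> finite_codim_in smul (seminorm_ker (p (j + 1))) (seminorm_ker (p j))"
          using no[simplified not_ex de_Morgan_conj not_all not_imp, rule_format, of "Suc j0"] by auto
        then show ?thesis
          by (intro exI[of _ "j - 1"]) (auto simp: seminorm_ker_def)
      qed
      from infinite_codim_imp_operator[OF this] isp show False
        unfolding invariant_subspace_property_def by blast
    qed
  next
    assume "\<exists>j0\<ge>1. \<forall>j\<ge>j0. finite_codim_in smul (seminorm_ker (p (j + 1))) (seminorm_ker (p j))"
    then obtain j0 where j0: "\<forall>j\<ge>j0. finite_codim_in smul (seminorm_ker (p (j + 1))) (seminorm_ker (p j))"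
      by blast
    have codim: "finite_codim_in smul (Ker (Suc j)) (Ker j)" if "j0 \<le> j" for j
      using j0[rule_format, of "Suc j"] that by (simp add: seminorm_ker_def)
    have "Ker j \<noteq> {0}" for j
      using no_norm seminorm_p[of j] continuous_p[of j] unfolding without_continuous_norm_def by blast
    then show "invariant_subspace_property smul"
      unfolding invariant_subspace_property_def
      using codim_imp_invariant_subspace[OF codim] continuous_imp_bounded_op by blast
  qed
qed

theorem theorem1p1:
  shows "(\<forall>(smul :: real \<Rightarrow> 'a::{ab_group_add,t2_space} \<Rightarrow> 'a) p.
            frechet_space smul \<and> (\<exists>e. schauder_basis smul e) \<and>
            without_continuous_norm smul \<and> increasing_inducing_seminorms smul p \<longrightarrow>
            (invariant_subspace_property smul \<longleftrightarrow>
             (\<exists>j0\<ge>1. \<forall>j\<ge>j0. finite_codim_in smul (seminorm_ker (p (j + 1))) (seminorm_ker (p j)))))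
         \<and>
         (\<forall>(smul :: complex \<Rightarrow> 'a::{ab_group_add,t2_space} \<Rightarrow> 'a) p.
            frechet_space smul \<and> (\<exists>e. schauder_basis smul e) \<and>
            without_continuous_norm smul \<and> increasing_inducing_seminorms smul p \<longrightarrow>
            (invariant_subspace_property smul \<longleftrightarrow>
             (\<exists>j0\<ge>1. \<forall>j\<ge>j0. finite_codim_in smul (seminorm_ker (p (j + 1))) (seminorm_ker (p j)))))"
  by (intro conjI allI impI; elim conjE exE; rule invariant_subspace_property_iff)

end
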